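(* Let $M$ be a piecewise flat Finsler surface and $T_xM$ the tangent cone at a vertex $x\in M$. Let $c(t)$ be a geodesic in $T_xM$. Suppose that there exists $x'=c(t')\neq x$ such that the tangent vector $\dot c^+(t')$ or $\dot c^-(t')$ at $x'$ is not tangent to the ray from $x$ through $x'$. Then $c(t)$ can be uniquely extended to a geodesic defined on $(-\infty,\infty)$, and this geodesic is a union of finitely many line segments and two rays, $$\{c(t),t\in(-\infty,\infty)\}=R_{x_1,v_1^-}\cup\Big(\bigcup_{i=1}^{m-1}L_{x_i,x_{i+1}}\Big)\cup R_{x_m,v_m^+},$$ where $R_{x_1,v_1^-},L_{x_1,x_2},\ldots,L_{x_{m-1},x_m},R_{x_m,v_m^+}$ are contained in Minkowski cones $C_{x,0},C_{x,1},\ldots,C_{x,m-1},C_{x,m}$ of $T_xM$ respectively, and each $x_i\neq x$ is contained in the edge $E_i=C_{x,i-1}\cap C_{x,i}$. In particular, the geodesic $\{c(t),t\in(-\infty,\infty)\}$ does not pass through $x$, and none of the line segments and rays in this decomposition is contained in an edge.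
   Context: A Minkowski norm on a finite-dimensional real vector space $V$ is a continuous $F:V\to[0,\infty)$, smooth and positive on $V\setminus\{0\}$, with $F(\lambda y)=\lambda F(y)$ for $\lambda\ge0$, such that for every $y\ne0$ the bilinear form $\langle u,v\rangle^F_y=\frac12\frac{\partial^2}{\partial s\partial t}F^2(y+su+tv)|_{s=t=0}$ is positive definite ($F(-y)=F(y)$ is not required). A Minkowski plane is $\mathbb R^2$ with the translation-invariant Finsler metric given by a Minkowski norm. A piecewise flat Finsler surface is a surface $M$ (without boundary) with a locally finite triangulation $M=\bigcup T_i$ by closed triangles, different triangles being disjoint or meeting in exactly one common edge or one common vertex, where each $T_i$ carries a flat metric $F_i$ such that $(T_i,F_i)$ is isometric to a straight-edged triangle in a Minkowski plane, and $F_i,F_j$ coincide on a common edge of $T_i,T_j$. Tangent cone: let $(T_1,F_1),\dots,(T_n,F_n)$ be the closed triangles containing $x$. Each is enlarged to a Minkowski cone $C_{x,i}$ with vertex $x$ (the planar sector at $x$ spanned by $T_i$) with $F_i$ extended to it; $T_xM=\bigcup_i C_{x,i}$, glued along common boundary rays. For $i\ne j$, $C_{x,i}\cap C_{x,j}$ is $\{x\}$ or a ray at $x$, called an edge. When $x$ is a vertex of $M$ there are at least three cones. In the claim the cones are indexed consecutively in the order they are met around $x$, and repetitions are allowed (the geodesic may a priori wind around $x$). A piecewise smooth curve is locally a finite union of smooth curves on closed intervals, each in a single cone; its length is $\int F(\dot c)\,dt$ (using the norm of the cone), and $d(p,q)$ is the infimum of lengths of piecewise smooth paths from $p$ to $q$.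 A geodesic is a piecewise smooth curve with constant nonzero speed that is locally minimizing: every $t_0$ has an $\varepsilon>0$ such that for $t_1<t_2$ in the domain within $\varepsilon$ of $t_0$ the length of $c|_{[t_1,t_2]}$ equals $d(c(t_1),c(t_2))$. $\dot c^-(t)$ and $\dot c^+(t)$ are the one-sided derivatives, viewed as incoming (arrow ending at $c(t)$) and outgoing (arrow starting at $c(t)$) tangent vectors. $L_{p,q}$ is the straight segment from $p$ to $q$ in a cone; $R_{p,v^+}$ is the ray starting at $p$ in direction of the outgoing vector $v^+$; $R_{p,v^-}$ is the ray ending at $p$ with direction the incoming vector $v^-$. *)

theory Defs
  imports "HOL-Analysis.Analysis"
begin

section \<open>Minkowski norms\<close>

text \<open>Real functions of class \<open>C\<^sup>k\<close> on an open set.\<close>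

primrec Ck_on :: "nat \<Rightarrow> 'v::euclidean_space set \<Rightarrow> ('v \<Rightarrow> real) \<Rightarrow> bool" where
  "Ck_on 0 S f \<longleftrightarrow> continuous_on S f"
| "Ck_on (Suc k) S f \<longleftrightarrow>
     (\<forall>x\<in>S. f differentiable (at x)) \<and>
     (\<forall>b\<in>Basis. Ck_on k S (\<lambda>x. frechet_derivative f (at x) b))"

definition Cinfinity_on :: "'v::euclidean_space set \<Rightarrow> ('v \<Rightarrow> real) \<Rightarrow> bool" where
  "Cinfinity_on S f \<longleftrightarrow> (\<forall>k. Ck_on k S f)"

definition fundamental_form :: "('v::euclidean_space \<Rightarrow> real) \<Rightarrow> 'v \<Rightarrow> 'v \<Rightarrow> 'v \<Rightarrow> real" where
  "fundamental_form F y u v =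
     1 / 2 * deriv (\<lambda>s. deriv (\<lambda>t. (F (y + s *\<^sub>R u + t *\<^sub>R v))\<^sup>2) 0) 0"

definition minkowski_norm :: "('v::euclidean_space \<Rightarrow> real) \<Rightarrow> bool" where
  "minkowski_norm F \<longleftrightarrow>
     continuous_on UNIV F \<and>
     (\<forall>y. 0 \<le> F y) \<and>
     (\<forall>y. y \<noteq> 0 \<longrightarrow> 0 < F y) \<and>
     Cinfinity_on (- {0}) F \<and>
     (\<forall>r y. 0 \<le> r \<longrightarrow> F (r *\<^sub>R y) = r * F y) \<and>
     (\<forall>y u. y \<noteq> 0 \<longrightarrow> u \<noteq> 0 \<longrightarrow> 0 < fundamental_form F y u u)"

section \<open>Piecewise flat Finsler surfaces\<close>

definition surface :: "'a topology \<Rightarrow> bool" where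
  "surface X \<longleftrightarrow>
     Hausdorff_space X \<and> second_countable X \<and>
     (\<forall>p\<in>topspace X. \<exists>U W. openin X U \<and> p \<in> U \<and> open W \<and>
        subtopology X U homeomorphic_space top_of_set (W :: (real^2) set))"

text \<open>The flat metric of the triangle \<open>tri M i\<close> is the one pulled back by the isometry
  \<open>chart M i\<close> onto a straight-edged triangle of the Minkowski plane \<open>(real^2, nrm M i)\<close>.
  Only the indices in \<open>idx M\<close> are relevant.\<close>

record ('a, 'i) pf_surface =
  surf_top :: "'a topology"
  idx :: "'i set"
  tri :: "'i \<Rightarrow> 'a set"
  chart :: "'i \<Rightarrow> 'a \<Rightarrow> real^2"
  nrm :: "'i \<Rightarrow> real^2 \<Rightarrow> real"

definition tri_vertices :: "('a, 'i) pf_surface \<Rightarrow> 'i \<Rightarrow> 'a set" where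
  "tri_vertices M i = {p \<in> tri M i. chart M i p extreme_point_of (chart M i ` tri M i)}"

definition tri_edges :: "('a, 'i) pf_surface \<Rightarrow> 'i \<Rightarrow> 'a set set" where
  "tri_edges M i = {e. e \<subseteq> tri M i \<and> (chart M i ` e) edge_of (chart M i ` tri M i)}"

text \<open>In the last clause \<open>p\<close> and \<open>q\<close> run over all ordered pairs of points of a common edge,
  so the two metrics are required to agree along the edge in both directions; this also
  makes the change of charts affine on the edge.\<close>

definition pf_finsler_surface :: "('a, 'i) pf_surface \<Rightarrow> bool" where
  "pf_finsler_surface M \<longleftrightarrow>
     surface (surf_top M) \<and>
     topspace (surf_top M) = (\<Union>i\<in>idx M. tri M i) \<and>
     locally_finite_in (surf_top M) (tri M ` idx M) \<and>
     (\<forall>i\<in>idx M. minkowski_norm (nrm M i) \<and>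
        (\<exists>a b c. \<not> collinear {a, b, c} \<and>
           homeomorphic_map (subtopology (surf_top M) (tri M i))
             (top_of_set (convex hull {a, b, c})) (chart M i))) \<and>
     (\<forall>i\<in>idx M. \<forall>j\<in>idx M. i \<noteq> j \<longrightarrow>
        tri M i \<inter> tri M j = {} \<or>
        (\<exists>p \<in> tri_vertices M i \<inter> tri_vertices M j. tri M i \<inter> tri M j = {p}) \<or>
        tri M i \<inter> tri M j \<in> tri_edges M i \<inter> tri_edges M j) \<and>
     (\<forall>i\<in>idx M. \<forall>j\<in>idx M. \<forall>p \<in> tri M i \<inter> tri M j. \<forall>q \<in> tri M i \<inter> tri M j.
        nrm M i (chart M i q - chart M i p) = nrm M j (chart M j q - chart M j p))"

definition is_vertex :: "('a, 'i) pf_surface \<Rightarrow> 'a \<Rightarrow> bool" where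
  "is_vertex M x \<longleftrightarrow> (\<exists>i\<in>idx M. x \<in> tri_vertices M i)"

section \<open>The tangent cone at a vertex\<close>

definition star :: "('a, 'i) pf_surface \<Rightarrow> 'a \<Rightarrow> 'i set" where
  "star M x = {i \<in> idx M. x \<in> tri M i}"

definition sector :: "('a, 'i) pf_surface \<Rightarrow> 'a \<Rightarrow> 'i \<Rightarrow> (real^2) set" where
  "sector M x i = cone hull ((\<lambda>q. chart M i q - chart M i x) ` tri M i)"

text \<open>The tangent cone is the disjoint union of the sectors (with their vertices at the
  origin) modulo gluing along the rays spanned by common edges and at the vertices. Its points
  are equivalence classes of pairs (index of a sector, vector in that sector).\<close>

definition glue ::
  "('a, 'i) pf_surface \<Rightarrow> 'a \<Rightarrow> (('i \<times> (real^2)) \<times> ('i \<times> (real^2))) set" where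
  "glue M x =
     {((i, v), (j, w)). i \<in> star M x \<and> j \<in> star M x \<and>
        (\<exists>q \<in> tri M i \<inter> tri M j. \<exists>s\<ge>0.
           v = s *\<^sub>R (chart M i q - chart M i x) \<and>
           w = s *\<^sub>R (chart M j q - chart M j x))}"

definition tcone :: "('a, 'i) pf_surface \<Rightarrow> 'a \<Rightarrow> ('i \<times> (real^2)) set set" where
  "tcone M x = (SIGMA i : star M x. sector M x i) // glue M x"

definition pt :: "('a, 'i) pf_surface \<Rightarrow> 'a \<Rightarrow> 'i \<Rightarrow> real^2 \<Rightarrow> ('i \<times> (real^2)) set" where
  "pt M x i v = glue M x `` {(i, v)}"

definition apex :: "('a, 'i) pf_surface \<Rightarrow> 'a \<Rightarrow> ('i \<times> (real^2)) set" where
  "apex M x = star M x \<times> {0}"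

text \<open>\<open>mcone M x i\<close> is the Minkowski cone \<open>C\<^bsub>x,i\<^esub>\<close> as a subset of the tangent cone, and
  \<open>coord i\<close> is the inverse of \<open>pt M x i\<close> on it.\<close>

definition mcone :: "('a, 'i) pf_surface \<Rightarrow> 'a \<Rightarrow> 'i \<Rightarrow> ('i \<times> (real^2)) set set" where
  "mcone M x i = {p \<in> tcone M x. \<exists>v. (i, v) \<in> p}"

definition coord :: "'i \<Rightarrow> ('i \<times> (real^2)) set \<Rightarrow> real^2" where
  "coord i p = (THE v. (i, v) \<in> p)"

text \<open>\<open>ray M x i p v\<close> starts at \<open>p\<close> in direction \<open>v\<close>; the ray ending at \<open>p\<close> with
  incoming direction \<open>v\<close> is \<open>ray M x i p (- v)\<close>. For vectors \<open>w\<close> outside the sector,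
  \<open>pt M x i w\<close> is not a point of the tangent cone, so that an inclusion
  \<open>ray M x i p v \<subseteq> mcone M x i\<close> does mean that the planar ray lies in the sector;
  similarly for segments.\<close>

definition ray ::
  "('a, 'i) pf_surface \<Rightarrow> 'a \<Rightarrow> 'i \<Rightarrow> ('i \<times> (real^2)) set \<Rightarrow> real^2 \<Rightarrow> ('i \<times> (real^2)) set set" where
  "ray M x i p v = {pt M x i (coord i p + s *\<^sub>R v) | s. 0 \<le> s}"

definition segment ::
  "('a, 'i) pf_surface \<Rightarrow> 'a \<Rightarrow> 'i \<Rightarrow> ('i \<times> (real^2)) set \<Rightarrow> ('i \<times> (real^2)) set \<Rightarrow> ('i \<times> (real^2)) set set" where
  "segment M x i p q = pt M x i ` closed_segment (coord i p) (coord i q)"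

definition cone_edge :: "('a, 'i) pf_surface \<Rightarrow> 'a \<Rightarrow> ('i \<times> (real^2)) set set \<Rightarrow> bool" where
  "cone_edge M x E \<longleftrightarrow>
     (\<exists>i\<in>star M x. \<exists>j\<in>star M x. i \<noteq> j \<and> E = mcone M x i \<inter> mcone M x j \<and>
        (\<exists>w. w \<noteq> 0 \<and> E = ray M x i (apex M x) w))"

text \<open>The cones with indices \<open>k 0, \<dots>, k m\<close> are met consecutively when going around \<open>x\<close>
  in one direction, possibly several times: neighbours are distinct and share an edge, and the
  sequence never turns back to the cone it has just left.\<close>

definition consecutive_cones :: "('a, 'i) pf_surface \<Rightarrow> 'a \<Rightarrow> nat \<Rightarrow> (nat \<Rightarrow> 'i) \<Rightarrow> bool" where
  "consecutive_cones M x m k \<longleftrightarrow>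
     (\<forall>i\<le>m. k i \<in> star M x) \<and>
     (\<forall>i\<in>{1..m}. k (i - 1) \<noteq> k i \<and> cone_edge M x (mcone M x (k (i - 1)) \<inter> mcone M x (k i))) \<and>
     (\<forall>i\<in>{1..<m}. k (i - 1) \<noteq> k (i + 1))"

section \<open>Curves, length and geodesics in the tangent cone\<close>

text \<open>Smoothness on a closed interval, with one-sided derivatives at the end points.\<close>

definition smooth_curve_on :: "real \<Rightarrow> real \<Rightarrow> (real \<Rightarrow> real^2) \<Rightarrow> bool" where
  "smooth_curve_on a b g \<longleftrightarrow>
     (\<exists>G :: nat \<Rightarrow> real \<Rightarrow> real^2. (\<forall>t\<in>{a..b}. G 0 t = g t) \<and>
        (\<forall>n. \<forall>t\<in>{a..b}. (G n has_vector_derivative G (Suc n) t) (at t within {a..b})))"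

text \<open>Curves are functions on the reals of which only the values on an interval \<open>D\<close> matter.
  Having a finite smooth subdivision on every compact subinterval of \<open>D\<close> is, by compactness,
  the same as having one locally in \<open>D\<close>.\<close>

definition piecewise_smooth ::
  "('a, 'i) pf_surface \<Rightarrow> 'a \<Rightarrow> real set \<Rightarrow> (real \<Rightarrow> ('i \<times> (real^2)) set) \<Rightarrow> bool" where
  "piecewise_smooth M x D c \<longleftrightarrow>
     (\<forall>t\<in>D. c t \<in> tcone M x) \<and>
     (\<forall>a b. a < b \<longrightarrow> {a..b} \<subseteq> D \<longrightarrow>
        (\<exists>(n::nat) \<tau>. \<tau> 0 = a \<and> \<tau> n = b \<and>
           (\<forall>l<n. \<tau> l < \<tau> (Suc l) \<and>
              (\<exists>i\<in>star M x. (\<forall>t\<in>{\<tau> l..\<tau> (Suc l)}. c t \<in> mcone M x i) \<and>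
                 smooth_curve_on (\<tau> l) (\<tau> (Suc l)) (\<lambda>t. coord i (c t))))))"

text \<open>The one-sided derivatives of \<open>c\<close> at \<open>t\<close>, in the coordinates of the cone \<open>i\<close>
  that contains \<open>c\<close> just after, respectively just before, \<open>t\<close>.\<close>

definition outgoing ::
  "('a, 'i) pf_surface \<Rightarrow> 'a \<Rightarrow> real set \<Rightarrow> (real \<Rightarrow> ('i \<times> (real^2)) set) \<Rightarrow> real \<Rightarrow> 'i \<Rightarrow> real^2 \<Rightarrow> bool" where
  "outgoing M x D c t i v \<longleftrightarrow>
     i \<in> star M x \<and>
     (\<exists>e>0. {t..t + e} \<subseteq> D \<and> (\<forall>s\<in>{t..t + e}. c s \<in> mcone M x i)) \<and>
     ((\<lambda>s. coord i (c s)) has_vector_derivative v) (at_right t)"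

definition incoming ::
  "('a, 'i) pf_surface \<Rightarrow> 'a \<Rightarrow> real set \<Rightarrow> (real \<Rightarrow> ('i \<times> (real^2)) set) \<Rightarrow> real \<Rightarrow> 'i \<Rightarrow> real^2 \<Rightarrow> bool" where
  "incoming M x D c t i v \<longleftrightarrow>
     i \<in> star M x \<and>
     (\<exists>e>0. {t - e..t} \<subseteq> D \<and> (\<forall>s\<in>{t - e..t}. c s \<in> mcone M x i)) \<and>
     ((\<lambda>s. coord i (c s)) has_vector_derivative v) (at_left t)"

text \<open>For a piecewise smooth curve on \<open>{a..b}\<close> the speed below is determined at every
  \<open>t < b\<close>: a curve that lies in two cones just after \<open>t\<close> runs along their common edge, where
  the two norms agree.\<close>

definition speed ::
  "('a, 'i) pf_surface \<Rightarrow> 'a \<Rightarrow> real set \<Rightarrow> (real \<Rightarrow> ('i \<times> (real^2)) set) \<Rightarrow> real \<Rightarrow> real" where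
  "speed M x D c t = (THE r. \<exists>i v. outgoing M x D c t i v \<and> r = nrm M i v)"

definition curve_length ::
  "('a, 'i) pf_surface \<Rightarrow> 'a \<Rightarrow> real \<Rightarrow> real \<Rightarrow> (real \<Rightarrow> ('i \<times> (real^2)) set) \<Rightarrow> real" where
  "curve_length M x a b c = integral {a..b} (speed M x {a..b} c)"

definition tdist ::
  "('a, 'i) pf_surface \<Rightarrow> 'a \<Rightarrow> ('i \<times> (real^2)) set \<Rightarrow> ('i \<times> (real^2)) set \<Rightarrow> real" where
  "tdist M x p q =
     Inf {curve_length M x a b c | a b c.
            a < b \<and> piecewise_smooth M x {a..b} c \<and> c a = p \<and> c b = q}"

definition geodesic ::
  "('a, 'i) pf_surface \<Rightarrow> 'a \<Rightarrow> real set \<Rightarrow> (real \<Rightarrow> ('i \<times> (real^2)) set) \<Rightarrow> bool" where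
  "geodesic M x D c \<longleftrightarrow>
     is_interval D \<and>
     piecewise_smooth M x D c \<and>
     (\<exists>\<kappa>>0. \<forall>t\<in>D. \<forall>i v. outgoing M x D c t i v \<or> incoming M x D c t i v \<longrightarrow> nrm M i v = \<kappa>) \<and>
     (\<forall>t0\<in>D. \<exists>\<epsilon>>0. \<forall>t1\<in>D. \<forall>t2\<in>D.
        t1 < t2 \<and> \<bar>t1 - t0\<bar> < \<epsilon> \<and> \<bar>t2 - t0\<bar> < \<epsilon> \<longrightarrow>
        curve_length M x t1 t2 c = tdist M x (c t1) (c t2))"

end

theory Submission
  imports Defs
begin

text \<open>
  For a smooth strictly convex norm \<open>F\<close>, the derivative of \<open>F\<close> at \<open>v\<close> is the unique covector \<open>\<xi>\<close> with
  \<open>\<xi> \<le> F\<close> and \<open>\<xi> v = F v\<close>. Away from the apex a geodesic is straight inside the cones, and where it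
  passes through an edge the covectors on both sides agree on that edge; conversely the covector on one
  side determines the direction on the other. Such a broken line is locally minimizing because the
  covectors glue to a calibration near the crossing. Uniqueness of the extension is local
  determinism in both time directions.

  The broken line crosses only finitely many edges. The value of the covector at the position,
  \<open>\<xi> (c t)\<close>, is continuous across edges and has derivative \<open>F v\<close>. Dividing its value at a crossing by
  the norm of the position vector (or of its negative, as long as the value is negative) gives a
  quantity in \<open>[-1, 1]\<close> that increases by at least a fixed positive amount from one edge to the next,
  except possibly once, when the sign changes. Hence a maximal broken line ends in two rays.

  That each edge lies in exactly two triangles follows from invariance of domain.
\<close>

section \<open>Minkowski norms\<close>

text \<open>Why a crossing yields a definite gain: let a line of velocity v run from the ray of e to
  that of e'. The differential of a convex function is monotone, so \<open>dF v e\<close> \<le>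
  \<open>dF e' e\<close>, and the latter is less than \<open>F e\<close> by strict convexity. A
  nonnegative normalised value thus stays below a bound less than 1 that depends only on the sector,
  and the remaining distance to 1 forces the gain. Negative values are treated by reversing both the
  gauge and the line. Finitely many sectors give one gain for all.

  Tangency to an edge cannot appear at a crossing: it is exactly the case in which the covector
  takes an extreme value, \<open>F e\<close> or \<open>- F (- e)\<close>, on the edge vector, and
  equality of the covectors would make the velocity on the other side tangent too.

  That an edge lies in at most two triangles is already the reason why the gluing is transitive;
  that it lies in at least two lets a line continue behind it. The tangent cone is used without a
  topology: where two geodesics agree up to a time, the limit is taken along straight germs.\<close>

locale scgauge =
  fixes F :: "'v::euclidean_space \<Rightarrow> real"
  assumes cont: "continuous_on UNIV F"
    and nonneg: "0 \<le> F v"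
    and pos: "v \<noteq> 0 \<Longrightarrow> 0 < F v"
    and homog: "0 \<le> r \<Longrightarrow> F (r *\<^sub>R v) = r * F v"
    and triangle: "F (v + w) \<le> F v + F w"
    and strict: "F (v + w) = F v + F w \<Longrightarrow> v \<noteq> 0 \<Longrightarrow> \<exists>l\<ge>0. w = l *\<^sub>R v"
    and diff: "v \<noteq> 0 \<Longrightarrow> F differentiable (at v)"
begin

definition dF :: "'v \<Rightarrow> 'v \<Rightarrow> real" where
  "dF v = frechet_derivative F (at v)"

lemma zero [simp]: "F 0 = 0"
  using homog[of 0 0] by simp

lemma dF_has_derivative: "v \<noteq> 0 \<Longrightarrow> (F has_derivative dF v) (at v)"
  unfolding dF_def using diff frechet_derivative_works by blast

lemma dF_linear: "v \<noteq> 0 \<Longrightarrow> linear (dF v)"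
  using dF_has_derivative has_derivative_linear by blast

lemma dF_DERIV: 
  assumes "v + t *\<^sub>R w \<noteq> 0"
  shows "((\<lambda>t. F (v + t *\<^sub>R w)) has_real_derivative dF (v + t *\<^sub>R w) w) (at t)"
proof -
  have "((\<lambda>t. F (v + t *\<^sub>R w)) has_derivative (\<lambda>h. dF (v + t *\<^sub>R w) (h *\<^sub>R w))) (at t)"
    by (rule has_derivative_compose[where f = "\<lambda>t. v + t *\<^sub>R w", OF _ dF_has_derivative[OF assms]])
       (auto intro!: derivative_eq_intros)
  moreover have "(\<lambda>h. dF (v + t *\<^sub>R w) (h *\<^sub>R w)) = (\<lambda>h. h * dF (v + t *\<^sub>R w) w)"
    using dF_linear[OF assms] by (simp add: linear_cmul)
  ultimately show ?thesis
    by (simp add: has_field_derivative_def mult_commute_abs)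
qed

text \<open>The gradient inequality: by convexity the difference quotients for times below 1 are at
  most the one at time 1, and the derivative is their limit from the right.\<close>

lemma dF_le_difference:
  assumes "v \<noteq> 0"
  shows "dF v w \<le> F (v + w) - F v"
proof -
  have D: "((\<lambda>t. F (v + t *\<^sub>R w)) has_real_derivative dF v w) (at 0)"
    using dF_DERIV[of v 0 w] assms by simp
  then have "((\<lambda>t. (F (v + t *\<^sub>R w) - F v) / t) \<longlongrightarrow> dF v w) (at_right 0)"
    by (simp add: DERIV_def filterlim_at_split)
  moreover have "\<forall>\<^sub>F t in at_right 0. (F (v + t *\<^sub>R w) - F v) / t \<le> F (v + w) - F v"
  proof -
    have "(F (v + t *\<^sub>R w) - F v) / t \<le> F (v + w) - F v" if t: "0 < t" "t < 1" for t
    proof -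
      have "v + t *\<^sub>R w = (1 - t) *\<^sub>R v + t *\<^sub>R (v + w)"
        by (simp add: algebra_simps)
      then have "F (v + t *\<^sub>R w) \<le> (1 - t) * F v + t * F (v + w)"
        using triangle[of "(1 - t) *\<^sub>R v" "t *\<^sub>R (v + w)"] homog[of "1 - t" v] homog[of t "v + w"] t by simp
      then show ?thesis using t by (simp add: field_simps)
    qed
    then show ?thesis
      using eventually_at_right[of 0 "1::real"] by (auto simp: eventually_at_right_field intro!: exI[of _ 1])
  qed
  ultimately show ?thesis
    by (rule tendsto_upperbound) simp
qed

lemma dF_le: "v \<noteq> 0 \<Longrightarrow> dF v w \<le> F w"
  using dF_le_difference[of v w] triangle[of v w] by simp

text \<open>The gradient inequality and the triangle inequality enclose \<open>F (v + w)\<close> by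
  \<open>F v + F w\<close> from both sides, so \<open>strict\<close> applies.\<close>

lemma dF_eqD:
  assumes "v \<noteq> 0" "F w \<le> dF v w"
  shows "\<exists>l\<ge>0. w = l *\<^sub>R v"
  using dF_le_difference[of v w] triangle[of v w] strict[of v w] assms by force

lemma dF_ge: "v \<noteq> 0 \<Longrightarrow> - F (- w) \<le> dF v w"
  using dF_le[of v "- w"] dF_linear[of v] by (simp add: linear_neg)

lemma dF_self: 
  assumes "v \<noteq> 0" shows "dF v v = F v"
proof (rule antisym)
  show "dF v v \<le> F v" using dF_le assms by blast
  have "dF v (- v) \<le> - F v" using dF_le_difference[of v "- v"] assms by simp
  then show "F v \<le> dF v v" using dF_linear[OF assms] by (simp add: linear_neg)
qed

text \<open>On the line through \<open>v\<close> in direction \<open>w\<close> the difference of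
  \<open>F\<close> and \<open>f\<close> has a minimum at \<open>v\<close>, so its derivative
  vanishes there. This recognises a covector as soon as it is known to support
  \<open>F\<close>.\<close>

lemma dF_support_unique:
  assumes v: "v \<noteq> 0" and f: "linear f" "\<And>w. f w \<le> F w" "f v = F v"
  shows "dF v w = f w"
proof -
  have "((\<lambda>t. F (v + t *\<^sub>R w)) has_real_derivative dF v w) (at 0)"
    using dF_DERIV[of v 0 w] v by simp
  then have "((\<lambda>t. F (v + t *\<^sub>R w) - (f v + t * f w)) has_real_derivative dF v w - f w) (at 0)"
    by (auto intro!: derivative_eq_intros)
  moreover have "F (v + 0 *\<^sub>R w) - (f v + 0 * f w) \<le> F (v + t *\<^sub>R w) - (f v + t * f w)" for t
    using f(2)[of "v + t *\<^sub>R w"] f(1,3) by (simp add: linear_add linear_cmul)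
  ultimately have "dF v w - f w = 0"
    by (intro DERIV_local_min[of _ _ 0 1]) auto
  then show ?thesis by simp
qed

lemma dF_scale:
  assumes "v \<noteq> 0" "0 < l"
  shows "dF (l *\<^sub>R v) w = dF v w"
proof (rule dF_support_unique)
  show "dF v (l *\<^sub>R v) = F (l *\<^sub>R v)"
  proof -
    have "dF v (l *\<^sub>R v) = l * dF v v" using linear_cmul[OF dF_linear[OF assms(1)], of l v] by simp
    also have "\<dots> = F (l *\<^sub>R v)" unfolding dF_self[OF assms(1)] using assms(2) by (intro homog[symmetric]) simp
    finally show ?thesis .
  qed
  show "l *\<^sub>R v \<noteq> 0" using assms by simp
  show "linear (dF v)" "\<And>w. dF v w \<le> F w" using assms(1) by (rule dF_linear, rule dF_le)
qed

lemma dF_less: "v \<noteq> 0 \<Longrightarrow> w \<notin> span {v} \<Longrightarrow> dF v w < F w"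
  using dF_eqD[of v w] by (metis not_less span_base span_scale singletonI)

text \<open>Evaluating each covector at the other vector and cancelling the common value on
  \<open>e\<close> gives \<open>F w \<le> dF v w\<close>, the equality case of
  \<open>dF_eqD\<close>. The sign of \<open>l\<close> says that the two vectors are not on opposite
  sides of the line of \<open>e\<close>.\<close>

lemma refraction_unique:
  assumes "v \<noteq> 0" "w \<noteq> 0" "w = l *\<^sub>R v + r *\<^sub>R e" "0 \<le> l" "dF v e = dF w e"
  shows "\<exists>m\<ge>0. w = m *\<^sub>R v"
proof (rule dF_eqD[OF assms(1)])
  have "dF v w = l * F v + r * dF v e"
    using assms dF_linear[of v] by (simp add: linear_add linear_cmul dF_self)
  moreover have "dF w (l *\<^sub>R v) = F w - r * dF w e"
  proof -
    have "l *\<^sub>R v = w - r *\<^sub>R e" using assms(3) by simp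
    then show ?thesis using dF_linear[OF assms(2)] assms(2)
      by (simp only: linear_diff linear_cmul) (simp add: dF_self)
  qed
  moreover have "dF w (l *\<^sub>R v) \<le> l * F v"
    using dF_le[OF assms(2), of "l *\<^sub>R v"] homog[OF assms(4)] by simp
  ultimately show "F w \<le> dF v w" using assms(5) by simp
qed

text \<open>The solution is a minimum point of F(w + r e) - s r as a function of r; the two strict
  bounds on \<open>s\<close> make this function grow linearly in both directions.\<close>

lemma refraction_exists:
  assumes ind: "w \<notin> span {e}" and s: "- F (- e) < s" "s < F e"
  shows "\<exists>r. dF (w + r *\<^sub>R e) e = s"
proof -
  define f where "f r = F (w + r *\<^sub>R e) - s * r" for r
  \<comment> \<open>Chosen so that at distance \<open>R\<close> the lower bound \<open>lb\<close>
    equals \<open>F w + 1\<close>, which exceeds the value \<open>F w\<close> at 0.\<close>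
  define R where "R = (F w + F (- w) + 1) / min (F e - s) (F (- e) + s)"
  have m: "0 < min (F e - s) (F (- e) + s)" using s by simp
  have R: "0 < R" unfolding R_def using m nonneg[of w] nonneg[of "-w"] by (intro divide_pos_pos) auto
  have lb: "\<bar>r\<bar> * min (F e - s) (F (- e) + s) - F (- w) \<le> f r" for r
  proof (cases "0 \<le> r")
    case True
    have "r * F e \<le> F (w + r *\<^sub>R e) + F (- w)"
      using triangle[of "w + r *\<^sub>R e" "- w"] homog[OF True, of e] by simp
    moreover have "r * min (F e - s) (F (- e) + s) \<le> r * (F e - s)"
      using True by (intro mult_left_mono) auto
    ultimately show ?thesis using True unfolding f_def by (simp add: algebra_simps)
  next
    case False
    have "(- r) * F (- e) \<le> F (w + r *\<^sub>R e) + F (- w)"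
      using triangle[of "w + r *\<^sub>R e" "- w"] homog[of "- r" "- e"] False by simp
    moreover have "(- r) * min (F e - s) (F (- e) + s) \<le> (- r) * (F (- e) + s)"
      using False by (intro mult_left_mono) auto
    ultimately show ?thesis using False unfolding f_def by (simp add: algebra_simps)
  qed
  have contf: "continuous_on {-R..R} f"
    unfolding f_def
    by (intro continuous_intros continuous_on_compose2[OF cont]) auto
  obtain r0 where r0: "r0 \<in> {-R..R}" "\<And>r. r \<in> {-R..R} \<Longrightarrow> f r0 \<le> f r"
    using continuous_attains_inf[OF compact_Icc _ contf] R by auto
  have min: "f r0 \<le> f r" for r
  proof (cases "r \<in> {-R..R}")
    case False
    then have "R \<le> \<bar>r\<bar>" by auto
    then have "R * min (F e - s) (F (- e) + s) \<le> \<bar>r\<bar> * min (F e - s) (F (- e) + s)"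
      using m by (intro mult_right_mono) auto
    moreover have "R * min (F e - s) (F (- e) + s) = F w + F (- w) + 1"
      unfolding R_def using m by (metis nonzero_eq_divide_eq less_irrefl)
    ultimately have "f 0 \<le> f r" using lb[of r] unfolding f_def by simp
    then show ?thesis using r0(2)[of 0] R by simp
  qed (use r0 in auto)
  have nz: "w + r0 *\<^sub>R e \<noteq> 0"
  proof
    assume "w + r0 *\<^sub>R e = 0"
    then have "w = (- r0) *\<^sub>R e" by (metis add_eq_0_iff2 scaleR_minus_left)
    then show False using ind by (metis span_base span_scale singletonI)
  qed
  have "(f has_real_derivative dF (w + r0 *\<^sub>R e) e - s) (at r0)"
    unfolding f_def by (auto intro!: derivative_eq_intros dF_DERIV[OF nz])
  then have "dF (w + r0 *\<^sub>R e) e - s = 0"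
    by (rule DERIV_local_min[where d = 1]) (use min in auto)
  then show ?thesis by auto
qed

lemma norm_lower_bound: "\<exists>c>0. \<forall>v. c * norm v \<le> F v"
proof -
  have "continuous_on (sphere 0 1) F" using cont continuous_on_subset by blast
  moreover have "sphere (0::'v) 1 \<noteq> {}" by (simp add: sphere_eq_empty)
  ultimately obtain u where u: "u \<in> sphere 0 1" "\<And>v. v \<in> sphere 0 1 \<Longrightarrow> F u \<le> F v"
    using continuous_attains_inf[of "sphere (0::'v) 1" F] by auto
  have "F u * norm v \<le> F v" for v
  proof (cases "v = 0")
    case False
    have "F u \<le> F (v /\<^sub>R norm v)" using u False by simp
    also have "\<dots> = F v / norm v" using homog[of "inverse (norm v)" v] by (simp add: divide_inverse mult.commute)
    finally show ?thesis using False by (simp add: field_simps)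
  qed simp
  moreover have "0 < F u" using u(1) pos[of u] by (metis mem_sphere_0 norm_zero zero_neq_one)
  ultimately show ?thesis by blast
qed

lemma linear_bound:
  fixes f :: "'v \<Rightarrow> real"
  assumes "linear f"
  shows "\<exists>K>0. \<forall>v. \<bar>f v\<bar> \<le> K * F v"
proof -
  obtain B where B: "B > 0" "\<And>v. norm (f v) \<le> B * norm v"
    using linear_bounded_pos[OF assms] by blast
  obtain c where c: "c > 0" "\<And>v. c * norm v \<le> F v" using norm_lower_bound by blast
  have "\<bar>f v\<bar> \<le> (B / c) * F v" for v
  proof -
    have "B * norm v \<le> B * (F v / c)" using c B by (intro mult_left_mono) (auto simp: field_simps)
    then show ?thesis using B(2)[of v] by simp
  qed
  then show ?thesis using B c by (intro exI[of _ "B / c"]) auto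
qed

text \<open>Integrate the covector that supports \<open>F\<close> at the chord: it is at most
  \<open>F\<close> on every velocity and equals \<open>F\<close> on the chord. Comparing with a
  majorant \<open>h\<close> admits a constant speed as integrand.\<close>

lemma chord_le_integral:
  fixes g :: "real \<Rightarrow> 'v"
  assumes "a \<le> b"
    and "\<And>t. t \<in> {a..b} \<Longrightarrow> (g has_vector_derivative g' t) (at t within {a..b})"
    and "(h has_integral J) {a..b}" "\<And>t. t \<in> {a..b} \<Longrightarrow> F (g' t) \<le> h t"
  shows "F (g b - g a) \<le> J"
proof (cases "g b - g a = 0")
  case True
  have "0 \<le> J"
    by (rule has_integral_nonneg[OF assms(3)]) (use assms(4) nonneg order_trans in blast)
  then show ?thesis using True by simp
next
  case False
  let ?x = "dF (g b - g a)"
  have "(g' has_integral (g b - g a)) {a..b}"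
    using fundamental_theorem_of_calculus assms(1,2) by blast
  then have "((\<lambda>t. ?x (g' t)) has_integral ?x (g b - g a)) {a..b}"
    using has_integral_linear[of g' "g b - g a" "{a..b}" ?x] dF_linear[OF False]
    by (simp add: linear_conv_bounded_linear o_def)
  then have "?x (g b - g a) \<le> J"
    by (rule has_integral_le[OF _ assms(3)]) (use assms(4) dF_le[OF False] order_trans in blast)
  then show ?thesis using dF_self[OF False] by simp
qed

text \<open>Running a line backwards means measuring with this gauge; it transfers
  \<open>crossing_step\<close> to negative values of the covector.\<close>

lemma reverse: "scgauge (\<lambda>v. F (- v))"
proof
  show "continuous_on UNIV (\<lambda>v. F (- v))"
    by (intro continuous_on_compose2[OF cont] continuous_intros) auto
  show "F (- (v + w)) \<le> F (- v) + F (- w)" for v w using triangle[of "- v" "- w"] by simp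
  show "\<exists>l\<ge>0. w = l *\<^sub>R v" if eq: "F (- (v + w)) = F (- v) + F (- w)" and v: "v \<noteq> 0" for v w
  proof -
    have "F (- v + - w) = F (- v) + F (- w)" using eq by simp
    then obtain l where "l \<ge> 0" "- w = l *\<^sub>R (- v)"
      using strict[of "- v" "- w"] v by (metis neg_equal_0_iff_equal)
    then show ?thesis by (metis neg_equal_iff_equal scaleR_minus_right)
  qed
  show "(\<lambda>v. F (- v)) differentiable at v" if "v \<noteq> 0" for v
    using differentiable_compose[of F uminus v UNIV] diff[of "- v"] that
    by (simp add: differentiable_minus)
qed (use nonneg pos homog in auto, metis homog scaleR_minus_right)

text \<open>The hypotheses say that a line with direction \<open>v\<close> runs from the ray of \<open>e\<close> to the ray of \<open>e'\<close>.\<close>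

lemma crossing_step:
  assumes ind: "e \<notin> span {e'}" "e' \<notin> span {e}"
  shows "\<exists>d>0. \<forall>a a' t v. 0 < a \<longrightarrow> 0 < a' \<longrightarrow> 0 < t \<longrightarrow> v \<noteq> 0 \<longrightarrow>
      a' *\<^sub>R e' = a *\<^sub>R e + t *\<^sub>R v \<longrightarrow> 0 \<le> dF v e \<longrightarrow> dF v e / F e + d \<le> dF v e' / F e'"
proof -
  have nz: "e \<noteq> 0" "e' \<noteq> 0" using ind span_zero by blast+
  have P: "0 < F e" "0 < F e'" using pos nz by auto
  have d1: "dF e' e < F e" using dF_less[OF nz(2) ind(1)] .
  have "independent {e, e'}" using ind by (metis dependent_single independent_insertI insert_commute nz(1))
  then obtain f where f: "linear f" "f e = (0::real)" "f e' = 1"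
    using linear_independent_extend[of "{e, e'}" "\<lambda>w. if w = e then 0 else 1"] ind
    by (metis (no_types, lifting) insertCI span_base singletonI)
  obtain K where K: "K > 0" "\<And>v. \<bar>f v\<bar> \<le> K * F v" using linear_bound[OF f(1)] by blast
  \<comment> \<open>The two factors are lower bounds for t F(v) / (a' F(e')), from the coordinate
    \<open>f\<close> along \<open>e'\<close>, and for 1 - s, from the inequality
    \<open>dF v e \<le> dF e' e\<close> proved below.\<close>
  define d where "d = (1 / (K * F e')) * (1 - dF e' e / F e)"
  have "0 < d" unfolding d_def using d1 P K by simp
  moreover have "dF v e / F e + d \<le> dF v e' / F e'"
    if h: "0 < a" "0 < a'" "0 < t" "v \<noteq> 0" "a' *\<^sub>R e' = a *\<^sub>R e + t *\<^sub>R v" "0 \<le> dF v e" for a a' t v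
  proof -
    have L: "linear (dF v)" "linear (dF e')" using dF_linear h nz by auto
    have e1: "a' * dF v e' = a * dF v e + t * F v"
      using arg_cong[OF h(5), of "dF v"] L h(4) by (simp add: linear_add linear_cmul dF_self)
    have e2: "t *\<^sub>R v = a' *\<^sub>R e' - a *\<^sub>R e" using h(5) by simp
    have "a' * F e' - a * dF e' e = dF e' (t *\<^sub>R v)"
      using L nz unfolding e2 by (simp add: linear_diff linear_cmul dF_self)
    also have "\<dots> \<le> t * F v" using dF_le[OF nz(2), of "t *\<^sub>R v"] homog[of t v] h by simp
    also have "\<dots> \<le> a' * F e' - a * dF v e"
      using e1 mult_left_mono[OF dF_le[OF h(4), of e'], of a'] h by simp
    finally have "dF v e \<le> dF e' e" using h by simp
    then have s: "dF v e / F e \<le> dF e' e / F e" using P by (simp add: divide_right_mono)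
    have "f (t *\<^sub>R v) = a'" unfolding e2 using f by (simp add: linear_diff linear_cmul)
    then have T: "a' \<le> K * (t * F v)" using K(2)[of "t *\<^sub>R v"] homog[of t v] h by simp
    have tr: "a' * F e' \<le> a * F e + t * F v"
      using triangle[of "a *\<^sub>R e" "t *\<^sub>R v"] h(1-3) homog[of a e] homog[of t v] homog[of a' e'] h(5) by simp
    define s where "s = dF v e / F e"
    have s0: "0 \<le> s" "s \<le> dF e' e / F e" using s P h by (auto simp: s_def)
    have s1: "s < 1" using s0 d1 P by (smt (verit) divide_less_eq_1_pos)
    have "a' * F e' * (dF v e' / F e') = a * F e * s + t * F v"
      using e1 P by (simp add: s_def)
    moreover have "a' * F e' * s \<le> (a * F e + t * F v) * s" using mult_right_mono[OF tr s0(1)] .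
    ultimately have "t * F v * (1 - s) \<le> a' * F e' * (dF v e' / F e' - s)"
      by (simp add: algebra_simps)
    moreover have "a' * F e' * d \<le> t * F v * (1 - s)"
    proof -
      have "a' * F e' * d = (a' / K) * (1 - dF e' e / F e)" unfolding d_def using P by simp
      also have "\<dots> \<le> (t * F v) * (1 - s)"
        using T K(1) s0 s1 d1 P h nonneg[of v] by (intro mult_mono) (auto simp: field_simps)
      finally show ?thesis .
    qed
    ultimately have "a' * F e' * d \<le> a' * F e' * (dF v e' / F e' - s)" by simp
    then have "d \<le> dF v e' / F e' - s" using h P by simp
    then show ?thesis by (simp add: s_def)
  qed
  ultimately show ?thesis by blast
qed

end

lemma reverse_dF:
  assumes "scgauge F" "v \<noteq> 0"
  shows "scgauge.dF (\<lambda>v. F (- v)) v w = - scgauge.dF F (- v) w"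
proof -
  interpret scgauge F by fact
  interpret r: scgauge "\<lambda>v. F (- v)" by (rule reverse)
  have "((\<lambda>v. F (- v)) has_derivative (\<lambda>h. dF (- v) (- h))) (at v)"
    using has_derivative_compose[of uminus uminus v UNIV F "dF (- v)"] dF_has_derivative[of "- v"] assms
    by (auto intro!: derivative_eq_intros)
  then have "r.dF v = (\<lambda>h. dF (- v) (- h))"
    using r.dF_has_derivative[OF assms(2)] has_derivative_unique by blast
  then show ?thesis using dF_linear[of "- v"] assms by (simp add: linear_neg)
qed

section \<open>Strict convexity from the fundamental form\<close>

lemma minkowski_norm_differentiable:
  assumes "minkowski_norm F" "y \<noteq> 0"
  shows "F differentiable (at y)"
    and "b \<in> Basis \<Longrightarrow> (\<lambda>x. frechet_derivative F (at x) b) differentiable (at y)"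
proof -
  have "Ck_on (Suc (Suc 0)) (- {0}) F"
    using assms unfolding minkowski_norm_def Cinfinity_on_def by blast
  then show "F differentiable (at y)"
    "b \<in> Basis \<Longrightarrow> (\<lambda>x. frechet_derivative F (at x) b) differentiable (at y)"
    using assms(2) by auto
qed

text \<open>On a line that misses 0, where \<open>F\<close> is smooth, the square of
  \<open>F\<close> has twice the fundamental form as second derivative; so its slope increases
  strictly.\<close>

lemma minkowski_norm_square_strictly_convex:
  assumes F: "minkowski_norm F" and nz: "\<And>r. v + r *\<^sub>R u \<noteq> 0" and u: "u \<noteq> 0" and t: "0 < t" "t < 1"
  shows "(F (v + t *\<^sub>R u))\<^sup>2 < (1 - t) * (F v)\<^sup>2 + t * (F (v + u))\<^sup>2"
proof -
  define z where "z r = v + r *\<^sub>R u" for r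
  define g where "g r = (F (z r))\<^sup>2" for r
  define G where "G r = 2 * F (z r) * (\<Sum>b\<in>Basis. (u \<bullet> b) * frechet_derivative F (at (z r)) b)" for r
  have nz': "z r \<noteq> 0" for r using nz by (simp add: z_def)
  have dz: "(z has_derivative (\<lambda>h. h *\<^sub>R u)) (at r)" for r
    unfolding z_def[abs_def] by (auto intro!: derivative_eq_intros)
  have dFz: "((\<lambda>r. F (z r)) has_real_derivative
      (\<Sum>b\<in>Basis. (u \<bullet> b) * frechet_derivative F (at (z r)) b)) (at r)" for r
  proof -
    let ?D = "frechet_derivative F (at (z r))"
    have D: "(F has_derivative ?D) (at (z r))"
      using minkowski_norm_differentiable(1)[OF F nz'] frechet_derivative_works by blast
    then have l: "linear ?D" by (rule has_derivative_linear)
    have "?D u = ?D (\<Sum>b\<in>Basis. (u \<bullet> b) *\<^sub>R b)" by (simp add: euclidean_representation)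
    also have "\<dots> = (\<Sum>b\<in>Basis. (u \<bullet> b) * ?D b)"
      using l by (simp add: linear_sum linear_cmul)
    finally have e: "?D u = (\<Sum>b\<in>Basis. (u \<bullet> b) * ?D b)" .
    have "((\<lambda>r. F (z r)) has_derivative (\<lambda>h. ?D (h *\<^sub>R u))) (at r)"
      using has_derivative_compose[OF dz D] .
    then show ?thesis using l e by (simp add: linear_cmul has_field_derivative_def mult_commute_abs)
  qed
  have dg: "(g has_real_derivative G r) (at r)" for r
    unfolding g_def[abs_def] G_def by (auto intro!: derivative_eq_intros dFz)
  have "G differentiable (at r)" for r
  proof -
    have "(\<lambda>r. F (z r)) differentiable (at r)" using dFz real_differentiable_def by blast
    moreover have "(\<lambda>r. frechet_derivative F (at (z r)) b) differentiable (at r)" if "b \<in> Basis" for b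
      using has_derivative_compose[OF dz, of "\<lambda>x. frechet_derivative F (at x) b"]
        minkowski_norm_differentiable(2)[OF F nz' that] unfolding differentiable_def by blast
    ultimately show ?thesis unfolding G_def[abs_def]
      by (intro differentiable_mult differentiable_sum differentiable_const) auto
  qed
  then obtain G' where dG: "\<And>r. (G has_real_derivative G' r) (at r)"
    unfolding real_differentiable_def by metis
  have pos: "0 < G' r" for r
  proof -
    \<comment> \<open>With both directions equal to \<open>u\<close>, the inner derivative is the
      slope \<open>G\<close> at the shifted parameter, so the iterated derivative is the derivative
      of \<open>G\<close>.\<close>
    have "deriv (\<lambda>t. (F (z r + s *\<^sub>R u + t *\<^sub>R u))\<^sup>2) 0 = G (s + r)" for s
    proof -
      have "(\<lambda>t. (F (z r + s *\<^sub>R u + t *\<^sub>R u))\<^sup>2) = (\<lambda>t. g (t + (s + r)))"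
        by (simp add: g_def z_def algebra_simps)
      moreover have "((\<lambda>t. g (t + (s + r))) has_real_derivative G (s + r)) (at 0)"
        using dg[of "s + r"] DERIV_shift[of g "G (s + r)" 0 "s + r"] by simp
      ultimately show ?thesis by (simp add: DERIV_imp_deriv)
    qed
    moreover have "((\<lambda>s. G (s + r)) has_real_derivative G' r) (at 0)"
      using dG[of r] DERIV_shift[of G "G' r" 0 r] by simp
    ultimately have "fundamental_form F (z r) u u = 1 / 2 * G' r"
      unfolding fundamental_form_def by (simp add: DERIV_imp_deriv)
    moreover have "0 < fundamental_form F (z r) u u"
      using F nz' u unfolding minkowski_norm_def by blast
    ultimately show ?thesis by simp
  qed
  obtain a where a: "0 < a" "a < t" "g t - g 0 = (t - 0) * G a"
    using MVT2[of 0 t g G] dg t by blast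
  obtain b where b: "t < b" "b < 1" "g 1 - g t = (1 - t) * G b"
    using MVT2[of t 1 g G] dg t by blast
  have "G a < G b"
    using DERIV_pos_imp_increasing[of a b G] a b dG pos by force
  then have "(g t - g 0) * (1 - t) < (g 1 - g t) * t"
    using a b t by (simp add: mult.commute mult.left_commute)
  then have "g t < (1 - t) * g 0 + t * g 1" by (simp add: algebra_simps)
  then show ?thesis by (simp add: g_def z_def)
qed

text \<open>For independent vectors, normalise to \<open>V\<close> and \<open>W\<close> of norm 1:
  then \<open>v + w\<close> is \<open>a + b\<close> times a proper convex combination of them, at
  which strict convexity of the square gives a norm below 1. Negative multiples are computed
  directly, because their line passes through 0.\<close>

lemma minkowski_norm_scgauge:
  assumes F: "minkowski_norm F"
  shows "scgauge F"
proof -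
  have cont: "continuous_on UNIV F" and nonneg: "\<And>y. 0 \<le> F y" and pos: "\<And>y. y \<noteq> 0 \<Longrightarrow> 0 < F y"
    and homog: "\<And>r y. 0 \<le> r \<Longrightarrow> F (r *\<^sub>R y) = r * F y"
    using F unfolding minkowski_norm_def by auto
  have F0: "F 0 = 0" using homog[of 0 0] by simp
  have less: "F (v + w) < F v + F w" if vw: "v \<noteq> 0" "w \<noteq> 0" "\<not> (\<exists>l\<ge>0. w = l *\<^sub>R v)" for v w
  proof (cases "\<exists>l. w = l *\<^sub>R v")
    case True
    then obtain l where l: "w = l *\<^sub>R v" by blast
    then have "l < 0" using vw(3) not_less by blast
    have vw': "v + w = (1 + l) *\<^sub>R v" using l by (simp add: algebra_simps)
    have w: "F w = (- l) * F (- v)" using l \<open>l < 0\<close> homog[of "- l" "- v"] by simp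
    show ?thesis
    proof (cases "0 \<le> 1 + l")
      case True
      then have "F (v + w) = (1 + l) * F v" using vw' homog by simp
      moreover have "l * F v < 0" using \<open>l < 0\<close> pos[OF vw(1)] by (simp add: mult_neg_pos)
      ultimately show ?thesis using nonneg[of w] by (simp add: algebra_simps)
    next
      case False
      moreover have "v + w = (- 1 - l) *\<^sub>R (- v)" by (simp add: l algebra_simps)
      moreover have "F ((- 1 - l) *\<^sub>R (- v)) = (- 1 - l) * F (- v)" using False by (intro homog) simp
      ultimately have "F (v + w) = (- 1 - l) * F (- v)" by metis
      then have "F (v + w) = (- l) * F (- v) - F (- v)" by (simp only: left_diff_distrib)
      moreover have "0 < F (- v)" using pos[of "- v"] vw by simp
      ultimately show ?thesis using w pos[OF vw(1)] by linarith
    qed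
  next
    case False
    define a where "a = F v"
    define b where "b = F w"
    have ab: "0 < a" "0 < b" using pos vw by (auto simp: a_def b_def)
    define V where "V = v /\<^sub>R a"
    define W where "W = w /\<^sub>R b"
    have FV: "F V = 1" "F W = 1"
      using homog[of "inverse a" v] homog[of "inverse b" w] ab by (auto simp: V_def W_def a_def b_def)
    define t where "t = b / (a + b)"
    have t: "0 < t" "t < 1" "1 - t = a / (a + b)" using ab by (auto simp: t_def field_simps)
    have key: "(1 - r) *\<^sub>R V + r *\<^sub>R W \<noteq> 0" for r
    proof
      assume h: "(1 - r) *\<^sub>R V + r *\<^sub>R W = 0"
      show False
      proof (cases "r = 0")
        case True
        then show False using h ab vw by (simp add: V_def)
      next
        case False
        have "r *\<^sub>R W = (- (1 - r)) *\<^sub>R V"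
          using h by (simp only: add_eq_0_iff scaleR_minus_left)
        then have "inverse r *\<^sub>R (r *\<^sub>R W) = inverse r *\<^sub>R ((- (1 - r)) *\<^sub>R V)" by (simp only:)
        then have "W = (- (1 - r) / r) *\<^sub>R V" using \<open>r \<noteq> 0\<close>
          by (metis scaleR_scaleR left_inverse scaleR_one divide_inverse mult.commute)
        then have "b *\<^sub>R W = (b * (- (1 - r) / r) * inverse a) *\<^sub>R v" by (simp add: V_def)
        then have "w = (b * (- (1 - r) / r) * inverse a) *\<^sub>R v" using ab by (simp add: W_def)
        then show False using \<open>\<not> (\<exists>l. w = l *\<^sub>R v)\<close> by blast
      qed
    qed
    have "V + r *\<^sub>R (W - V) \<noteq> 0" for r using key[of r] by (simp add: algebra_simps)
    moreover have "W - V \<noteq> 0"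
    proof
      assume "W - V = 0"
      then have "b *\<^sub>R W = (b * inverse a) *\<^sub>R v" by (simp add: V_def)
      then have "w = (b * inverse a) *\<^sub>R v" using ab by (simp add: W_def)
      then show False using False by blast
    qed
    ultimately have "(F (V + t *\<^sub>R (W - V)))\<^sup>2 < (1 - t) * (F V)\<^sup>2 + t * (F (V + (W - V)))\<^sup>2"
      using minkowski_norm_square_strictly_convex[OF F] t by blast
    then have "(F (V + t *\<^sub>R (W - V)))\<^sup>2 < 1\<^sup>2" by (simp add: FV)
    then have *: "F (V + t *\<^sub>R (W - V)) < 1" using power_less_imp_less_base by fastforce
    have "(a + b) *\<^sub>R (V + t *\<^sub>R (W - V)) = ((a + b) * (1 - t)) *\<^sub>R V + ((a + b) * t) *\<^sub>R W"
      by (simp add: algebra_simps)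
    also have "\<dots> = a *\<^sub>R V + b *\<^sub>R W" using ab t(3) by (simp add: t_def)
    also have "\<dots> = v + w" using ab by (simp add: V_def W_def)
    finally have "F (v + w) = (a + b) * F (V + t *\<^sub>R (W - V))"
      using homog[of "a + b"] ab by (metis add_nonneg_nonneg less_imp_le)
    also have "\<dots> < a + b" using * ab by simp
    finally show ?thesis by (simp add: a_def b_def)
  qed
  show ?thesis
  proof
    show "F (v + w) \<le> F v + F w" for v w
    proof (cases "v = 0 \<or> w = 0")
      case False
      show ?thesis
      proof (cases "\<exists>l\<ge>0. w = l *\<^sub>R v")
        case True
        then obtain l where l: "l \<ge> 0" "w = l *\<^sub>R v" by blast
        then have "v + w = (1 + l) *\<^sub>R v" by (simp add: algebra_simps)
        then show ?thesis using l homog[of l v] homog[of "1 + l" v] by (simp add: algebra_simps)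
      qed (use less False in force)
    qed (auto simp: F0)
    show "\<exists>l\<ge>0. w = l *\<^sub>R v" if "F (v + w) = F v + F w" "v \<noteq> 0" for v w
    proof (cases "w = 0")
      case False
      then show ?thesis using less[OF that(2) False] that(1) by force
    qed (auto intro: exI[of _ 0])
  qed (use cont nonneg pos homog minkowski_norm_differentiable(1)[OF F] in auto)
qed

section \<open>Triangles of a surface\<close>

lemma plane_coordinates:
  fixes e e' :: "real^2"
  assumes "e \<noteq> 0" "\<nexists>c. e' = c *\<^sub>R e"
  shows "\<exists>f g. linear f \<and> linear g \<and> f e = (1::real) \<and> f e' = 0 \<and> g e = (0::real) \<and> g e' = 1 \<and>
    (\<forall>w. w = f w *\<^sub>R e + g w *\<^sub>R e')"
proof -
  have "e' \<notin> span {e}" using assms(2) by (auto simp: span_singleton)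
  then have ind: "independent {e', e}" and ne: "e \<noteq> e'"
    using assms(1) by (auto simp: independent_insert intro: span_base)
  have full: "UNIV \<subseteq> span {e', e}"
    by (rule card_ge_dim_independent[OF _ ind]) (use ne in auto)
  obtain f where f: "linear f" "f e = (1::real)" "f e' = 0"
    using linear_independent_extend[OF ind, of "\<lambda>w. if w = e then 1 else 0"] ne by auto
  obtain g where g: "linear g" "g e = (0::real)" "g e' = 1"
    using linear_independent_extend[OF ind, of "\<lambda>w. if w = e then 0 else 1"] ne by auto
  have "w = f w *\<^sub>R e + g w *\<^sub>R e'" for w
  proof -
    obtain a b where "w - a *\<^sub>R e' = b *\<^sub>R e"
      using full span_breakdown_eq[of w e' "{e}"] by (auto simp: span_singleton)
    then have w: "w = a *\<^sub>R e' + b *\<^sub>R e" by (simp add: algebra_simps)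
    have "f w = b" "g w = a" using f g unfolding w by (auto simp: linear_add linear_cmul)
    then show ?thesis using w by simp
  qed
  then show ?thesis using f g by blast
qed

text \<open>A local chart around a point of the image transports the planar theorem. This will show
  that two triangles glued along an edge fill a neighbourhood.\<close>

lemma surface_invariance_of_domain:
  fixes S :: "(real^2) set"
  assumes X: "surface X" and S: "open S" and cont: "continuous_map (top_of_set S) X f" and inj: "inj_on f S"
  shows "openin X (f ` S)"
proof (subst openin_subopen, intro ballI)
  fix p assume "p \<in> f ` S"
  then have "p \<in> topspace X" using cont by (auto simp: continuous_map_def)
  then obtain U and W :: "(real^2) set" where U: "openin X U" "p \<in> U" "open W"
    "subtopology X U homeomorphic_space top_of_set W"
    using X unfolding surface_def by blast
  then obtain h k where hk: "homeomorphic_maps (subtopology X U) (top_of_set W) h k"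
    by (auto simp: homeomorphic_space_def)
  have UX: "topspace (subtopology X U) = U" using U(1) openin_subset by (auto simp: topspace_subtopology)
  have h: "continuous_map (subtopology X U) (top_of_set W) h"
    and hkid: "\<And>z. z \<in> U \<Longrightarrow> k (h z) = z"
    using hk UX by (auto simp: homeomorphic_maps_def)
  define S' where "S' = {s \<in> S. f s \<in> U}"
  have "openin (top_of_set S) S'"
    using openin_continuous_map_preimage[OF cont U(1)] by (simp add: S'_def)
  then have S': "open S'" using S openin_open_eq by blast
  have fS': "continuous_map (top_of_set S') (subtopology X U) f"
  proof -
    have "continuous_map (subtopology (top_of_set S) S') X f"
      using cont continuous_map_from_subtopology by blast
    moreover have "subtopology (top_of_set S) S' = top_of_set S'"
      unfolding subtopology_subtopology by (rule arg_cong[where f = top_of_set]) (auto simp: S'_def)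
    ultimately show ?thesis by (auto simp: continuous_map_in_subtopology S'_def)
  qed
  have "continuous_map (top_of_set S') (top_of_set W) (h \<circ> f)"
    using continuous_map_compose[OF fS' h] .
  then have c: "continuous_on S' (h \<circ> f)" and hW: "(h \<circ> f) ` S' \<subseteq> W"
    by (simp_all add: continuous_map_in_subtopology image_subset_iff_funcset o_def)
  have "inj_on (h \<circ> f) S'"
  proof (rule inj_onI)
    fix s t assume "s \<in> S'" "t \<in> S'" "(h \<circ> f) s = (h \<circ> f) t"
    then have "k (h (f s)) = k (h (f t))" "s \<in> S" "t \<in> S" "f s \<in> U" "f t \<in> U" by (auto simp: S'_def)
    then show "s = t" using hkid inj by (metis inj_onD)
  qed
  then have "open ((h \<circ> f) ` S')" using invariance_of_domain[OF c S'] by blast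
  then have "openin (top_of_set W) ((h \<circ> f) ` S')"
    by (rule open_subset[OF hW])
  from openin_continuous_map_preimage[OF h this]
  have o: "openin (subtopology X U) {z \<in> U. h z \<in> (h \<circ> f) ` S'}"
    unfolding UX .
  have "{z \<in> U. h z \<in> (h \<circ> f) ` S'} = f ` S'"
  proof (intro equalityI subsetI)
    fix z assume "z \<in> {z \<in> U. h z \<in> (h \<circ> f) ` S'}"
    then obtain s where s: "z \<in> U" "s \<in> S'" "h z = h (f s)" unfolding image_iff o_def by blast
    then have "z = f s" using hkid[of z] hkid[of "f s"] unfolding S'_def by (metis (mono_tags, lifting) mem_Collect_eq)
    then show "z \<in> f ` S'" using s(2) by blast
  next
    fix z assume "z \<in> f ` S'"
    then obtain s where "s \<in> S'" "z = f s" by blast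
    then show "z \<in> {z \<in> U. h z \<in> (h \<circ> f) ` S'}" by (simp add: S'_def)
  qed
  then have "openin X (f ` S')" using o openin_open_subtopology[OF U(1)] by simp
  moreover have "p \<in> f ` S'" using \<open>p \<in> f ` S\<close> U(2) by (auto simp: S'_def)
  ultimately show "\<exists>T. openin X T \<and> p \<in> T \<and> T \<subseteq> f ` S" by (auto simp: S'_def)
qed



text \<open>The counterpart for maps from the surface to the plane. It excludes boundary edges: a
  neighbourhood inside one triangle would have an open image under the chart of that
  triangle.\<close>

lemma surface_open_image:
  fixes f :: "'a \<Rightarrow> real^2"
  assumes X: "surface X" and N: "openin X N" and cont: "continuous_map (subtopology X N) euclidean f"
    and inj: "inj_on f N"
  shows "open (f ` N)"
proof (subst openin_subopen[of euclidean, simplified open_openin[symmetric]], intro ballI)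
  fix v assume "v \<in> f ` N"
  then obtain p where p: "p \<in> N" "v = f p" by blast
  then have "p \<in> topspace X" using N openin_subset by blast
  then obtain U and W :: "(real^2) set" where U: "openin X U" "p \<in> U" "open W"
    "subtopology X U homeomorphic_space top_of_set W"
    using X unfolding surface_def by blast
  then obtain h k where hk: "homeomorphic_maps (subtopology X U) (top_of_set W) h k"
    by (auto simp: homeomorphic_space_def)
  have UX: "topspace (subtopology X U) = U" using U(1) openin_subset by (auto simp: topspace_subtopology)
  have k: "continuous_map (top_of_set W) (subtopology X U) k"
    and kh: "\<And>z. z \<in> U \<Longrightarrow> k (h z) = z" and hk': "\<And>w. w \<in> W \<Longrightarrow> h (k w) = w"
    and hW: "\<And>z. z \<in> U \<Longrightarrow> h z \<in> W"
    using hk UX by (auto simp: homeomorphic_maps_def continuous_map_def)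
  define W' where "W' = {w \<in> W. k w \<in> N}"
  have kX: "continuous_map (top_of_set W) X k" using k by (simp add: continuous_map_in_subtopology)
  have "openin (top_of_set W) W'"
    using openin_continuous_map_preimage[OF kX N] by (simp add: W'_def)
  then have W': "open W'" using U(3) openin_open_eq by blast
  have "continuous_map (top_of_set W') (subtopology X N) k"
  proof -
    have "continuous_map (subtopology (top_of_set W) W') X k"
      using kX continuous_map_from_subtopology by blast
    moreover have "subtopology (top_of_set W) W' = top_of_set W'"
      unfolding subtopology_subtopology by (rule arg_cong[where f = top_of_set]) (auto simp: W'_def)
    ultimately show ?thesis by (auto simp: continuous_map_in_subtopology W'_def)
  qed
  then have "continuous_on W' (f \<circ> k)"
    using continuous_map_compose[OF _ cont] by (metis continuous_map_iff_continuous)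
  moreover have "inj_on (f \<circ> k) W'"
  proof (rule inj_onI)
    fix s t assume "s \<in> W'" "t \<in> W'" "(f \<circ> k) s = (f \<circ> k) t"
    then have "k s = k t" "s \<in> W" "t \<in> W" using inj_onD[OF inj, of "k s" "k t"] by (simp_all add: W'_def)
    then show "s = t" using hk' by metis
  qed
  ultimately have op: "open ((f \<circ> k) ` W')" by (rule invariance_of_domain[OF _ W'])
  have hp: "h p \<in> W'" using U p kh hW by (simp add: W'_def)
  have "v = (f \<circ> k) (h p)" using kh[OF U(2)] p(2) by simp
  then have "v \<in> (f \<circ> k) ` W'" using hp by (rule image_eqI)
  moreover have "(f \<circ> k) ` W' \<subseteq> f ` N" by (auto simp: W'_def)
  ultimately show "\<exists>T. open T \<and> v \<in> T \<and> T \<subseteq> f ` N" using op by (intro exI[of _ "(f \<circ> k) ` W'"] conjI)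
qed

section \<open>Charts, vertices and edges of the triangulation\<close>

locale pf_surf =
  fixes M :: "('a, 'i) pf_surface"
  assumes M: "pf_finsler_surface M"
begin

abbreviation "X \<equiv> surf_top M"
abbreviation "T \<equiv> tri M"
abbreviation "ch \<equiv> chart M"
abbreviation "F \<equiv> nrm M"

lemma surface: "surface X"
  using M by (simp add: pf_finsler_surface_def)

lemma gauge: "i \<in> idx M \<Longrightarrow> scgauge (F i)"
  using M minkowski_norm_scgauge by (auto simp: pf_finsler_surface_def)

lemma T_subset: "i \<in> idx M \<Longrightarrow> T i \<subseteq> topspace X"
  using M by (auto simp: pf_finsler_surface_def)

lemma nrm_eq:
  "\<lbrakk>i \<in> idx M; j \<in> idx M; p \<in> T i \<inter> T j; q \<in> T i \<inter> T j\<rbrakk> \<Longrightarrow> F i (ch i q - ch i p) = F j (ch j q - ch j p)"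
  using M unfolding pf_finsler_surface_def by blast

lemma inter_cases:
  assumes "i \<in> idx M" "j \<in> idx M" "i \<noteq> j" "x \<in> T i \<inter> T j"
  obtains (vertex) "x \<in> tri_vertices M i" "x \<in> tri_vertices M j" "T i \<inter> T j = {x}"
    | (edge) "T i \<inter> T j \<in> tri_edges M i" "T i \<inter> T j \<in> tri_edges M j"
proof -
  have "T i \<inter> T j = {} \<or> (\<exists>p \<in> tri_vertices M i \<inter> tri_vertices M j. T i \<inter> T j = {p}) \<or>
        T i \<inter> T j \<in> tri_edges M i \<inter> tri_edges M j"
    using M assms(1-3) unfolding pf_finsler_surface_def by blast
  then show ?thesis
    using assms(4) vertex edge by (metis Int_iff empty_iff singletonD)
qed

lemma triangle:
  assumes "i \<in> idx M"
  obtains p q r where "p \<in> T i" "q \<in> T i" "r \<in> T i" "\<not> collinear {ch i p, ch i q, ch i r}"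
    "ch i ` T i = convex hull {ch i p, ch i q, ch i r}"
    "homeomorphic_map (subtopology X (T i)) (top_of_set (ch i ` T i)) (ch i)"
proof -
  obtain a b c where abc: "\<not> collinear {a, b, c}"
    "homeomorphic_map (subtopology X (T i)) (top_of_set (convex hull {a, b, c})) (ch i)"
    using M assms unfolding pf_finsler_surface_def by blast
  have "ch i ` T i = convex hull {a, b, c}"
    using homeomorphic_imp_surjective_map[OF abc(2)] T_subset[OF assms] by (simp add: Int_absorb1)
  moreover from this have "{a, b, c} \<subseteq> ch i ` T i" by (simp add: hull_subset)
  then obtain p q r where "p \<in> T i" "q \<in> T i" "r \<in> T i" "ch i p = a" "ch i q = b" "ch i r = c" by auto
  ultimately show ?thesis using that[of p q r] abc by simp
qed

lemma chart_inj: "i \<in> idx M \<Longrightarrow> inj_on (ch i) (T i)"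
  by (metis triangle homeomorphic_imp_injective_map T_subset topspace_subtopology inf.absorb2)

lemma chart_eq_iff: "\<lbrakk>i \<in> idx M; p \<in> T i; q \<in> T i\<rbrakk> \<Longrightarrow> ch i p = ch i q \<longleftrightarrow> p = q"
  using chart_inj inj_on_eq_iff by metis

lemma tri_vertices_eq:
  assumes "i \<in> idx M" "p \<in> T i" "q \<in> T i" "r \<in> T i" "\<not> collinear {ch i p, ch i q, ch i r}"
    "ch i ` T i = convex hull {ch i p, ch i q, ch i r}"
  shows "tri_vertices M i = {p, q, r}"
proof -
  have "\<not> affine_dependent {ch i p, ch i q, ch i r}"
    using assms(5) by (simp add: collinear_3_eq_affine_dependent)
  then have "ch i z extreme_point_of (ch i ` T i) \<longleftrightarrow> ch i z \<in> {ch i p, ch i q, ch i r}" for z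
    unfolding assms(6) by (rule extreme_point_of_convex_hull_affine_independent)
  then show ?thesis
    using assms(1-4) chart_eq_iff unfolding tri_vertices_def by auto
qed

text \<open>Faces of a simplex are the hulls of subsets of its vertices, and affine dimension 1
  leaves two of them. The ends are pulled back to points of the surface, where different triangles
  can be compared.\<close>

lemma edge_ends:
  assumes "i \<in> idx M" "E \<in> tri_edges M i"
  obtains p q where "p \<noteq> q" "p \<in> tri_vertices M i" "q \<in> tri_vertices M i" "p \<in> E" "q \<in> E"
    "ch i ` E = closed_segment (ch i p) (ch i q)"
proof -
  obtain p q r where pqr: "p \<in> T i" "q \<in> T i" "r \<in> T i" "\<not> collinear {ch i p, ch i q, ch i r}"
    "ch i ` T i = convex hull {ch i p, ch i q, ch i r}"
    using triangle[OF assms(1)] by metis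
  have V: "tri_vertices M i = {p, q, r}" using tri_vertices_eq[OF assms(1) pqr] .
  let ?S = "{ch i p, ch i q, ch i r}"
  have ind: "\<not> affine_dependent ?S" using pqr(4) by (simp add: collinear_3_eq_affine_dependent)
  have E: "E \<subseteq> T i" "(ch i ` E) face_of (convex hull ?S)" "aff_dim (ch i ` E) = 1"
    using assms(2) pqr(5) by (auto simp: tri_edges_def edge_of_def)
  obtain C where C: "C \<subseteq> ?S" "ch i ` E = convex hull C"
    using iffD1[OF face_of_convex_hull_affine_independent[OF ind] E(2)] by (elim exE conjE)
  have "\<not> affine_dependent C" using C(1) ind affine_independent_subset by blast
  moreover have "aff_dim C = 1" using E(3) unfolding C(2) aff_dim_convex_hull .
  ultimately have "card C = 2" using aff_dim_affine_independent[of C] by linarith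
  then obtain u w where uw: "C = {u, w}" "u \<noteq> w" by (meson card_2_iff)
  have "u \<in> ch i ` {p, q, r}" "w \<in> ch i ` {p, q, r}" using C(1) uw(1) by simp_all
  then obtain p' q' where p': "p' \<in> {p, q, r}" "u = ch i p'" and q': "q' \<in> {p, q, r}" "w = ch i q'"
    by (elim imageE)
  have seg: "ch i ` E = closed_segment (ch i p') (ch i q')"
    using C(2) uw p' q' by (simp add: segment_convex_hull)
  then have "ch i p' \<in> ch i ` E" "ch i q' \<in> ch i ` E" by auto
  moreover have "p' \<in> T i" "q' \<in> T i" using p' q' pqr(1-3) by auto
  ultimately have "p' \<in> E" "q' \<in> E"
    using inj_on_image_mem_iff[OF chart_inj[OF assms(1)] _ E(1)] by simp_all
  moreover have "p' \<noteq> q'" using p' q' uw(2) by metis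
  ultimately show ?thesis using that[of p' q'] p'(1) q'(1) V seg by simp
qed

text \<open>Since the norms are strictly convex, being between two points of a common edge is a metric
  notion, on which the two triangles agree; so a change of charts maps end points to end points.\<close>

lemma vertex_transfer:
  assumes ij: "i \<in> idx M" "j \<in> idx M" "i \<noteq> j" and z: "z \<in> T i \<inter> T j" "z \<in> tri_vertices M i"
  shows "z \<in> tri_vertices M j"
  using ij z(1)
proof (cases rule: inter_cases)
  case edge
  interpret Fi: scgauge "F i" using gauge ij by blast
  interpret Fj: scgauge "F j" using gauge ij by blast
  obtain r s where rs: "r \<noteq> s" "r \<in> tri_vertices M j" "s \<in> tri_vertices M j" "r \<in> T i \<inter> T j" "s \<in> T i \<inter> T j"
    "ch j ` (T i \<inter> T j) = closed_segment (ch j r) (ch j s)"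
    using edge_ends[OF ij(2) edge(2)] by metis
  show ?thesis
  proof (rule ccontr)
    assume "z \<notin> tri_vertices M j"
    then have ne: "z \<noteq> r" "z \<noteq> s" using rs by auto
    have "ch j z \<in> closed_segment (ch j r) (ch j s)" using rs(6) z(1) by blast
    then obtain t where t: "0 \<le> t" "t \<le> 1" "ch j z = (1 - t) *\<^sub>R ch j r + t *\<^sub>R ch j s"
      by (auto simp: in_segment)
    have t1: "0 \<le> 1 - t" using t by simp
    have A: "ch j z - ch j r = t *\<^sub>R (ch j s - ch j r)" "ch j s - ch j z = (1 - t) *\<^sub>R (ch j s - ch j r)"
      using t(3) by (auto simp: algebra_simps)
    have "F j (ch j s - ch j r) = F j (ch j z - ch j r) + F j (ch j s - ch j z)"
      unfolding A Fj.homog[OF t(1)] Fj.homog[OF t1] by (simp add: left_diff_distrib)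
    then have "F i (ch i s - ch i r) = F i (ch i z - ch i r) + F i (ch i s - ch i z)"
      using nrm_eq[OF ij(1,2)] rs(4,5) z(1) by simp
    moreover have "ch i z - ch i r \<noteq> 0" using chart_eq_iff[of i z r] ij z rs ne by auto
    ultimately obtain l where l: "l \<ge> 0" "ch i s - ch i z = l *\<^sub>R (ch i z - ch i r)"
      using Fi.strict[of "ch i z - ch i r" "ch i s - ch i z"] by auto
    then have e: "(1 + l) *\<^sub>R ch i z = l *\<^sub>R ch i r + ch i s" by (simp add: algebra_simps)
    have "ch i z = inverse (1 + l) *\<^sub>R ((1 + l) *\<^sub>R ch i z)" using l by simp
    also have "\<dots> = (l / (1 + l)) *\<^sub>R ch i r + (1 / (1 + l)) *\<^sub>R ch i s"
      unfolding e by (simp add: scaleR_add_right divide_inverse mult.commute)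
    finally have "ch i z \<in> closed_segment (ch i r) (ch i s)"
      unfolding in_segment using l by (intro exI[of _ "1 / (1 + l)"]) (auto simp: field_simps)
    moreover have "ch i z \<noteq> ch i r" "ch i z \<noteq> ch i s" using chart_eq_iff ij z rs ne by auto
    ultimately have "ch i z \<in> open_segment (ch i r) (ch i s)" by (simp add: open_segment_def)
    moreover have "ch i z extreme_point_of ch i ` T i" using z(2) by (simp add: tri_vertices_def)
    ultimately show False using rs(4,5) unfolding extreme_point_of_def by blast
  qed
qed (use z in auto)

end

section \<open>The triangles around the vertex\<close>

locale pf_vertex = pf_surf M for M :: "('a, 'i) pf_surface" +
  fixes x :: 'a
  assumes x: "is_vertex M x"
begin

abbreviation "I \<equiv> star M x"

text \<open>The boundary rays of a sector are labelled by points of the surface rather than by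
  vectors, so that neighbouring sectors name a common ray by the same label.\<close>

definition Y :: "'i \<Rightarrow> 'a set" where "Y i = tri_vertices M i - {x}"
definition e :: "'i \<Rightarrow> 'a \<Rightarrow> real^2" where "e i y = ch i y - ch i x"

lemma star_idx [simp]: "i \<in> I \<Longrightarrow> i \<in> idx M" and star_x [simp]: "i \<in> I \<Longrightarrow> x \<in> T i"
  by (auto simp: star_def)

text \<open>\<open>x\<close> is a vertex of one triangle, and \<open>vertex_transfer\<close> carries
  this over to every other triangle containing it. Hence each sector is spanned by two edges at
  \<open>x\<close>.\<close>

lemma star_vertex: "i \<in> I \<Longrightarrow> x \<in> tri_vertices M i"
proof -
  assume i: "i \<in> I"
  obtain k where k: "k \<in> idx M" "x \<in> tri_vertices M k" using x unfolding is_vertex_def by blast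
  show ?thesis
  proof (cases "i = k")
    case False
    then show ?thesis using vertex_transfer[of k i x] k i by (auto simp: tri_vertices_def)
  qed (use k in simp)
qed

lemma Y_T: "\<lbrakk>i \<in> I; y \<in> Y i\<rbrakk> \<Longrightarrow> y \<in> T i" by (auto simp: Y_def tri_vertices_def)

lemma Y_two:
  assumes i: "i \<in> I"
  obtains y y' where "y \<noteq> y'" "Y i = {y, y'}" "\<not> collinear {ch i x, ch i y, ch i y'}"
    "ch i ` T i = convex hull {ch i x, ch i y, ch i y'}"
proof -
  obtain p q r where pqr: "p \<in> T i" "q \<in> T i" "r \<in> T i" "\<not> collinear {ch i p, ch i q, ch i r}"
    "ch i ` T i = convex hull {ch i p, ch i q, ch i r}"
    using triangle[OF star_idx[OF i]] by metis
  have V: "tri_vertices M i = {p, q, r}" using tri_vertices_eq[OF star_idx[OF i] pqr] .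
  have ne: "p \<noteq> q" "p \<noteq> r" "q \<noteq> r" using pqr(4) by (auto simp: insert_commute)
  consider "x = p" | "x = q" | "x = r" using star_vertex[OF i] V by auto
  then show ?thesis
  proof cases
    case 1
    then have "Y i = {q, r}" unfolding Y_def V using ne by auto
    then show ?thesis using pqr 1 ne by (intro that[of q r]) (simp_all)
  next
    case 2
    then have "Y i = {p, r}" unfolding Y_def V using ne by auto
    then show ?thesis using pqr 2 ne by (intro that[of p r]) (simp_all add: insert_commute)
  next
    case 3
    then have "Y i = {p, q}" unfolding Y_def V using ne by auto
    then show ?thesis using pqr 3 ne by (intro that[of p q]) (simp_all add: insert_commute)
  qed
qed

definition oth :: "'i \<Rightarrow> 'a \<Rightarrow> 'a" where "oth i y = (THE y'. y' \<in> Y i \<and> y' \<noteq> y)"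

lemma oth:
  assumes "i \<in> I" "y \<in> Y i"
  shows "oth i y \<in> Y i" "oth i y \<noteq> y" "Y i = {y, oth i y}" "oth i (oth i y) = y"
proof -
  obtain y1 y2 where Y: "y1 \<noteq> y2" "Y i = {y1, y2}" using Y_two[OF assms(1)] by metis
  have "oth i y1 = y2" "oth i y2 = y1" unfolding oth_def using Y by (auto intro!: the_equality)
  then show "oth i y \<in> Y i" "oth i y \<noteq> y" "Y i = {y, oth i y}" "oth i (oth i y) = y"
    using Y assms by auto
qed

lemma Y_hull:
  assumes "i \<in> I" "y \<in> Y i"
  shows "\<not> collinear {ch i x, ch i y, ch i (oth i y)}"
    and "ch i ` T i = convex hull {ch i x, ch i y, ch i (oth i y)}"
proof -
  obtain y1 y2 where Y: "y1 \<noteq> y2" "Y i = {y1, y2}" "\<not> collinear {ch i x, ch i y1, ch i y2}"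
    "ch i ` T i = convex hull {ch i x, ch i y1, ch i y2}"
    by (rule Y_two[OF assms(1)])
  have "y = y1 \<and> oth i y = y2 \<or> y = y2 \<and> oth i y = y1"
    using oth(1,2)[OF assms] assms(2) unfolding Y(2) by auto
  then have "{ch i x, ch i y, ch i (oth i y)} = {ch i x, ch i y1, ch i y2}" by (elim disjE) auto
  then show "\<not> collinear {ch i x, ch i y, ch i (oth i y)}"
    "ch i ` T i = convex hull {ch i x, ch i y, ch i (oth i y)}" using Y(3,4) by simp_all
qed

lemma e_independent:
  assumes "i \<in> I" "y \<in> Y i"
  shows "e i y \<noteq> 0" "\<nexists>c. e i (oth i y) = c *\<^sub>R e i y"
proof -
  have "\<not> collinear {0, e i y, e i (oth i y)}"
    using Y_hull(1)[OF assms] collinear_3[of "ch i y" "ch i x" "ch i (oth i y)"] by (simp add: e_def insert_commute)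
  then show "e i y \<noteq> 0" "\<nexists>c. e i (oth i y) = c *\<^sub>R e i y" by (auto simp: collinear_lemma)
qed

text \<open>\<open>co i y\<close> is the coordinate along \<open>e i y\<close> in the basis of the two edge vectors at the vertex.\<close>

definition co :: "'i \<Rightarrow> 'a \<Rightarrow> real^2 \<Rightarrow> real" where
  "co i y = (SOME f. linear f \<and> f (e i y) = 1 \<and> f (e i (oth i y)) = 0)"

lemma co:
  assumes "i \<in> I" "y \<in> Y i"
  shows "linear (co i y)" "co i y (e i y) = 1" "co i y (e i (oth i y)) = 0"
    "co i (oth i y) (e i y) = 0" "co i (oth i y) (e i (oth i y)) = 1"
    "w = co i y w *\<^sub>R e i y + co i (oth i y) w *\<^sub>R e i (oth i y)"
proof -
  have ex: "linear (co i y) \<and> co i y (e i y) = 1 \<and> co i y (e i (oth i y)) = 0" if y: "y \<in> Y i" for y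
  proof -
    obtain f g where "linear f" "linear g" "f (e i y) = (1::real)" "f (e i (oth i y)) = 0"
      "g (e i y) = (0::real)" "g (e i (oth i y)) = 1" "\<forall>w. w = f w *\<^sub>R e i y + g w *\<^sub>R e i (oth i y)"
      using plane_coordinates[OF e_independent[OF assms(1) y]] by (elim exE conjE)
    then have "\<exists>f. linear f \<and> f (e i y) = (1::real) \<and> f (e i (oth i y)) = 0" by blast
    from someI_ex[OF this] show ?thesis unfolding co_def .
  qed
  note a = ex[OF assms(2)] and b = ex[OF oth(1)[OF assms]]
  show "linear (co i y)" "co i y (e i y) = 1" "co i y (e i (oth i y)) = 0" using a by auto
  show "co i (oth i y) (e i y) = 0" "co i (oth i y) (e i (oth i y)) = 1" using b oth[OF assms] by auto
  obtain f g where fg: "linear f" "linear g" "f (e i y) = (1::real)" "f (e i (oth i y)) = 0"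
      "g (e i y) = (0::real)" "g (e i (oth i y)) = 1" "\<forall>w. w = f w *\<^sub>R e i y + g w *\<^sub>R e i (oth i y)"
    using plane_coordinates[OF e_independent[OF assms]] by (elim exE conjE)
  have w: "w = f w *\<^sub>R e i y + g w *\<^sub>R e i (oth i y)" using fg(7) by (rule spec)
  have c1: "co i y w = f w"
  proof (subst w)
    show "co i y (f w *\<^sub>R e i y + g w *\<^sub>R e i (oth i y)) = f w" using a by (simp add: linear_add linear_cmul)
  qed
  have c2: "co i (oth i y) w = g w"
  proof (subst w)
    show "co i (oth i y) (f w *\<^sub>R e i y + g w *\<^sub>R e i (oth i y)) = g w"
      using b oth(4)[OF assms] by (simp add: linear_add linear_cmul)
  qed
  show "w = co i y w *\<^sub>R e i y + co i (oth i y) w *\<^sub>R e i (oth i y)" unfolding c1 c2 by (rule w)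
qed

lemma co_simps [simp]:
  assumes "i \<in> I" "y \<in> Y i"
  shows "co i y (v + w) = co i y v + co i y w" "co i y (v - w) = co i y v - co i y w"
    "co i y (- v) = - co i y v" "co i y (r *\<^sub>R v) = r * co i y v" "co i y 0 = 0"
    "co i y (e i y) = 1" "co i y (e i (oth i y)) = 0" "co i (oth i y) (e i y) = 0"
  using co[OF assms] by (auto simp: linear_add linear_diff linear_neg linear_cmul linear_0)

lemma co_eqI:
  assumes "i \<in> I" "y \<in> Y i" "co i y v = co i y w" "co i (oth i y) v = co i (oth i y) w"
  shows "v = w"
  using co(6)[OF assms(1,2), of v] co(6)[OF assms(1,2), of w] assms(3,4) by metis

text \<open>The two coordinates are the barycentric weights of the outer vertices; the last
  inequality expresses the weight of \<open>x\<close>.\<close>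

lemma triangle_shape:
  assumes "i \<in> I" "y \<in> Y i"
  shows "ch i x + w \<in> ch i ` T i \<longleftrightarrow> 0 \<le> co i y w \<and> 0 \<le> co i (oth i y) w \<and> co i y w + co i (oth i y) w \<le> 1"
proof -
  note T = Y_hull(2)[OF assms]
  have ch: "ch i y = ch i x + e i y" "ch i (oth i y) = ch i x + e i (oth i y)" by (auto simp: e_def)
  have o: "oth i y \<in> Y i" using oth[OF assms] by blast
  show ?thesis
  proof
    assume "ch i x + w \<in> ch i ` T i"
    then obtain u v t where uvt: "0 \<le> u" "0 \<le> v" "0 \<le> t" "u + v + t = 1"
      "ch i x + w = u *\<^sub>R ch i x + v *\<^sub>R ch i y + t *\<^sub>R ch i (oth i y)"
      unfolding T convex_hull_3 by (elim CollectE exE conjE)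
    note uvt(5)
    also have "u *\<^sub>R ch i x + v *\<^sub>R ch i y + t *\<^sub>R ch i (oth i y)
        = (u + v + t) *\<^sub>R ch i x + v *\<^sub>R e i y + t *\<^sub>R e i (oth i y)"
      unfolding ch by (simp add: algebra_simps)
    finally have w: "w = v *\<^sub>R e i y + t *\<^sub>R e i (oth i y)" using uvt(4) by simp
    have "co i y w = v" "co i (oth i y) w = t"
      unfolding w using assms o co(5)[OF assms] by auto
    then show "0 \<le> co i y w \<and> 0 \<le> co i (oth i y) w \<and> co i y w + co i (oth i y) w \<le> 1" using uvt by simp
  next
    assume h: "0 \<le> co i y w \<and> 0 \<le> co i (oth i y) w \<and> co i y w + co i (oth i y) w \<le> 1"
    have "ch i x + w = ch i x + (co i y w *\<^sub>R e i y + co i (oth i y) w *\<^sub>R e i (oth i y))"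
      using co(6)[OF assms, of w] by (rule arg_cong)
    also have "\<dots> = (1 - co i y w - co i (oth i y) w) *\<^sub>R ch i x + co i y w *\<^sub>R ch i y
        + co i (oth i y) w *\<^sub>R ch i (oth i y)"
      unfolding ch by (simp add: algebra_simps)
    finally show "ch i x + w \<in> ch i ` T i"
      unfolding T convex_hull_3 using h by (intro CollectI exI conjI) auto
  qed
qed

end

section \<open>Closed triangles and local finiteness\<close>

context pf_surf begin

lemma chart_homeo:
  assumes "i \<in> idx M"
  shows "homeomorphic_map (subtopology X (T i)) (top_of_set (ch i ` T i)) (ch i)"
  by (rule triangle[OF assms])

lemma T_closed:
  assumes "i \<in> idx M"
  shows "closedin X (T i)"
proof -
  obtain p q r where pqr: "ch i ` T i = convex hull {ch i p, ch i q, ch i r}"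
    by (rule triangle[OF assms])
  have "compact (ch i ` T i)" unfolding pqr by (rule finite_imp_compact_convex_hull) simp
  then have "compact_space (top_of_set (ch i ` T i))"
    by (simp add: compact_space_subtopology)
  then have "compact_space (subtopology X (T i))"
    using homeomorphic_compact_space homeomorphic_map_imp_homeomorphic_space chart_homeo[OF assms] by blast
  then have "compactin X (T i)" using T_subset[OF assms] by (simp add: compactin_subspace)
  moreover have "Hausdorff_space X" using surface by (simp add: surface_def)
  ultimately show ?thesis by (rule compactin_imp_closedin[rotated])
qed

text \<open>Only finitely many triangles meet a suitable neighbourhood of \<open>q\<close>; remove
  from it the union of those that miss \<open>q\<close>, which is closed.\<close>

lemma small_neighbourhood:
  assumes "q \<in> topspace X"
  shows "\<exists>N. openin X N \<and> q \<in> N \<and> (\<forall>z\<in>N. \<forall>j\<in>idx M. z \<in> T j \<longrightarrow> q \<in> T j)"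
proof -
  have "locally_finite_in X (T ` idx M)" using M by (simp add: pf_finsler_surface_def)
  then obtain V where V: "openin X V" "q \<in> V" "finite {U \<in> T ` idx M. U \<inter> V \<noteq> {}}"
    using assms unfolding locally_finite_in_def by blast
  define B where "B = {U \<in> T ` idx M. U \<inter> V \<noteq> {} \<and> q \<notin> U}"
  have "finite B" by (rule finite_subset[OF _ V(3)]) (auto simp: B_def)
  moreover have "\<forall>U\<in>B. closedin X U" using T_closed unfolding B_def by blast
  ultimately have "closedin X (\<Union>B)" by (intro closedin_Union) auto
  then have "openin X (V - \<Union>B)" using V(1) by (rule openin_diff[rotated])
  moreover have "q \<in> V - \<Union>B" using V(2) unfolding B_def by blast
  moreover have "\<forall>z\<in>V - \<Union>B. \<forall>j\<in>idx M. z \<in> T j \<longrightarrow> q \<in> T j"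
    unfolding B_def by blast
  ultimately show ?thesis by (intro exI[of _ "V - \<Union>B"] conjI)
qed

lemma vertex_in_segment:
  assumes "i \<in> idx M" "p \<in> T i" "q \<in> T i" "z \<in> tri_vertices M i" "ch i z \<in> closed_segment (ch i p) (ch i q)"
  shows "z = p \<or> z = q"
proof -
  have z: "z \<in> T i" "ch i z extreme_point_of ch i ` T i" using assms(4) by (auto simp: tri_vertices_def)
  then have "ch i z \<notin> open_segment (ch i p) (ch i q)"
    using assms(2,3) unfolding extreme_point_of_def by blast
  then have "ch i z = ch i p \<or> ch i z = ch i q" using assms(5) by (auto simp: open_segment_def)
  then show ?thesis using chart_eq_iff[OF assms(1)] z(1) assms(2,3) by metis
qed

end

section \<open>Edges shared by triangles at the vertex\<close>

context pf_vertex begin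

lemma Y_x: "y \<in> Y i \<Longrightarrow> y \<noteq> x" by (simp add: Y_def)

lemma tri_vertices_Y: "i \<in> I \<Longrightarrow> tri_vertices M i = insert x (Y i)"
  using star_vertex by (auto simp: Y_def)

text \<open>\<open>x\<close> and \<open>y\<close> lie on the common edge and are extreme points of
  the triangle, so they must be its two ends.\<close>

lemma shared_edge_segment:
  assumes ij: "i \<in> I" "j \<in> idx M" "i \<noteq> j" and y: "y \<in> Y i" "y \<in> T j" "x \<in> T j"
  shows "ch i ` (T i \<inter> T j) = closed_segment (ch i x) (ch i y)"
proof -
  have i: "i \<in> idx M" using ij by simp
  have xy: "x \<in> T i \<inter> T j" "y \<in> T i \<inter> T j" using Y_T y ij by auto
  have E: "T i \<inter> T j \<in> tri_edges M i"
    using i ij(2,3) xy(1)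
  proof (cases rule: inter_cases)
    case vertex
    then show ?thesis using xy(2) Y_x[OF y(1)] by simp
  qed simp
  obtain p q where pq: "p \<noteq> q" "p \<in> T i \<inter> T j" "q \<in> T i \<inter> T j"
    "ch i ` (T i \<inter> T j) = closed_segment (ch i p) (ch i q)"
    by (rule edge_ends[OF i E])
  have "ch i x \<in> closed_segment (ch i p) (ch i q)" "ch i y \<in> closed_segment (ch i p) (ch i q)"
    using xy pq(4) by blast+
  moreover have "x \<in> tri_vertices M i" "y \<in> tri_vertices M i" "p \<in> T i" "q \<in> T i"
    using tri_vertices_Y[OF ij(1)] y(1) pq by simp_all
  ultimately have "x = p \<or> x = q" "y = p \<or> y = q"
    using vertex_in_segment[OF i, of p q] by simp_all
  then show "ch i ` (T i \<inter> T j) = closed_segment (ch i x) (ch i y)"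
    using pq(4) Y_x[OF y(1)] closed_segment_commute by metis
qed

lemma shared_edge_vertex:
  assumes ij: "i \<in> I" "j \<in> idx M" "i \<noteq> j" and y: "y \<in> Y i" "y \<in> T j" "x \<in> T j"
  shows "j \<in> I" "y \<in> Y j"
proof -
  show j: "j \<in> I" using ij(2) y(3) unfolding star_def by blast
  have "y \<in> tri_vertices M i" using y by (simp add: Y_def)
  then have "y \<in> tri_vertices M j"
    using vertex_transfer[of i j y] ij y Y_T[OF ij(1) y(1)] by simp
  then show "y \<in> Y j" using Y_x[OF y(1)] by (simp add: Y_def)
qed

text \<open>The agreement of the metrics is used for both orders of the end points, which settles
  positive and negative \<open>r\<close> separately; a norm here may be asymmetric.\<close>

lemma edge_norm:
  assumes "i \<in> I" "j \<in> I" "y \<in> Y i" "y \<in> Y j"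
  shows "F i (r *\<^sub>R e i y) = F j (r *\<^sub>R e j y)"
proof -
  interpret Fi: scgauge "F i" using gauge assms by simp
  interpret Fj: scgauge "F j" using gauge assms by simp
  have xy: "x \<in> T i \<inter> T j" "y \<in> T i \<inter> T j" using Y_T assms by auto
  have a: "F i (e i y) = F j (e j y)" using nrm_eq[of i j x y] xy assms by (simp add: e_def)
  have b: "F i (- e i y) = F j (- e j y)" using nrm_eq[of i j y x] xy assms by (simp add: e_def)
  show ?thesis
  proof (cases "0 \<le> r")
    case True then show ?thesis using a by (simp add: Fi.homog Fj.homog)
  next
    case False
    then have "0 \<le> - r" by simp
    from Fi.homog[OF this, of "- e i y"] Fj.homog[OF this, of "- e j y"] show ?thesis using b by simp
  qed
qed

text \<open>In either chart the parameter is the distance from \<open>x\<close> divided by the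
  length of the edge. The two metrics agree on both, so the parameters coincide.\<close>

lemma shared_edge_coordinates:
  assumes ij: "i \<in> I" "j \<in> I" "i \<noteq> j" and y: "y \<in> Y i" "y \<in> Y j" and z: "z \<in> T i \<inter> T j"
  shows "\<exists>s\<in>{0..1}. ch i z = ch i x + s *\<^sub>R e i y \<and> ch j z = ch j x + s *\<^sub>R e j y"
proof -
  have "ch i z \<in> closed_segment (ch i x) (ch i y)"
    using shared_edge_segment[of i j y] ij y z Y_T by auto
  then obtain s where s: "s \<in> {0..1}" "ch i z = ch i x + s *\<^sub>R e i y"
    by (auto simp: in_segment e_def algebra_simps)
  have "ch j z \<in> closed_segment (ch j x) (ch j y)"
    using shared_edge_segment[of j i y] ij y z Y_T by (auto simp: Int_commute)
  then obtain t where t: "t \<in> {0..1}" "ch j z = ch j x + t *\<^sub>R e j y"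
    by (auto simp: in_segment e_def algebra_simps)
  interpret Fi: scgauge "F i" using gauge ij by simp
  have "F i (ch i z - ch i x) = F j (ch j z - ch j x)" using nrm_eq[of i j x z] z ij by simp
  then have "F i (s *\<^sub>R e i y) = F i (t *\<^sub>R e i y)" using s t edge_norm[OF ij(1,2) y] by simp
  then have "s * F i (e i y) = t * F i (e i y)" using s t by (simp add: Fi.homog)
  then have "s = t" using Fi.pos[OF e_independent(1)[OF ij(1) y(1)]] by simp
  then show ?thesis using s t by blast
qed

lemma shared_edge_points:
  assumes ij: "i \<in> I" "j \<in> I" "i \<noteq> j" and y: "y \<in> Y i" "y \<in> Y j" and s: "s \<in> {0..1}"
  obtains z where "z \<in> T i \<inter> T j" "ch i z = ch i x + s *\<^sub>R e i y" "ch j z = ch j x + s *\<^sub>R e j y"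
proof -
  have "ch i x + s *\<^sub>R e i y \<in> closed_segment (ch i x) (ch i y)"
    using s by (auto simp: in_segment e_def algebra_simps intro!: exI[of _ s])
  then have "ch i x + s *\<^sub>R e i y \<in> ch i ` (T i \<inter> T j)"
    using shared_edge_segment[of i j y] ij y Y_T by simp
  then obtain z where z: "z \<in> T i \<inter> T j" "ch i z = ch i x + s *\<^sub>R e i y" by (metis imageE)
  obtain t where t: "ch i z = ch i x + t *\<^sub>R e i y" "ch j z = ch j x + t *\<^sub>R e j y"
    using shared_edge_coordinates[OF ij y z(1)] by blast
  have "s = t" using t(1) z(2) e_independent(1)[OF ij(1) y(1)] by simp
  then show ?thesis using that z t by metis
qed

lemma shared_edge_unique:
  assumes ij: "i \<in> I" "j \<in> I" "i \<noteq> j" and y: "y \<in> Y i" "y \<in> Y j" "y' \<in> Y i" "y' \<in> Y j"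
  shows "y' = y"
proof (rule ccontr)
  assume "y' \<noteq> y"
  then have o: "y' = oth i y" using oth[OF ij(1) y(1)] y by blast
  obtain s where "ch i y' = ch i x + s *\<^sub>R e i y"
    using shared_edge_coordinates[OF ij y(1,2), of y'] y Y_T ij by blast
  then have "e i (oth i y) = s *\<^sub>R e i y" using o by (simp add: e_def)
  then show False using e_independent(2)[OF ij(1) y(1)] by blast
qed

lemma star_inter:
  assumes ij: "i \<in> I" "j \<in> I" "i \<noteq> j"
  shows "T i \<inter> T j = {x} \<or> (\<exists>y. y \<in> Y i \<inter> Y j)"
proof -
  have i: "i \<in> idx M" and j: "j \<in> idx M" and xx: "x \<in> T i \<inter> T j" using ij by auto
  show ?thesis
    using i j ij(3) xx
  proof (cases rule: inter_cases)
    case edge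
    obtain p q where pq: "p \<noteq> q" "p \<in> tri_vertices M i" "q \<in> tri_vertices M i" "p \<in> T i \<inter> T j" "q \<in> T i \<inter> T j"
      by (rule edge_ends[OF i edge(1)])
    then obtain y where "y \<in> tri_vertices M i" "y \<in> T i \<inter> T j" "y \<noteq> x" by metis
    then have "y \<in> Y i" "y \<in> T j" by (auto simp: Y_def)
    then show ?thesis using shared_edge_vertex[OF ij(1) j ij(3)] star_x[OF ij(2)] by blast
  qed simp
qed

lemma finite_star: "finite I"
proof -
  obtain i where "i \<in> idx M" "x \<in> tri_vertices M i" using x unfolding is_vertex_def by blast
  then have i: "i \<in> I" unfolding star_def tri_vertices_def by blast
  then have "x \<in> topspace X" using T_subset[OF star_idx[OF i]] star_x[OF i] by blast
  moreover have "locally_finite_in X (T ` idx M)" using M by (simp add: pf_finsler_surface_def)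
  ultimately obtain V where V: "openin X V" "x \<in> V" "finite {U \<in> T ` idx M. U \<inter> V \<noteq> {}}"
    unfolding locally_finite_in_def by blast
  have "T ` I \<subseteq> {U \<in> T ` idx M. U \<inter> V \<noteq> {}}" using V(2) unfolding star_def by blast
  then have "finite (T ` I)" using V(3) finite_subset by blast
  \<comment> \<open>Local finiteness counts triangles as sets. It bounds the indices too, because
    two indices of one triangle would share both of its edges at \<open>x\<close>.\<close>
  moreover have "inj_on T I"
  proof (rule inj_onI, rule ccontr)
    fix i j assume ij: "i \<in> I" "j \<in> I" "T i = T j" "i \<noteq> j"
    obtain y0 y1 where "Y i = {y0, y1}" by (rule Y_two[OF ij(1)])
    then have y0: "y0 \<in> Y i" by simp
    have o: "oth i y0 \<in> Y i" "oth i y0 \<noteq> y0" using oth[OF ij(1) y0] by auto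
    have "y \<in> Y j" if "y \<in> Y i" for y
      using shared_edge_vertex[of i j y] that ij Y_T[OF ij(1) that] by simp
    then show False using shared_edge_unique[OF ij(1,2,4) y0] y0 o by blast
  qed
  ultimately show ?thesis by (rule finite_imageD)
qed

definition iv :: "'i \<Rightarrow> real^2 \<Rightarrow> 'a" where "iv i w = inv_into (T i) (ch i) (ch i x + w)"

lemma iv:
  assumes "i \<in> I" "ch i x + w \<in> ch i ` T i"
  shows "iv i w \<in> T i" "ch i (iv i w) = ch i x + w"
  using assms(2) by (auto simp: iv_def inv_into_into f_inv_into_f)

lemma iv_chart: "\<lbrakk>i \<in> I; z \<in> T i\<rbrakk> \<Longrightarrow> iv i (ch i z - ch i x) = z"
  using chart_inj[OF star_idx, of i] by (simp add: iv_def)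

lemma iv_continuous:
  assumes i: "i \<in> I" and f: "continuous_on S f" "\<And>w. w \<in> S \<Longrightarrow> ch i x + f w \<in> ch i ` T i"
  shows "continuous_map (top_of_set S) X (\<lambda>w. iv i (f w))"
proof -
  obtain g where g: "homeomorphic_maps (subtopology X (T i)) (top_of_set (ch i ` T i)) (ch i) g"
    using chart_homeo[OF star_idx[OF i]] homeomorphic_map_maps by blast
  have tT: "topspace (subtopology X (T i)) = T i"
    using T_subset[OF star_idx[OF i]] by (simp add: Int_absorb1)
  have gc: "continuous_map (top_of_set (ch i ` T i)) X g"
    and gi: "\<And>z. z \<in> T i \<Longrightarrow> g (ch i z) = z"
    using g unfolding homeomorphic_maps_def tT by (auto simp: continuous_map_in_subtopology)
  have "continuous_map (top_of_set S) (top_of_set (ch i ` T i)) (\<lambda>w. ch i x + f w)"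
    using f by (auto simp: continuous_map_in_subtopology intro!: continuous_intros)
  from continuous_map_compose[OF this gc]
  have "continuous_map (top_of_set S) X (\<lambda>w. g (ch i x + f w))" by (simp add: o_def)
  moreover have "g (ch i x + f w) = iv i (f w)" if "w \<in> S" for w
  proof -
    have "iv i (f w) \<in> T i" "ch i (iv i (f w)) = ch i x + f w" using iv[OF i f(2)[OF that]] by auto
    then show ?thesis using gi by metis
  qed
  ultimately show ?thesis by (rule continuous_map_eq) simp
qed

text \<open>The midpoint is in the relative interior of the edge, hence it belongs to exactly those
  triangles that contain the edge: it is no vertex, and the only edge of triangle \<open>i\<close>
  through it is the one from \<open>x\<close> to \<open>y\<close>.\<close>

lemma edge_midpoint:
  assumes i: "i \<in> I" and y: "y \<in> Y i"
  obtains q where "q \<in> T i" "ch i q = ch i x + (1 / 2) *\<^sub>R e i y" "q \<in> topspace X"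
    "\<And>j. j \<in> idx M \<Longrightarrow> q \<in> T j \<Longrightarrow> j \<noteq> i \<Longrightarrow> j \<in> I \<and> y \<in> Y j"
    "\<And>j. j \<in> I \<Longrightarrow> y \<in> Y j \<Longrightarrow> q \<in> T j \<and> ch j q = ch j x + (1 / 2) *\<^sub>R e j y"
proof -
  have ii: "i \<in> idx M" using i by simp
  have mid: "co i y ((1 / 2) *\<^sub>R e i y) = 1 / 2" "co i (oth i y) ((1 / 2) *\<^sub>R e i y) = 0"
    using i y oth(1)[OF i y] co(4)[OF i y] by simp_all
  define q where "q = iv i ((1 / 2) *\<^sub>R e i y)"
  have "ch i x + (1 / 2) *\<^sub>R e i y \<in> ch i ` T i" using triangle_shape[OF i y] mid by simp
  from iv[OF i this] have q: "q \<in> T i" "ch i q = ch i x + (1 / 2) *\<^sub>R e i y" by (auto simp: q_def)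
  have seg: "ch i q \<in> closed_segment (ch i x) (ch i y)"
    unfolding q in_segment by (rule exI[of _ "1 / 2"]) (simp add: e_def vec_eq_iff field_simps)
  have qnx: "q \<noteq> x" "q \<noteq> y"
    using q(2) e_independent(1)[OF i y] by (auto simp: e_def algebra_simps)
  have nv: "q \<notin> tri_vertices M i"
    using vertex_in_segment[OF ii star_x[OF i] Y_T[OF i y] _ seg] qnx by blast
  have "j \<in> I \<and> y \<in> Y j" if j: "j \<in> idx M" "q \<in> T j" "j \<noteq> i" for j
  proof -
    have "i \<noteq> j" "q \<in> T i \<inter> T j" using j q by auto
    with ii j(1) show ?thesis
    proof (cases rule: inter_cases)
      case vertex then show ?thesis using nv by simp
    next
      case edge
      obtain p r where pr: "p \<noteq> r" "p \<in> tri_vertices M i" "r \<in> tri_vertices M i" "p \<in> T i \<inter> T j" "r \<in> T i \<inter> T j"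
        "ch i ` (T i \<inter> T j) = closed_segment (ch i p) (ch i r)"
        by (rule edge_ends[OF ii edge(1)])
      have V: "tri_vertices M i = {x, y, oth i y}"
        using tri_vertices_Y[OF i] oth(3)[OF i y] by simp
      have "ch i q \<in> closed_segment (ch i p) (ch i r)" using pr(6) q(1) j(2) by blast
      then obtain t where t: "0 \<le> t" "t \<le> 1" "ch i q = (1 - t) *\<^sub>R ch i p + t *\<^sub>R ch i r"
        unfolding in_segment by blast
      define E where "E z = ch i z - ch i x" for z
      have E: "E x = 0" "E y = e i y" "E (oth i y) = e i (oth i y)" by (auto simp: E_def e_def)
      have "E q = (1 - t) *\<^sub>R E p + t *\<^sub>R E r" unfolding E_def t(3) by (simp add: algebra_simps)
      then have c: "(1 / 2) *\<^sub>R e i y = (1 - t) *\<^sub>R E p + t *\<^sub>R E r" by (simp add: E_def q)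
      have o: "oth i y \<in> Y i" using oth(1)[OF i y] .
      have c1: "1 / 2 = (1 - t) * co i y (E p) + t * co i y (E r)"
        using arg_cong[OF c, of "co i y"] i y by simp
      have c2: "0 = (1 - t) * co i (oth i y) (E p) + t * co i (oth i y) (E r)"
        using arg_cong[OF c, of "co i (oth i y)"] i o co(4)[OF i y] by simp
      note S = E co(2-5)[OF i y] co_simps(5)[OF i y] co_simps(5)[OF i o]
      have "p \<noteq> oth i y"
      proof
        assume p: "p = oth i y"
        then consider "r = x" | "r = y" using pr V by auto
        then show False by cases (use c1 c2 in \<open>auto simp: p S\<close>)
      qed
      moreover have "r \<noteq> oth i y"
      proof
        assume r: "r = oth i y"
        then consider "p = x" | "p = y" using pr V by auto
        then show False by cases (use c1 c2 in \<open>auto simp: r S\<close>)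
      qed
      ultimately have "{p, r} = {x, y}" using pr(1-3) V by auto
      then have "x \<in> T j" "y \<in> T j" using pr(4,5) by auto
      then show ?thesis using shared_edge_vertex[OF i j(1) _ y] j by metis
    qed
  qed
  moreover have "q \<in> T j \<and> ch j q = ch j x + (1 / 2) *\<^sub>R e j y" if j: "j \<in> I" "y \<in> Y j" for j
  proof (cases "j = i")
    case False
    obtain z where z: "z \<in> T i \<inter> T j" "ch i z = ch i x + (1 / 2) *\<^sub>R e i y" "ch j z = ch j x + (1 / 2) *\<^sub>R e j y"
      by (rule shared_edge_points[of i j y "1 / 2"]) (use i j y False in auto)
    then have "z = q" using chart_eq_iff[OF ii, of z q] q by simp
    then show ?thesis using z by simp
  qed (use q in simp)
  moreover have "q \<in> topspace X" using q T_subset[OF ii] by blast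
  ultimately show ?thesis using that q by blast
qed

text \<open>Without a second triangle, a neighbourhood of the midpoint would lie in triangle
  \<open>i\<close>. Its chart image would be open, although a triangle contains no disc around a
  point of its boundary.\<close>

lemma neighbour_exists:
  assumes i: "i \<in> I" and y: "y \<in> Y i"
  shows "\<exists>j\<in>I. j \<noteq> i \<and> y \<in> Y j"
proof (rule ccontr)
  assume no: "\<not> ?thesis"
  have ii: "i \<in> idx M" using i by simp
  obtain q where q: "q \<in> T i" "ch i q = ch i x + (1 / 2) *\<^sub>R e i y" "q \<in> topspace X"
    and J: "\<And>j. j \<in> idx M \<Longrightarrow> q \<in> T j \<Longrightarrow> j \<noteq> i \<Longrightarrow> j \<in> I \<and> y \<in> Y j"
    using edge_midpoint[OF i y] by metis
  obtain N where N: "openin X N" "q \<in> N" "\<And>z j. z \<in> N \<Longrightarrow> j \<in> idx M \<Longrightarrow> z \<in> T j \<Longrightarrow> q \<in> T j"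
    using small_neighbourhood[OF q(3)] by (elim exE conjE) blast
  have top: "topspace X = (\<Union>i\<in>idx M. T i)" using M by (simp add: pf_finsler_surface_def)
  have NT: "N \<subseteq> T i"
  proof
    fix z assume z: "z \<in> N"
    then have "z \<in> (\<Union>i\<in>idx M. T i)" using openin_subset[OF N(1)] top by blast
    then obtain j where j: "j \<in> idx M" "z \<in> T j" by blast
    then have "q \<in> T j" using N(3) z by blast
    then have "j = i" using J[OF j(1)] no by blast
    then show "z \<in> T i" using j by simp
  qed
  have "continuous_map (subtopology X (T i)) (top_of_set (ch i ` T i)) (ch i)"
    using chart_homeo[OF ii] by (rule homeomorphic_imp_continuous_map)
  then have "continuous_map (subtopology X (T i)) euclidean (ch i)"
    by (simp add: continuous_map_in_subtopology)
  then have "continuous_map (subtopology X N) euclidean (ch i)"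
    using continuous_map_from_subtopology_mono NT by blast
  then have "open (ch i ` N)"
    by (rule surface_open_image[OF surface N(1)]) (rule inj_on_subset[OF chart_inj[OF ii] NT])
  then obtain d where d: "0 < d" "ball (ch i q) d \<subseteq> ch i ` N"
    using N(2) by (metis openE imageI)
  let ?o = "e i (oth i y)"
  have o: "oth i y \<in> Y i" using oth(1)[OF i y] .
  have on: "?o \<noteq> 0" using e_independent(1)[OF i o] .
  \<comment> \<open>The displacement has length half the radius \<open>d\<close> and leads to the
    far side of the edge, where the coordinate of \<open>oth i y\<close> is negative.\<close>
  define r where "r = d / (2 * norm ?o)"
  have r: "0 < r" using d on by (simp add: r_def)
  have "norm (r *\<^sub>R ?o) = d / 2" using on d by (simp add: r_def)
  then have "ch i q - r *\<^sub>R ?o \<in> ball (ch i q) d" using d by (simp add: dist_norm)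
  then have "ch i q - r *\<^sub>R ?o \<in> ch i ` T i" using d(2) NT by blast
  then have "ch i x + ((1 / 2) *\<^sub>R e i y - r *\<^sub>R ?o) \<in> ch i ` T i" by (simp only: q(2) add_diff_eq)
  then have "0 \<le> co i (oth i y) ((1 / 2) *\<^sub>R e i y - r *\<^sub>R ?o)"
    unfolding triangle_shape[OF i y] by blast
  then show False using i o co(4)[OF i y] r by simp
qed

text \<open>Two triangles with a common edge already fill a neighbourhood of its midpoint.\<close>

lemma neighbour_unique:
  assumes ijk: "i \<in> I" "j \<in> I" "k \<in> I" "i \<noteq> j" "i \<noteq> k" "j \<noteq> k" and y: "y \<in> Y i" "y \<in> Y j" "y \<in> Y k"
  shows False
proof -
  let ?o = "oth i y" and ?p = "oth j y" and ?s = "oth k y"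
  have o: "?o \<in> Y i" "?p \<in> Y j" "?s \<in> Y k" using oth(1) ijk y by auto
  \<comment> \<open>\<open>W\<close> is a parallelogram around the midpoint of the edge, in the
    coordinates of triangle \<open>i\<close>; \<open>L\<close> unfolds its half beyond the edge into
    triangle \<open>j\<close>. The bounds 1/4 and 3/4 keep both halves inside the triangles.\<close>
  define W where "W = {w. - 1 / 4 < co i ?o w \<and> co i ?o w < 1 / 4 \<and> 1 / 4 < co i y w \<and> co i y w < 3 / 4}"
  define L where "L w = co i y w *\<^sub>R e j y - co i ?o w *\<^sub>R e j ?p" for w
  have ci: "continuous_on UNIV (co i y)" "continuous_on UNIV (co i ?o)"
    using co(1)[OF ijk(1) y(1)] co(1)[OF ijk(1) o(1)] linear_continuous_on linear_conv_bounded_linear by blast+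
  have W: "open W" unfolding W_def
    by (intro open_Collect_conj open_Collect_less continuous_on_const ci)
  have coL: "co j y (L w) = co i y w" "co j ?p (L w) = - co i ?o w" for w
    using ijk(2) y(2) o(2) co(4,5)[OF ijk(2) y(2)] by (simp_all add: L_def)
  have iS: "ch i x + w \<in> ch i ` T i" if "w \<in> W" "0 \<le> co i ?o w" for w
    unfolding triangle_shape[OF ijk(1) y(1)] using that by (simp add: W_def)
  have jS: "ch j x + L w \<in> ch j ` T j" if "w \<in> W" "co i ?o w \<le> 0" for w
    unfolding triangle_shape[OF ijk(2) y(2)] coL using that by (simp add: W_def)
  define g where "g w = (if 0 \<le> co i ?o w then iv i w else iv j (L w))" for w
  have gc: "continuous_map (top_of_set W) X g"
    unfolding g_def[abs_def]
  proof (rule continuous_map_cases_le)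
    show "continuous_map (top_of_set W) euclideanreal (co i ?o)" using ci continuous_on_subset by auto
    have "continuous_map (top_of_set {w \<in> W. 0 \<le> co i ?o w}) X (iv i)"
      by (rule iv_continuous[OF ijk(1)]) (auto intro: iS)
    then show "continuous_map (subtopology (top_of_set W) {w \<in> topspace (top_of_set W). 0 \<le> co i ?o w}) X (iv i)"
      by (simp add: subtopology_subtopology Int_absorb1)
    have "continuous_map (top_of_set {w \<in> W. co i ?o w \<le> 0}) X (\<lambda>w. iv j (L w))"
    proof (rule iv_continuous[OF ijk(2)])
      show "continuous_on {w \<in> W. co i ?o w \<le> 0} L"
        unfolding L_def by (intro continuous_intros continuous_on_subset[OF ci(1)] continuous_on_subset[OF ci(2)]) auto
    qed (use jS in auto)
    then show "continuous_map (subtopology (top_of_set W) {w \<in> topspace (top_of_set W). co i ?o w \<le> 0}) X (\<lambda>w. iv j (L w))"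
      by (simp add: subtopology_subtopology Int_absorb1)
    show "iv i w = iv j (L w)" if "w \<in> topspace (top_of_set W)" "0 = co i ?o w" for w
    proof -
      have w: "w \<in> W" "co i ?o w = 0" using that by auto
      obtain z where z: "z \<in> T i \<inter> T j" "ch i z = ch i x + co i y w *\<^sub>R e i y" "ch j z = ch j x + co i y w *\<^sub>R e j y"
        by (rule shared_edge_points[OF ijk(1,2,4) y(1,2), of "co i y w"]) (use w in \<open>auto simp: W_def\<close>)
      have "w = co i y w *\<^sub>R e i y" using co(6)[OF ijk(1) y(1), of w] w(2) by simp
      then have "iv i w = z" using iv_chart[OF ijk(1), of z] z by simp
      moreover have "iv j (L w) = z" using iv_chart[OF ijk(2), of z] z w(2) by (simp add: L_def)
      ultimately show ?thesis by simp
    qed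
  qed simp
  have gi: "g w \<in> T i" "ch i (g w) = ch i x + w" if "w \<in> W" "0 \<le> co i ?o w" for w
    using iv[OF ijk(1) iS[OF that]] that by (auto simp: g_def)
  have gj: "g w \<in> T j" "ch j (g w) = ch j x + L w" if "w \<in> W" "co i ?o w < 0" for w
    using iv[OF ijk(2) jS, of w] that by (auto simp: g_def)
  have mixed: "g v \<noteq> g w" if vw: "v \<in> W" "w \<in> W" "0 \<le> co i ?o v" "co i ?o w < 0" for v w
  proof
    assume "g v = g w"
    then have "g w \<in> T i \<inter> T j" using gi[OF vw(1,3)] gj[OF vw(2,4)] by simp
    then obtain s where "ch j (g w) = ch j x + s *\<^sub>R e j y"
      using shared_edge_coordinates[OF ijk(1,2,4) y(1,2)] by blast
    then have "L w = s *\<^sub>R e j y" using gj[OF vw(2,4)] by simp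
    then have "co j ?p (L w) = 0" using ijk(2) o(2) co(4)[OF ijk(2) y(2)] by simp
    then show False using coL vw by simp
  qed
  have inj: "inj_on g W"
  proof (rule inj_onI)
    fix v w assume vw: "v \<in> W" "w \<in> W" "g v = g w"
    consider "0 \<le> co i ?o v" "0 \<le> co i ?o w" | "0 \<le> co i ?o v" "co i ?o w < 0"
      | "co i ?o v < 0" "0 \<le> co i ?o w" | "co i ?o v < 0" "co i ?o w < 0" by linarith
    then show "v = w"
    proof cases
      case 1
      have "ch i x + v = ch i x + w" using gi(2)[OF vw(1) 1(1)] gi(2)[OF vw(2) 1(2)] vw(3) by metis
      then show ?thesis by simp
    next
      case 2 then show ?thesis using mixed vw by blast
    next
      case 3 then show ?thesis using mixed[of w v] vw by simp
    next
      case 4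
      have "ch j x + L v = ch j x + L w" using gj(2)[OF vw(1) 4(1)] gj(2)[OF vw(2) 4(2)] vw(3) by metis
      then have "L v = L w" by simp
      then show ?thesis using coL co_eqI[OF ijk(1) y(1), of v w] by (metis neg_equal_iff_equal)
    qed
  qed
  have op: "openin X (g ` W)" using surface_invariance_of_domain[OF surface W gc inj] .
  \<comment> \<open>A path that starts at the midpoint and enters triangle \<open>k\<close>
    transversally. The open image of \<open>W\<close> contains its start, hence also a point with
    \<open>s > 0\<close>, which would then lie on the edge.\<close>
  define f where "f s = (1 / 2) *\<^sub>R e k y + s *\<^sub>R e k ?s" for s :: real
  have cof: "co k y (f s) = 1 / 2" "co k ?s (f s) = s" for s
    using ijk(3) y(3) o(3) co(4,5)[OF ijk(3) y(3)] by (simp_all add: f_def)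
  have kS: "ch k x + f s \<in> ch k ` T k" if "s \<in> {0..1/2}" for s
    unfolding triangle_shape[OF ijk(3) y(3)] cof using that by simp
  have kc: "continuous_map (top_of_set {0..1/2}) X (\<lambda>s. iv k (f s))"
    by (rule iv_continuous[OF ijk(3) _ kS]) (auto simp: f_def intro!: continuous_intros)
  define S where "S = {s \<in> {0..1/2}. iv k (f s) \<in> g ` W}"
  have "openin (top_of_set {0..1/2}) S"
    using openin_continuous_map_preimage[OF kc op] by (simp add: S_def)
  moreover have "iv k (f 0) \<in> g ` W"
  proof -
    let ?w = "(1 / 2) *\<^sub>R e i y"
    have w: "co i y ?w = 1 / 2" "co i ?o ?w = 0" using ijk(1) y(1) o(1) co(4)[OF ijk(1) y(1)] by simp_all
    then have "?w \<in> W" by (simp add: W_def)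
    obtain z where z: "z \<in> T i \<inter> T k" "ch i z = ch i x + (1/2) *\<^sub>R e i y" "ch k z = ch k x + (1/2) *\<^sub>R e k y"
      by (rule shared_edge_points[OF ijk(1,3,5) y(1,3), of "1/2"]) simp_all
    have "g ?w = z" using iv_chart[OF ijk(1), of z] z w by (simp add: g_def)
    moreover have "iv k (f 0) = z" using iv_chart[OF ijk(3), of z] z by (simp add: f_def)
    ultimately show ?thesis using \<open>?w \<in> W\<close> by blast
  qed
  then have "0 \<in> S" by (simp add: S_def)
  ultimately obtain d where d: "0 < d" "ball 0 d \<inter> {0..1/2} \<subseteq> S"
    unfolding openin_contains_ball by blast
  define s where "s = min (d / 2) (1 / 2)"
  have s: "0 < s" "s < d" "s \<le> 1/2" using d by (auto simp: s_def)
  then have "s \<in> ball 0 d \<inter> {0..1/2}" by simp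
  then have "iv k (f s) \<in> g ` W" using d(2) unfolding S_def by blast
  then obtain w where w: "w \<in> W" "iv k (f s) = g w" by blast
  have zk: "iv k (f s) \<in> T k" "ch k (iv k (f s)) = ch k x + f s" using iv[OF ijk(3) kS] s by auto
  have "\<exists>l. l \<in> {i, j} \<and> g w \<in> T l" using gi(1) gj(1) w(1) by (metis insertCI not_less)
  then obtain l where l: "l \<in> {i, j}" "iv k (f s) \<in> T l" using w by auto
  then have l': "l \<in> I" "l \<noteq> k" "y \<in> Y l" using ijk y by auto
  obtain t where "ch k x + f s = ch k x + t *\<^sub>R e k y"
    using shared_edge_coordinates[OF l'(1) ijk(3) l'(2,3) y(3), of "iv k (f s)"] zk l by auto
  then have "f s = t *\<^sub>R e k y" by simp
  then have "co k ?s (f s) = 0" using ijk(3) o(3) co(4)[OF ijk(3) y(3)] by simp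
  then show False using cof s by simp
qed

end

section \<open>The tangent cone\<close>

context pf_vertex begin

abbreviation "sec \<equiv> sector M x"
abbreviation "pnt \<equiv> pt M x"

lemma sector_iff:
  assumes i: "i \<in> I" and y: "y \<in> Y i"
  shows "w \<in> sec i \<longleftrightarrow> 0 \<le> co i y w \<and> 0 \<le> co i (oth i y) w"
proof -
  have o: "oth i y \<in> Y i" using oth[OF i y] by simp
  have S: "sec i = {c *\<^sub>R v | c v. 0 \<le> c \<and> ch i x + v \<in> ch i ` T i}"
  proof -
    have "(\<lambda>q. ch i q - ch i x) ` T i = {v. ch i x + v \<in> ch i ` T i}"
    proof (intro equalityI subsetI)
      fix v assume "v \<in> {v. ch i x + v \<in> ch i ` T i}"
      then obtain q where "q \<in> T i" "ch i x + v = ch i q" by blast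
      then show "v \<in> (\<lambda>q. ch i q - ch i x) ` T i" by (intro image_eqI[of _ _ q]) (simp_all add: eq_diff_eq add.commute)
    qed auto
    then show ?thesis unfolding sector_def cone_hull_expl by blast
  qed
  show ?thesis
  proof
    assume "w \<in> sec i"
    then obtain c v where "w = c *\<^sub>R v" "0 \<le> c" "ch i x + v \<in> ch i ` T i" unfolding S by blast
    then show "0 \<le> co i y w \<and> 0 \<le> co i (oth i y) w"
      unfolding triangle_shape[OF i y] using i y o by simp
  next
    assume h: "0 \<le> co i y w \<and> 0 \<le> co i (oth i y) w"
    define m where "m = 1 + co i y w + co i (oth i y) w"
    have m: "0 < m" using h by (simp add: m_def)
    have "ch i x + inverse m *\<^sub>R w \<in> ch i ` T i"
    proof -
      have "inverse m * (co i y w + co i (oth i y) w) \<le> inverse m * m"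
        using m by (intro mult_left_mono) (simp_all add: m_def)
      then have "inverse m * co i y w + inverse m * co i (oth i y) w \<le> 1"
        using m by (simp add: distrib_left)
      then show ?thesis unfolding triangle_shape[OF i y] using i y o h m by simp
    qed
    moreover have "w = m *\<^sub>R (inverse m *\<^sub>R w)" using m by simp
    ultimately show "w \<in> sec i" unfolding S using m by (intro CollectI exI[of _ m] exI[of _ "inverse m *\<^sub>R w"]) simp
  qed
qed

lemma Y_nonempty: "i \<in> I \<Longrightarrow> \<exists>y. y \<in> Y i"
  using Y_two[of i] by (metis insertI1)

lemma sector_iff_all: "i \<in> I \<Longrightarrow> w \<in> sec i \<longleftrightarrow> (\<forall>y\<in>Y i. 0 \<le> co i y w)"
proof -
  assume i: "i \<in> I"
  then obtain y where y: "y \<in> Y i" using Y_nonempty by blast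
  show ?thesis unfolding sector_iff[OF i y] using oth(3)[OF i y] by auto
qed

lemma sector_zero [simp]: "i \<in> I \<Longrightarrow> 0 \<in> sec i"
  by (simp add: sector_iff_all)

lemma sector_edge [simp]: "\<lbrakk>i \<in> I; y \<in> Y i; 0 \<le> s\<rbrakk> \<Longrightarrow> s *\<^sub>R e i y \<in> sec i"
  by (simp add: sector_iff oth(1))

lemma sector_convex: "i \<in> I \<Longrightarrow> convex (sec i)"
  by (rule convexI) (simp add: sector_iff_all)

lemma edge_scale_eq [simp]: "\<lbrakk>i \<in> I; y \<in> Y i\<rbrakk> \<Longrightarrow> s *\<^sub>R e i y = t *\<^sub>R e i y \<longleftrightarrow> s = t"
  using e_independent(1) by simp

lemma edge_vectors_eq:
  assumes "i \<in> I" "y \<in> Y i" "y' \<in> Y i" "s *\<^sub>R e i y = t *\<^sub>R e i y'" "s \<noteq> 0"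
  shows "y = y'" "s = t"
proof -
  show "y = y'"
  proof (rule ccontr)
    assume "y \<noteq> y'"
    then have "y = oth i y'" using oth(3)[OF assms(1,3)] assms(2) by blast
    then have "co i y (t *\<^sub>R e i y') = 0" using assms oth(1) by simp
    moreover have "co i y (s *\<^sub>R e i y) = s" using assms(1,2) by simp
    ultimately show False using assms(4,5) by simp
  qed
  then show "s = t" using assms(4) edge_scale_eq[OF assms(1,3)] by simp
qed

text \<open>Both charts use the same parameter along a common edge by
  \<open>shared_edge_coordinates\<close>. So the point \<open>q\<close> and the factor
  \<open>s\<close> of the definition combine into a single parameter on the ray of a shared
  vertex.\<close>

lemma glue_iff:
  "((i, v), (j, w)) \<in> glue M x \<longleftrightarrow> i \<in> I \<and> j \<in> I \<and>
     (i = j \<and> v = w \<and> v \<in> sec i \<or> v = 0 \<and> w = 0 \<or>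
      i \<noteq> j \<and> (\<exists>y\<in>Y i \<inter> Y j. \<exists>s>0. v = s *\<^sub>R e i y \<and> w = s *\<^sub>R e j y))" (is "?L \<longleftrightarrow> ?R")
proof
  assume ?L
  then obtain q s where ij: "i \<in> I" "j \<in> I" and q: "q \<in> T i \<inter> T j" "0 \<le> s"
    "v = s *\<^sub>R (ch i q - ch i x)" "w = s *\<^sub>R (ch j q - ch j x)" unfolding glue_def by blast
  show ?R
  proof (cases "i = j")
    case True
    have "v \<in> sec i" unfolding sector_def cone_hull_expl using q by blast
    then show ?thesis using True q ij by simp
  next
    case False
    show ?thesis
    proof (cases "v = 0 \<and> w = 0")
      case nz: False
      then have "T i \<inter> T j \<noteq> {x}" using q by auto
      then obtain y where y: "y \<in> Y i" "y \<in> Y j" using star_inter[OF ij False] by blast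
      obtain t where t: "t \<in> {0..1}" "ch i q = ch i x + t *\<^sub>R e i y" "ch j q = ch j x + t *\<^sub>R e j y"
        using shared_edge_coordinates[OF ij False y q(1)] by blast
      then have "v = (s * t) *\<^sub>R e i y" "w = (s * t) *\<^sub>R e j y" using q by auto
      moreover have "0 < s * t" using calculation nz q(2) t(1) by (metis atLeastAtMost_iff less_eq_real_def mult_eq_0_iff mult_pos_pos scaleR_zero_left)
      ultimately show ?thesis using False ij y by blast
    qed (use ij in simp)
  qed
next
  assume R: ?R
  then have ij: "i \<in> I" "j \<in> I" by auto
  consider "i = j" "v = w" "v \<in> sec i" | "v = 0" "w = 0" |
     y s where "y \<in> Y i" "y \<in> Y j" "0 < s" "v = s *\<^sub>R e i y" "w = s *\<^sub>R e j y" using R by blast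
  then show ?L
  proof cases
    case 1
    then obtain q c where "q \<in> T i" "0 \<le> c" "v = c *\<^sub>R (ch i q - ch i x)"
      unfolding sector_def cone_hull_expl by blast
    then show ?thesis using 1 ij unfolding glue_def by auto
  next
    case 2
    then show ?thesis using ij unfolding glue_def by (auto intro!: bexI[of _ x] exI[of _ 0])
  next
    case (3 y s)
    then show ?thesis using ij Y_T unfolding glue_def e_def
      by (auto intro!: bexI[of _ y] exI[of _ s])
  qed
qed

text \<open>The issue is transitivity: crossing a ray from \<open>i\<close> to \<open>j\<close> and
  then the same ray from \<open>j\<close> to \<open>k\<close> leads back to \<open>i\<close>, as no
  ray bounds three sectors.\<close>

lemma glue_equiv: "equiv (SIGMA i : I. sec i) (glue M x)"
proof (rule equivI)
  show "glue M x \<subseteq> (SIGMA i : I. sec i) \<times> (SIGMA i : I. sec i)"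
  proof (rule subsetI)
    fix z assume z: "z \<in> glue M x"
    obtain i v j w where zz: "z = ((i, v), (j, w))" by (metis surj_pair)
    show "z \<in> (SIGMA i : I. sec i) \<times> (SIGMA i : I. sec i)"
      using z unfolding zz glue_iff by auto
  qed
  show "refl_on (SIGMA i : I. sec i) (glue M x)"
    by (rule refl_onI) (auto simp: glue_iff)
  show "sym (glue M x)"
  proof (rule symI)
    fix a b assume "(a, b) \<in> glue M x"
    moreover obtain i v j w where "a = (i, v)" "b = (j, w)" by (metis surj_pair)
    ultimately show "(b, a) \<in> glue M x" by (auto simp: glue_iff)
  qed
  show "trans (glue M x)"
  proof (rule transI)
    fix a b c assume h: "(a, b) \<in> glue M x" "(b, c) \<in> glue M x"
    obtain i v j w k u where abc: "a = (i, v)" "b = (j, w)" "c = (k, u)" by (metis surj_pair)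
    note h1 = h(1)[unfolded abc glue_iff] and h2 = h(2)[unfolded abc glue_iff]
    have I: "i \<in> I" "j \<in> I" "k \<in> I" using h1 h2 by auto
    show "(a, c) \<in> glue M x" unfolding abc
    proof (cases "w = 0")
      case True
      have "v = 0" "u = 0" using h1 h2 True I e_independent(1) by auto
      then show "((i, v), (k, u)) \<in> glue M x" using I by (simp add: glue_iff)
    next
      case w: False
      show "((i, v), (k, u)) \<in> glue M x"
      proof (cases "i = j \<or> j = k")
        case True
        then show ?thesis using h w unfolding abc using h1 h2 by auto
      next
        case False
        obtain y s where y: "y \<in> Y i" "y \<in> Y j" "s > 0" "v = s *\<^sub>R e i y" "w = s *\<^sub>R e j y"
          using h1 False w by blast
        obtain y' s' where y': "y' \<in> Y j" "y' \<in> Y k" "s' > 0" "w = s' *\<^sub>R e j y'" "u = s' *\<^sub>R e k y'"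
          using h2 False w by blast
        have eq: "y = y'" "s = s'" using edge_vectors_eq[OF I(2) y(2) y'(1), of s s'] y y' by auto
        have "i = k" using neighbour_unique[of i j k y] I False y y' eq by metis
        then show ?thesis using I y y' eq by (simp add: glue_iff)
      qed
    qed
  qed
qed

lemma pt_eq_iff:
  assumes "i \<in> I" "j \<in> I" "v \<in> sec i" "w \<in> sec j"
  shows "pnt i v = pnt j w \<longleftrightarrow> i = j \<and> v = w \<or> v = 0 \<and> w = 0 \<or>
      i \<noteq> j \<and> (\<exists>y\<in>Y i \<inter> Y j. \<exists>s>0. v = s *\<^sub>R e i y \<and> w = s *\<^sub>R e j y)"
proof -
  have "pnt i v = pnt j w \<longleftrightarrow> ((i, v), (j, w)) \<in> glue M x"
    unfolding pt_def by (rule eq_equiv_class_iff[OF glue_equiv]) (use assms in auto)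
  then show ?thesis unfolding glue_iff using assms by simp
qed

lemma pt_eq_same [simp]: "\<lbrakk>i \<in> I; v \<in> sec i; w \<in> sec i\<rbrakk> \<Longrightarrow> pnt i v = pnt i w \<longleftrightarrow> v = w"
  by (auto simp: pt_eq_iff)

lemma pt_edge: "\<lbrakk>i \<in> I; j \<in> I; y \<in> Y i; y \<in> Y j; 0 \<le> s\<rbrakk> \<Longrightarrow> pnt i (s *\<^sub>R e i y) = pnt j (s *\<^sub>R e j y)"
proof (cases "s = 0 \<or> i = j")
  case False
  assume "i \<in> I" "j \<in> I" "y \<in> Y i" "y \<in> Y j" "0 \<le> s"
  moreover from this False have "0 < s" by simp
  ultimately show ?thesis using False by (simp only: pt_eq_iff sector_edge) blast
qed (auto simp: pt_eq_iff)

lemma tcone_iff: "p \<in> tcone M x \<longleftrightarrow> (\<exists>i\<in>I. \<exists>v\<in>sec i. p = pnt i v)"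
  unfolding tcone_def quotient_def pt_def by auto

lemma mem_pt_iff: "(i, v) \<in> pnt j w \<longleftrightarrow> ((j, w), (i, v)) \<in> glue M x"
  by (simp add: pt_def)

lemma mem_pt_D:
  assumes "j \<in> I" "w \<in> sec j" "(i, v) \<in> pnt j w"
  shows "i \<in> I" "v \<in> sec i" "pnt j w = pnt i v"
proof -
  have g: "((j, w), (i, v)) \<in> glue M x" using assms(3) by (simp add: mem_pt_iff)
  then have "(i, v) \<in> (SIGMA i : I. sec i)" using glue_equiv unfolding equiv_def by blast
  then show "i \<in> I" "v \<in> sec i" by auto
  show "pnt j w = pnt i v" unfolding pt_def using equiv_class_eq[OF glue_equiv g] .
qed

lemma mcone_iff: "i \<in> I \<Longrightarrow> p \<in> mcone M x i \<longleftrightarrow> (\<exists>v\<in>sec i. p = pnt i v)"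
proof
  assume i: "i \<in> I" and "p \<in> mcone M x i"
  then obtain j w v where "j \<in> I" "w \<in> sec j" "p = pnt j w" "(i, v) \<in> p"
    unfolding mcone_def tcone_iff by blast
  then show "\<exists>v\<in>sec i. p = pnt i v" using mem_pt_D[of j w i v] by metis
next
  assume i: "i \<in> I" and "\<exists>v\<in>sec i. p = pnt i v"
  then obtain v where v: "v \<in> sec i" "p = pnt i v" by blast
  then have "(i, v) \<in> p" using i by (simp add: mem_pt_iff glue_iff)
  then show "p \<in> mcone M x i" unfolding mcone_def tcone_iff using v i by blast
qed

lemma pt_mcone [simp]: "\<lbrakk>i \<in> I; v \<in> sec i\<rbrakk> \<Longrightarrow> pnt i v \<in> mcone M x i"
  using mcone_iff by blast

lemma mcone_tcone: "p \<in> mcone M x i \<Longrightarrow> p \<in> tcone M x"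
  by (simp add: mcone_def)

lemma coord_pt [simp]:
  assumes "i \<in> I" "v \<in> sec i"
  shows "coord i (pnt i v) = v"
  unfolding coord_def
proof (rule the_equality)
  show "(i, v) \<in> pnt i v" using assms by (simp add: mem_pt_iff glue_iff)
  show "w = v" if "(i, w) \<in> pnt i v" for w using mem_pt_D[OF assms that] assms by simp
qed

lemma coord_mcone:
  assumes "i \<in> I" "p \<in> mcone M x i"
  shows "coord i p \<in> sec i" "pnt i (coord i p) = p"
  using assms mcone_iff by auto

lemma apex_pt: "i \<in> I \<Longrightarrow> apex M x = pnt i 0"
proof -
  assume i: "i \<in> I"
  have "(j, w) \<in> pnt i 0 \<longleftrightarrow> j \<in> I \<and> w = 0" for j w
    unfolding mem_pt_iff glue_iff using i e_independent(1) by auto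
  then show ?thesis unfolding apex_def by auto
qed

lemma pt_apex_iff [simp]: "\<lbrakk>i \<in> I; v \<in> sec i\<rbrakk> \<Longrightarrow> pnt i v = apex M x \<longleftrightarrow> v = 0"
  by (simp add: apex_pt)

lemma mcone_inter:
  assumes "i \<in> I" "j \<in> I" "i \<noteq> j" "p \<in> mcone M x i" "p \<in> mcone M x j"
  shows "coord i p = 0 \<and> coord j p = 0 \<or>
    (\<exists>y\<in>Y i \<inter> Y j. \<exists>s>0. coord i p = s *\<^sub>R e i y \<and> coord j p = s *\<^sub>R e j y)"
  using pt_eq_iff[of i j "coord i p" "coord j p"] coord_mcone assms by simp

lemma mcone_inter_edge:
  assumes "i \<in> I" "j \<in> I" "i \<noteq> j" "p \<in> mcone M x i" "p \<in> mcone M x j" "y \<in> Y i" "y \<in> Y j"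
  shows "\<exists>s\<ge>0. coord i p = s *\<^sub>R e i y \<and> coord j p = s *\<^sub>R e j y"
  using mcone_inter[OF assms(1-5)]
proof
  assume "coord i p = 0 \<and> coord j p = 0"
  then show ?thesis by (intro exI[of _ 0]) simp
next
  assume "\<exists>y\<in>Y i \<inter> Y j. \<exists>s>0. coord i p = s *\<^sub>R e i y \<and> coord j p = s *\<^sub>R e j y"
  then obtain y' s where "y' \<in> Y i" "y' \<in> Y j" "s > 0" "coord i p = s *\<^sub>R e i y'" "coord j p = s *\<^sub>R e j y'" by blast
  moreover from this have "y' = y" using shared_edge_unique[OF assms(1-3,6,7)] by blast
  ultimately show ?thesis by (intro exI[of _ s]) simp
qed

end

section \<open>Length and distance\<close>

context pf_vertex begin

abbreviation "mc \<equiv> mcone M x"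

lemma gaugeI: "i \<in> I \<Longrightarrow> scgauge (F i)" using gauge by simp

text \<open>Where a curve runs in two cones it runs along their common edge, on which the norms agree.\<close>

lemma derivative_norm_unique:
  assumes ij: "i \<in> I" "j \<in> I" and A: "at t within A \<noteq> bot" "t \<in> A"
    and c: "\<And>s. s \<in> A \<Longrightarrow> c s \<in> mc i" "\<And>s. s \<in> A \<Longrightarrow> c s \<in> mc j"
    and v: "((\<lambda>s. coord i (c s)) has_vector_derivative v) (at t within A)"
    and w: "((\<lambda>s. coord j (c s)) has_vector_derivative w) (at t within A)"
  shows "F i v = F j w"
proof (cases "i = j")
  case True
  then show ?thesis using vector_derivative_unique_within[OF A(1) v] w by simp
next
  case False
  interpret Fi: scgauge "F i" by (rule gaugeI[OF ij(1)])
  interpret Fj: scgauge "F j" by (rule gaugeI[OF ij(2)])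
  show ?thesis
  proof (cases "\<exists>y. y \<in> Y i \<inter> Y j")
    case True
    then obtain y where y: "y \<in> Y i" "y \<in> Y j" by blast
    have ed: "coord i (c s) = co i y (coord i (c s)) *\<^sub>R e i y \<and> coord j (c s) = co i y (coord i (c s)) *\<^sub>R e j y"
      if s: "s \<in> A" for s
    proof -
      obtain r where "r \<ge> 0" "coord i (c s) = r *\<^sub>R e i y" "coord j (c s) = r *\<^sub>R e j y"
        using mcone_inter_edge[OF ij False c(1)[OF s] c(2)[OF s] y] by blast
      then show ?thesis using ij(1) y(1) by simp
    qed
    have bl: "bounded_linear (co i y)" using co(1)[OF ij(1) y(1)] linear_conv_bounded_linear by blast
    have d: "((\<lambda>s. co i y (coord i (c s)) *\<^sub>R z) has_vector_derivative co i y v *\<^sub>R z) (at t within A)" for z :: "real^2"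
      by (rule bounded_linear.has_vector_derivative[OF bounded_linear_scaleR_left])
        (rule bounded_linear.has_vector_derivative[OF bl v])
    have "((\<lambda>s. coord i (c s)) has_vector_derivative co i y v *\<^sub>R e i y) (at t within A)"
      by (rule has_vector_derivative_transform[OF A(2) _ d]) (use ed in auto)
    then have v': "v = co i y v *\<^sub>R e i y" using vector_derivative_unique_within[OF A(1) v] by blast
    have "((\<lambda>s. coord j (c s)) has_vector_derivative co i y v *\<^sub>R e j y) (at t within A)"
      by (rule has_vector_derivative_transform[OF A(2) _ d]) (use ed in auto)
    then have w': "w = co i y v *\<^sub>R e j y" using vector_derivative_unique_within[OF A(1) w] by blast
    show ?thesis using edge_norm[OF ij y, of "co i y v"] v' w' by metis
  next
    case False
    then have z: "coord i (c s) = 0 \<and> coord j (c s) = 0" if "s \<in> A" for s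
      using mcone_inter[OF ij \<open>i \<noteq> j\<close> c(1)[OF that] c(2)[OF that]] by blast
    have "((\<lambda>s. coord i (c s)) has_vector_derivative 0) (at t within A)"
      by (rule has_vector_derivative_transform[OF A(2) _ has_vector_derivative_const[of 0]]) (use z in auto)
    moreover have "((\<lambda>s. coord j (c s)) has_vector_derivative 0) (at t within A)"
      by (rule has_vector_derivative_transform[OF A(2) _ has_vector_derivative_const[of 0]]) (use z in auto)
    ultimately have "v = 0" "w = 0" using vector_derivative_unique_within[OF A(1)] v w by blast+
    then show ?thesis by simp
  qed
qed

lemma outgoing_norm_unique:
  assumes "outgoing M x D c t i v" "outgoing M x D' c t j w"
  shows "F i v = F j w"
proof -
  obtain a where a: "a > 0" "\<forall>s\<in>{t..t+a}. c s \<in> mc i" using assms(1) unfolding outgoing_def by blast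
  obtain b where b: "b > 0" "\<forall>s\<in>{t..t+b}. c s \<in> mc j" using assms(2) unfolding outgoing_def by blast
  define d where "d = min a b"
  have d: "t < t + d" using a b by (simp add: d_def)
  have at: "at t within {t..t+d} = at_right t" using at_within_Icc_at_right[OF d] .
  show ?thesis
  proof (rule derivative_norm_unique[of i j t "{t..t+d}" c])
    show "i \<in> I" "j \<in> I" using assms by (auto simp: outgoing_def)
    show "at t within {t..t+d} \<noteq> bot" unfolding at by simp
    show "((\<lambda>s. coord i (c s)) has_vector_derivative v) (at t within {t..t + d})"
      "((\<lambda>s. coord j (c s)) has_vector_derivative w) (at t within {t..t + d})"
      unfolding at using assms by (auto simp: outgoing_def)
  qed (use a b d in \<open>auto simp: d_def\<close>)
qed

lemma incoming_norm_unique: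
  assumes "incoming M x D c t i v" "incoming M x D' c t j w"
  shows "F i v = F j w"
proof -
  obtain a where a: "a > 0" "\<forall>s\<in>{t-a..t}. c s \<in> mc i" using assms(1) unfolding incoming_def by blast
  obtain b where b: "b > 0" "\<forall>s\<in>{t-b..t}. c s \<in> mc j" using assms(2) unfolding incoming_def by blast
  define d where "d = min a b"
  have d: "t - d < t" using a b by (simp add: d_def)
  have at: "at t within {t-d..t} = at_left t" using at_within_Icc_at_left[OF d] .
  show ?thesis
  proof (rule derivative_norm_unique[of i j t "{t-d..t}" c])
    show "i \<in> I" "j \<in> I" using assms by (auto simp: incoming_def)
    show "at t within {t-d..t} \<noteq> bot" unfolding at by simp
    show "((\<lambda>s. coord i (c s)) has_vector_derivative v) (at t within {t-d..t})"
      "((\<lambda>s. coord j (c s)) has_vector_derivative w) (at t within {t-d..t})"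
      unfolding at using assms by (auto simp: incoming_def)
  qed (use a b d in \<open>auto simp: d_def\<close>)
qed

lemma speed_eq:
  assumes "outgoing M x D c t i v"
  shows "speed M x D c t = F i v"
  unfolding speed_def
proof (rule the_equality)
  show "\<exists>i' v'. outgoing M x D c t i' v' \<and> F i v = F i' v'" using assms by blast
  show "r = F i v" if "\<exists>i' v'. outgoing M x D c t i' v' \<and> r = F i' v'" for r
    using that outgoing_norm_unique[OF assms] by metis
qed

definition piece :: "(real \<Rightarrow> ('i \<times> (real^2)) set) \<Rightarrow> real \<Rightarrow> real \<Rightarrow> 'i \<Rightarrow> (real \<Rightarrow> real^2) \<Rightarrow> bool" where
  "piece c s t i g' \<longleftrightarrow> s < t \<and> i \<in> I \<and> (\<forall>r\<in>{s..t}. c r \<in> mc i) \<and> continuous_on {s..t} g' \<and>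
     (\<forall>r\<in>{s..t}. ((\<lambda>r. coord i (c r)) has_vector_derivative g' r) (at r within {s..t}))"

lemma smooth_piece:
  assumes "s < t" "i \<in> I" "\<forall>r\<in>{s..t}. c r \<in> mc i" "smooth_curve_on s t (\<lambda>r. coord i (c r))"
  obtains g' where "piece c s t i g'"
proof -
  obtain G :: "nat \<Rightarrow> real \<Rightarrow> real^2" where G0: "\<forall>r\<in>{s..t}. G 0 r = coord i (c r)"
    and G: "\<And>n r. r \<in> {s..t} \<Longrightarrow> (G n has_vector_derivative G (Suc n) r) (at r within {s..t})"
    using assms(4) unfolding smooth_curve_on_def by blast
  have "((\<lambda>r. coord i (c r)) has_vector_derivative G (Suc 0) r) (at r within {s..t})" if "r \<in> {s..t}" for r
    by (rule has_vector_derivative_transform[OF that _ G[OF that]]) (use G0 in auto)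
  moreover have "continuous_on {s..t} (G (Suc 0))"
    unfolding continuous_on_eq_continuous_within using G has_vector_derivative_continuous by blast
  ultimately show ?thesis using assms that[of "G (Suc 0)"] unfolding piece_def by blast
qed

lemma piece_outgoing:
  assumes p: "piece c s t i g'" and r: "s \<le> r" "r < t" and D: "{s..t} \<subseteq> D"
  shows "outgoing M x D c r i (g' r)"
proof -
  have "((\<lambda>r. coord i (c r)) has_vector_derivative g' r) (at r within {s..t})"
    using p r unfolding piece_def by auto
  then have "((\<lambda>r. coord i (c r)) has_vector_derivative g' r) (at r within {r..t})"
    by (rule has_vector_derivative_within_subset) (use r in auto)
  then have "((\<lambda>r. coord i (c r)) has_vector_derivative g' r) (at_right r)"
    using at_within_Icc_at_right[OF r(2)] by simp
  moreover have "{r..r + (t - r)} \<subseteq> D" "\<forall>s\<in>{r..r + (t - r)}. c s \<in> mc i" "i \<in> I"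
    using p r D unfolding piece_def by auto
  ultimately show ?thesis unfolding outgoing_def using r by (intro conjI exI[of _ "t - r"]) auto
qed

lemma piece_incoming:
  assumes p: "piece c s t i g'" and r: "s < r" "r \<le> t" and D: "{s..t} \<subseteq> D"
  shows "incoming M x D c r i (g' r)"
proof -
  have "((\<lambda>r. coord i (c r)) has_vector_derivative g' r) (at r within {s..t})"
    using p r unfolding piece_def by auto
  then have "((\<lambda>r. coord i (c r)) has_vector_derivative g' r) (at r within {s..r})"
    by (rule has_vector_derivative_within_subset) (use r in auto)
  then have "((\<lambda>r. coord i (c r)) has_vector_derivative g' r) (at_left r)"
    using at_within_Icc_at_left[OF r(1)] by simp
  moreover have "{r - (r - s)..r} \<subseteq> D" "\<forall>u\<in>{r - (r - s)..r}. c u \<in> mc i" "i \<in> I"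
    using p r D unfolding piece_def by auto
  ultimately show ?thesis unfolding incoming_def using r by (intro conjI exI[of _ "r - s"]) auto
qed

lemma piece_length:
  assumes p: "piece c s t i g'" and D: "{s..t} \<subseteq> D"
  obtains J where "(speed M x D c has_integral J) {s..t}" "F i (coord i (c t) - coord i (c s)) \<le> J"
proof -
  interpret scgauge "F i" using gaugeI p by (simp add: piece_def)
  have "continuous_on {s..t} (\<lambda>r. F i (g' r))"
    using p by (intro continuous_on_compose2[OF cont]) (auto simp: piece_def)
  then obtain J where J: "((\<lambda>r. F i (g' r)) has_integral J) {s..t}"
    using integrable_continuous_real by blast
  have "(speed M x D c has_integral J) {s..t}"
  proof (rule has_integral_spike_finite[OF _ _ J])
    \<comment> \<open>At the right end the piece determines no outgoing vector; a single point does
      not change the integral.\<close>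
    show "finite {t}" by simp
    show "speed M x D c r = F i (g' r)" if "r \<in> {s..t} - {t}" for r
      using speed_eq[OF piece_outgoing[OF p _ _ D]] that by auto
  qed
  moreover have "F i (coord i (c t) - coord i (c s)) \<le> J"
    by (rule chord_le_integral[OF _ _ J, where g = "\<lambda>r. coord i (c r)"]) (use p in \<open>auto simp: piece_def\<close>)
  ultimately show ?thesis using that by blast
qed

text \<open>Induction over the subdivision for a relation \<open>R\<close> that is additive over
  adjacent intervals. It serves both for lower bounds on the length and for its exact value at
  constant speed.\<close>

lemma pieces_integral:
  assumes c: "piecewise_smooth M x {a..b} c" and ab: "a < b"
    and P: "\<And>s t i g'. a \<le> s \<Longrightarrow> t \<le> b \<Longrightarrow> piece c s t i g' \<Longrightarrow>
      \<exists>J. (speed M x {a..b} c has_integral J) {s..t} \<and> R s t J"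
    and add: "\<And>s J K t. R a s J \<Longrightarrow> R s t K \<Longrightarrow> R a t (J + K)"
  shows "\<exists>J. (speed M x {a..b} c has_integral J) {a..b} \<and> R a b J"
proof -
  obtain n \<tau> where n: "\<tau> 0 = a" "\<tau> (n::nat) = b" and
    sub: "\<And>l. l < n \<Longrightarrow> \<tau> l < \<tau> (Suc l) \<and> (\<exists>i\<in>I. (\<forall>t\<in>{\<tau> l..\<tau> (Suc l)}. c t \<in> mc i) \<and>
                 smooth_curve_on (\<tau> l) (\<tau> (Suc l)) (\<lambda>t. coord i (c t)))"
    using c ab unfolding piecewise_smooth_def by (metis order_refl)
  have mono: "\<tau> k \<le> \<tau> l" if "k \<le> l" "l \<le> n" for k l
    using that
  proof (induction l)
    case (Suc l)
    then show ?case using sub[of l] by (cases "k = Suc l") auto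
  qed simp
  have "n \<noteq> 0" using n ab by (metis less_irrefl)
  have "0 < l \<Longrightarrow> l \<le> n \<Longrightarrow> \<exists>J. (speed M x {a..b} c has_integral J) {a..\<tau> l} \<and> R a (\<tau> l) J" for l
  proof (induction l)
    case (Suc l)
    obtain i where i: "i \<in> I" "\<forall>t\<in>{\<tau> l..\<tau> (Suc l)}. c t \<in> mc i"
      "smooth_curve_on (\<tau> l) (\<tau> (Suc l)) (\<lambda>t. coord i (c t))" and lt: "\<tau> l < \<tau> (Suc l)"
      using sub[of l] Suc by auto
    obtain g' where g: "piece c (\<tau> l) (\<tau> (Suc l)) i g'" using smooth_piece[OF lt i] .
    have le: "a \<le> \<tau> l" "\<tau> (Suc l) \<le> b" using mono[of 0 l] mono[of "Suc l" n] n Suc by auto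
    obtain K where K: "(speed M x {a..b} c has_integral K) {\<tau> l..\<tau> (Suc l)}" "R (\<tau> l) (\<tau> (Suc l)) K"
      using P[OF le g] by blast
    show ?case
    proof (cases "l = 0")
      case True then show ?thesis using K n by auto
    next
      case False
      then obtain J where J: "(speed M x {a..b} c has_integral J) {a..\<tau> l}" "R a (\<tau> l) J" using Suc by auto
      have "(speed M x {a..b} c has_integral (J + K)) {a..\<tau> (Suc l)}"
        by (rule has_integral_combine[OF le(1) less_imp_le[OF lt] J(1) K(1)])
      then show ?thesis using add[OF J(2) K(2)] by blast
    qed
  qed simp
  from this[of n] show ?thesis using \<open>n \<noteq> 0\<close> n by simp
qed

text \<open>The calibration principle: on each piece \<open>f\<close> grows by at most the length of
  the chord, which is at most the length of the piece.\<close>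

lemma curve_length_lower:
  assumes c: "piecewise_smooth M x {a..b} c" and ab: "a < b"
    and f: "\<And>i v w. i \<in> I \<Longrightarrow> v \<in> sec i \<Longrightarrow> w \<in> sec i \<Longrightarrow> f (pnt i w) - f (pnt i v) \<le> F i (w - v)"
  shows "f (c b) - f (c a) \<le> curve_length M x a b c"
proof -
  have "\<exists>J. (speed M x {a..b} c has_integral J) {a..b} \<and> f (c b) - f (c a) \<le> J"
  proof (rule pieces_integral[OF c ab, of "\<lambda>s t J. f (c t) - f (c s) \<le> J"])
    fix s t i g' assume st: "a \<le> s" "t \<le> b" and p: "piece c s t i g'"
    obtain J where J: "(speed M x {a..b} c has_integral J) {s..t}" "F i (coord i (c t) - coord i (c s)) \<le> J"
      by (rule piece_length[OF p, of "{a..b}"]) (use st in auto)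
    have "i \<in> I" "c s \<in> mc i" "c t \<in> mc i" using p by (auto simp: piece_def)
    then have "f (c t) - f (c s) \<le> F i (coord i (c t) - coord i (c s))"
      using f[of i "coord i (c s)" "coord i (c t)"] coord_mcone by simp
    then show "\<exists>J. (speed M x {a..b} c has_integral J) {s..t} \<and> f (c t) - f (c s) \<le> J"
      using J by fastforce
  qed linarith
  then show ?thesis unfolding curve_length_def by (metis integral_unique)
qed

lemma curve_length_const:
  assumes c: "piecewise_smooth M x {a..b} c" and ab: "a < b"
    and k: "\<And>t i v. outgoing M x {a..b} c t i v \<Longrightarrow> F i v = \<kappa>"
  shows "curve_length M x a b c = \<kappa> * (b - a)"
proof -
  have "\<exists>J. (speed M x {a..b} c has_integral J) {a..b} \<and> J = \<kappa> * (b - a)"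
  proof (rule pieces_integral[OF c ab, of "\<lambda>s t J. J = \<kappa> * (t - s)"])
    fix s t i g' assume st: "a \<le> s" "t \<le> b" and p: "piece c s t i g'"
    have "(speed M x {a..b} c has_integral (\<kappa> * (t - s))) {s..t}"
    proof (rule has_integral_spike_finite)
      show "finite {t}" by simp
      show "speed M x {a..b} c r = \<kappa>" if r: "r \<in> {s..t} - {t}" for r
      proof -
        have "outgoing M x {a..b} c r i (g' r)" by (rule piece_outgoing[OF p]) (use r st in auto)
        then show ?thesis using speed_eq k by metis
      qed
      have "s \<le> t" using p by (simp add: piece_def)
      then show "((\<lambda>r. \<kappa>) has_integral \<kappa> * (t - s)) {s..t}"
        using has_integral_const_real[of \<kappa> s t] by (simp add: mult.commute)
    qed
    then show "\<exists>J. (speed M x {a..b} c has_integral J) {s..t} \<and> J = \<kappa> * (t - s)" by blast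
  qed (simp add: algebra_simps)
  then show ?thesis unfolding curve_length_def by (metis integral_unique)
qed

lemma piecewise_smooth_subset:
  "piecewise_smooth M x D c \<Longrightarrow> E \<subseteq> D \<Longrightarrow> piecewise_smooth M x E c"
  unfolding piecewise_smooth_def by blast

lemma curve_length_nonneg:
  assumes "piecewise_smooth M x {a..b} c" "a < b"
  shows "0 \<le> curve_length M x a b c"
proof -
  have "(0::real) \<le> F i (w - v)" if "i \<in> I" for i v w
    using scgauge.nonneg[OF gaugeI[OF that]] .
  then show ?thesis using curve_length_lower[OF assms, of "\<lambda>_. 0"] by simp
qed

lemma tdist_le:
  assumes "piecewise_smooth M x {a..b} c" "a < b"
  shows "tdist M x (c a) (c b) \<le> curve_length M x a b c"
  unfolding tdist_def
proof (rule cInf_lower)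
  show "bdd_below {curve_length M x a' b' c' |a' b' c'. a' < b' \<and> piecewise_smooth M x {a'..b'} c' \<and> c' a' = c a \<and> c' b' = c b}"
    by (rule bdd_belowI[of _ 0]) (use curve_length_nonneg in blast)
qed (use assms in blast)

lemma tdist_ge:
  assumes c: "piecewise_smooth M x {a..b} c" "a < b"
    and f: "\<And>i v w. i \<in> I \<Longrightarrow> v \<in> sec i \<Longrightarrow> w \<in> sec i \<Longrightarrow> f (pnt i w) - f (pnt i v) \<le> F i (w - v)"
  shows "f (c b) - f (c a) \<le> tdist M x (c a) (c b)"
  unfolding tdist_def
proof (rule cInf_greatest)
  \<comment> \<open>The given curve makes the set of lengths nonempty, so that \<open>Inf\<close> is
    a genuine infimum.\<close>
  show "{curve_length M x a' b' c' |a' b' c'. a' < b' \<and> piecewise_smooth M x {a'..b'} c' \<and> c' a' = c a \<and> c' b' = c b} \<noteq> {}"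
    using c by blast
  fix l assume "l \<in> {curve_length M x a' b' c' |a' b' c'. a' < b' \<and> piecewise_smooth M x {a'..b'} c' \<and> c' a' = c a \<and> c' b' = c b}"
  then obtain a' b' c' where "l = curve_length M x a' b' c'" "a' < b'" "piecewise_smooth M x {a'..b'} c'" "c' a' = c a" "c' b' = c b"
    by blast
  then show "f (c b) - f (c a) \<le> l" using curve_length_lower[of a' b' c' f] f by metis
qed

section \<open>Straight segments as curves\<close>

lemma smooth_affine: "smooth_curve_on a b (\<lambda>r. u + (r - s) *\<^sub>R v)"
  unfolding smooth_curve_on_def
proof (intro exI[of _ "\<lambda>n. if n = 0 then (\<lambda>r. u + (r - s) *\<^sub>R v) else if n = Suc 0 then (\<lambda>_. v) else (\<lambda>_. 0)"] conjI ballI allI)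
  fix n :: nat and t :: real
  have "((\<lambda>r. u + (r - s) *\<^sub>R v) has_vector_derivative v) (at t within {a..b})"
    by (auto intro!: derivative_eq_intros)
  then show "((if n = 0 then (\<lambda>r. u + (r - s) *\<^sub>R v) else if n = Suc 0 then (\<lambda>_. v) else (\<lambda>_. 0)) has_vector_derivative
      (if Suc n = 0 then (\<lambda>r. u + (r - s) *\<^sub>R v) else if Suc n = Suc 0 then (\<lambda>_. v) else (\<lambda>_. 0)) t) (at t within {a..b})"
    by auto
qed auto

lemma smooth_curve_cong:
  "(\<And>r. r \<in> {a..b} \<Longrightarrow> f r = g r) \<Longrightarrow> smooth_curve_on a b f \<longleftrightarrow> smooth_curve_on a b g"
  unfolding smooth_curve_on_def by simp

definition straight :: "(real \<Rightarrow> ('i \<times> (real^2)) set) \<Rightarrow> real \<Rightarrow> real \<Rightarrow> 'i \<Rightarrow> (real \<Rightarrow> real^2) \<Rightarrow> bool" where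
  "straight c s t i l \<longleftrightarrow> i \<in> I \<and> (\<forall>r\<in>{s..t}. l r \<in> sec i \<and> c r = pnt i (l r))"

lemma straight_coord: "straight c s t i l \<Longrightarrow> r \<in> {s..t} \<Longrightarrow> coord i (c r) = l r \<and> c r \<in> mc i"
  by (auto simp: straight_def)

lemma straight_smooth:
  assumes "straight c s t i (\<lambda>r. u + (r - a) *\<^sub>R v)"
  shows "smooth_curve_on s t (\<lambda>r. coord i (c r))"
  using smooth_curve_cong[of s t "\<lambda>r. coord i (c r)" "\<lambda>r. u + (r - a) *\<^sub>R v"] smooth_affine straight_coord[OF assms] by simp

lemma straight_piece:
  assumes "straight c s t i (\<lambda>r. u + (r - a) *\<^sub>R v)" "s < t"
  shows "piece c s t i (\<lambda>_. v)"
proof -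
  have "((\<lambda>r. coord i (c r)) has_vector_derivative v) (at r within {s..t})" if "r \<in> {s..t}" for r
  proof (rule has_vector_derivative_transform[OF that])
    show "((\<lambda>r. u + (r - a) *\<^sub>R v) has_vector_derivative v) (at r within {s..t})"
      by (auto intro!: derivative_eq_intros)
  qed (use straight_coord[OF assms(1)] in auto)
  then show ?thesis using assms straight_coord[OF assms(1)] by (auto simp: piece_def straight_def)
qed

text \<open>The competitor in all comparisons with the distance. A broken path permits variation of
  its break point on an edge; with a degenerate second segment it compares two points of one
  cone.\<close>

lemma tdist_two_segments:
  assumes ij: "i \<in> I" "j \<in> I" and u: "u \<in> sec i" "v \<in> sec i" "v' \<in> sec j" "w \<in> sec j" and eq: "pnt i v = pnt j v'"
  shows "tdist M x (pnt i u) (pnt j w) \<le> F i (v - u) + F j (w - v')"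
proof -
  define c where "c t = (if t \<le> 1 then pnt i (u + (t - 0) *\<^sub>R (v - u)) else pnt j (v' + (t - 1) *\<^sub>R (w - v')))" for t :: real
  have m: "p + t *\<^sub>R (q - p) \<in> sec k" if "k \<in> I" "p \<in> sec k" "q \<in> sec k" "0 \<le> t" "t \<le> 1" for k p q and t :: real
    using convexD_alt[OF sector_convex[OF that(1)] that(2,3,4,5)] by (simp add: algebra_simps)
  have s1: "straight c 0 1 i (\<lambda>t. u + (t - 0) *\<^sub>R (v - u))"
    using m[OF ij(1) u(1,2)] ij by (auto simp: straight_def c_def)
  have s2: "straight c 1 2 j (\<lambda>t. v' + (t - 1) *\<^sub>R (w - v'))"
    unfolding straight_def
  proof (intro conjI ballI)
    fix r :: real assume r: "r \<in> {1..2}"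
    show "v' + (r - 1) *\<^sub>R (w - v') \<in> sec j" using m[OF ij(2) u(3,4), of "r - 1"] r by simp
    show "c r = pnt j (v' + (r - 1) *\<^sub>R (w - v'))" using r eq by (cases "r = 1") (auto simp: c_def)
  qed (use ij in simp)
  have tc: "c t \<in> tcone M x" if "t \<in> {0..2}" for t
    using straight_coord[OF s1, of t] straight_coord[OF s2, of t] that mcone_tcone by (cases "t \<le> 1") auto
  have c: "piecewise_smooth M x {0..2} c"
    unfolding piecewise_smooth_def
  proof (intro conjI ballI allI impI)
    fix a b :: real assume ab: "a < b" "{a..b} \<subseteq> {0..2}"
    then have ab': "0 \<le> a" "b \<le> 2" by auto
    have sub: "straight c s t k l" if "straight c s' t' k l" "s' \<le> s" "t \<le> t'" for s t s' t' k l
      using that by (auto simp: straight_def)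
    have one: "\<exists>i\<in>I. (\<forall>t\<in>{s..t}. c t \<in> mc i) \<and> smooth_curve_on s t (\<lambda>t. coord i (c t))"
      if "0 \<le> s \<and> t \<le> 1 \<or> 1 \<le> s \<and> t \<le> 2" for s t
      using that
    proof
      assume h: "0 \<le> s \<and> t \<le> 1"
      then have "straight c s t i (\<lambda>t. u + (t - 0) *\<^sub>R (v - u))" using sub[OF s1] by blast
      then show ?thesis using straight_smooth straight_coord ij(1) by blast
    next
      assume h: "1 \<le> s \<and> t \<le> 2"
      then have "straight c s t j (\<lambda>t. v' + (t - 1) *\<^sub>R (w - v'))" using sub[OF s2] by blast
      then show ?thesis using straight_smooth straight_coord ij(2) by blast
    qed
    show "\<exists>(n::nat) \<tau>. \<tau> 0 = a \<and> \<tau> n = b \<and> (\<forall>l<n. \<tau> l < \<tau> (Suc l) \<and>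
          (\<exists>i\<in>I. (\<forall>t\<in>{\<tau> l..\<tau> (Suc l)}. c t \<in> mc i) \<and> smooth_curve_on (\<tau> l) (\<tau> (Suc l)) (\<lambda>t. coord i (c t))))"
    proof (cases "a < 1 \<and> 1 < b")
      case True
      show ?thesis
        by (intro exI[of _ "2::nat"] exI[of _ "\<lambda>l::nat. if l = 0 then a else if l = 1 then 1 else b"])
          (use True ab' one in \<open>auto simp: less_2_cases_iff\<close>)
    next
      case False
      show ?thesis
        by (intro exI[of _ "1::nat"] exI[of _ "\<lambda>l::nat. if l = 0 then a else b"])
          (use False ab ab' one[of a b] in auto)
    qed
  qed (use tc in blast)
  have int: "(speed M x {0..2} c has_integral F k z) {s..s+1}"
    if k: "straight c s (s + 1) k (\<lambda>t. p + (t - s) *\<^sub>R z)" "{s..s+1} \<subseteq> {0..2}" for s k p z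
  proof (rule has_integral_spike_finite)
    show "finite {s + 1}" by simp
    show "speed M x {0..2} c r = F k z" if r: "r \<in> {s..s+1} - {s+1}" for r
    proof -
      have "outgoing M x {0..2} c r k z" by (rule piece_outgoing[OF straight_piece[OF k(1)]]) (use r k(2) in auto)
      then show ?thesis using speed_eq by metis
    qed
    show "((\<lambda>r. F k z) has_integral F k z) {s..s+1}"
      using has_integral_const_real[of "F k z" s "s + 1"] by simp
  qed
  have "(speed M x {0..2} c has_integral (F i (v - u) + F j (w - v'))) {0..2}"
    by (rule has_integral_combine[of 0 1 2]) (use int[of 0 i u "v - u"] int[of 1 j v' "w - v'"] s1 s2 in auto)
  then have "curve_length M x 0 2 c = F i (v - u) + F j (w - v')"
    unfolding curve_length_def by (rule integral_unique)
  moreover have "c 0 = pnt i u" "c 2 = pnt j w" by (auto simp: c_def)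
  ultimately show ?thesis using tdist_le[OF c] by simp
qed

end

section \<open>Geodesics across an edge\<close>

context pf_vertex begin

abbreviation "xi i \<equiv> scgauge.dF (F i)"

text \<open>At constant speed the length in the definition of a geodesic is \<open>\<kappa>\<close>
  times the elapsed time, so minimality becomes a condition on \<open>tdist\<close> alone.\<close>

definition geo :: "real \<Rightarrow> real set \<Rightarrow> (real \<Rightarrow> ('i \<times> (real^2)) set) \<Rightarrow> bool" where
  "geo \<kappa> D c \<longleftrightarrow> is_interval D \<and> piecewise_smooth M x D c \<and> 0 < \<kappa> \<and>
     (\<forall>t\<in>D. \<forall>i v. outgoing M x D c t i v \<or> incoming M x D c t i v \<longrightarrow> F i v = \<kappa>) \<and>
     (\<forall>t0\<in>D. \<exists>\<epsilon>>0. \<forall>t1\<in>D. \<forall>t2\<in>D. t1 < t2 \<and> \<bar>t1 - t0\<bar> < \<epsilon> \<and> \<bar>t2 - t0\<bar> < \<epsilon> \<longrightarrow>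
        tdist M x (c t1) (c t2) = \<kappa> * (t2 - t1))"

lemma interval_Icc: "is_interval D \<Longrightarrow> a \<in> D \<Longrightarrow> b \<in> D \<Longrightarrow> {a..b} \<subseteq> (D :: real set)"
  by (rule subsetI) (simp add: mem_is_interval_1_I[of D a b])

lemma constant_speed_length:
  assumes D: "is_interval D" "piecewise_smooth M x D c"
    and k: "\<forall>t\<in>D. \<forall>i v. outgoing M x D c t i v \<or> incoming M x D c t i v \<longrightarrow> F i v = \<kappa>"
    and t: "t1 \<in> D" "t2 \<in> D" "t1 < t2"
  shows "curve_length M x t1 t2 c = \<kappa> * (t2 - t1)"
proof (rule curve_length_const[OF piecewise_smooth_subset[OF D(2)] t(3)])
  show sub: "{t1..t2} \<subseteq> D" using interval_Icc D t by blast
  fix t i v assume o: "outgoing M x {t1..t2} c t i v"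
  then have "outgoing M x D c t i v" unfolding outgoing_def using sub by blast
  moreover have "t \<in> D"
  proof -
    obtain e where "0 < e" "{t..t + e} \<subseteq> D" using calculation unfolding outgoing_def by blast
    then show ?thesis by auto
  qed
  ultimately show "F i v = \<kappa>" using k by blast
qed

lemma geodesic_geo: "geodesic M x D c \<longleftrightarrow> (\<exists>\<kappa>. geo \<kappa> D c)"
proof
  assume g: "geodesic M x D c"
  then obtain \<kappa> where k: "0 < \<kappa>"
    "\<forall>t\<in>D. \<forall>i v. outgoing M x D c t i v \<or> incoming M x D c t i v \<longrightarrow> F i v = \<kappa>"
    unfolding geodesic_def by blast
  have D: "is_interval D" "piecewise_smooth M x D c" using g unfolding geodesic_def by blast+
  have "geo \<kappa> D c" unfolding geo_def
  proof (intro conjI ballI)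
    fix t0 assume "t0 \<in> D"
    then obtain \<epsilon> where "\<epsilon> > 0" "\<forall>t1\<in>D. \<forall>t2\<in>D. t1 < t2 \<and> \<bar>t1 - t0\<bar> < \<epsilon> \<and> \<bar>t2 - t0\<bar> < \<epsilon> \<longrightarrow>
        curve_length M x t1 t2 c = tdist M x (c t1) (c t2)"
      using g unfolding geodesic_def by blast
    then show "\<exists>\<epsilon>>0. \<forall>t1\<in>D. \<forall>t2\<in>D. t1 < t2 \<and> \<bar>t1 - t0\<bar> < \<epsilon> \<and> \<bar>t2 - t0\<bar> < \<epsilon> \<longrightarrow>
        tdist M x (c t1) (c t2) = \<kappa> * (t2 - t1)"
      using constant_speed_length[OF D k(2)] by metis
  qed (use D k in blast)+
  then show "\<exists>\<kappa>. geo \<kappa> D c" by blast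
next
  assume "\<exists>\<kappa>. geo \<kappa> D c"
  then obtain \<kappa> where g: "geo \<kappa> D c" by blast
  then have D: "is_interval D" "piecewise_smooth M x D c"
    and k: "0 < \<kappa>" "\<forall>t\<in>D. \<forall>i v. outgoing M x D c t i v \<or> incoming M x D c t i v \<longrightarrow> F i v = \<kappa>"
    unfolding geo_def by blast+
  show "geodesic M x D c" unfolding geodesic_def
  proof (intro conjI ballI)
    show "\<exists>\<kappa>>0. \<forall>t\<in>D. \<forall>i v. outgoing M x D c t i v \<or> incoming M x D c t i v \<longrightarrow> F i v = \<kappa>"
      using k by blast
    fix t0 assume "t0 \<in> D"
    then obtain \<epsilon> where "\<epsilon> > 0" "\<forall>t1\<in>D. \<forall>t2\<in>D. t1 < t2 \<and> \<bar>t1 - t0\<bar> < \<epsilon> \<and> \<bar>t2 - t0\<bar> < \<epsilon> \<longrightarrow>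
        tdist M x (c t1) (c t2) = \<kappa> * (t2 - t1)"
      using g unfolding geo_def by blast
    then show "\<exists>\<epsilon>>0. \<forall>t1\<in>D. \<forall>t2\<in>D. t1 < t2 \<and> \<bar>t1 - t0\<bar> < \<epsilon> \<and> \<bar>t2 - t0\<bar> < \<epsilon> \<longrightarrow>
        curve_length M x t1 t2 c = tdist M x (c t1) (c t2)"
      using constant_speed_length[OF D k(2)] by metis
  qed (use D in blast)+
qed

lemma piece_restrict:
  assumes "piece c s t i g'" "s \<le> s'" "s' < t'" "t' \<le> t"
  shows "piece c s' t' i g'"
  using assms has_vector_derivative_within_subset[of "\<lambda>r. coord i (c r)" _ _ "{s..t}" "{s'..t'}"]
    continuous_on_subset[of "{s..t}" g' "{s'..t'}"]
  unfolding piece_def by auto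

text \<open>A chord is at most as long as the piece by \<open>chord_le_integral\<close>, and at
  least as long since it is a competitor. So every intermediate point gives equality in the triangle
  inequality; strict convexity puts it on the chord, and the constant speed fixes its
  parameter.\<close>

lemma minimizing_piece_straight:
  assumes g: "geo \<kappa> D c" and p: "piece c s t i g'" and D: "{s..t} \<subseteq> D"
    and min: "\<And>t1 t2. s \<le> t1 \<Longrightarrow> t1 < t2 \<Longrightarrow> t2 \<le> t \<Longrightarrow> tdist M x (c t1) (c t2) = \<kappa> * (t2 - t1)"
  shows "\<exists>v. F i v = \<kappa> \<and> (\<forall>r\<in>{s..t}. coord i (c r) = coord i (c s) + (r - s) *\<^sub>R v)"
proof -
  have i: "i \<in> I" and st: "s < t" and mc: "\<And>r. r \<in> {s..t} \<Longrightarrow> c r \<in> mc i" using p by (auto simp: piece_def)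
  have k: "0 < \<kappa>" using g by (simp add: geo_def)
  interpret scgauge "F i" by (rule gaugeI[OF i])
  define q where "q r = coord i (c r)" for r
  have Fg: "F i (g' r) = \<kappa>" if r: "r \<in> {s..t}" for r
  proof -
    have "outgoing M x D c r i (g' r) \<or> incoming M x D c r i (g' r)"
      using piece_outgoing[OF p _ _ D] piece_incoming[OF p _ _ D] r st by (cases "r < t") auto
    then show ?thesis using g r D unfolding geo_def by blast
  qed
  have eq: "F i (q t2 - q t1) = \<kappa> * (t2 - t1)" if t: "s \<le> t1" "t1 < t2" "t2 \<le> t" for t1 t2
  proof (rule antisym)
    have p': "piece c t1 t2 i g'" using piece_restrict[OF p t] .
    show "F i (q t2 - q t1) \<le> \<kappa> * (t2 - t1)"
    proof (rule chord_le_integral[of t1 t2 q g' "\<lambda>_. \<kappa>"])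
      show "((\<lambda>_. \<kappa>) has_integral \<kappa> * (t2 - t1)) {t1..t2}"
        using has_integral_const_real[of \<kappa> t1 t2] t by (simp add: mult.commute)
    qed (use p' t Fg in \<open>auto simp: piece_def q_def[abs_def]\<close>)
    have c12: "c t1 = pnt i (q t1)" "c t2 = pnt i (q t2)" "q t1 \<in> sec i" "q t2 \<in> sec i"
      using coord_mcone[OF i mc] t by (auto simp: q_def)
    have "tdist M x (c t1) (c t2) \<le> F i (q t2 - q t1) + F i (q t2 - q t2)"
      unfolding c12 by (rule tdist_two_segments[OF i i c12(3,4,4,4)]) simp
    then show "\<kappa> * (t2 - t1) \<le> F i (q t2 - q t1)" using min[OF t] by simp
  qed
  define v where "v = (q t - q s) /\<^sub>R (t - s)"
  have v: "q t - q s = (t - s) *\<^sub>R v" using st by (simp add: v_def)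
  have Fv: "F i v = \<kappa>"
    unfolding v_def using homog[of "inverse (t - s)" "q t - q s"] eq[of s t] st by simp
  have "q r = q s + (r - s) *\<^sub>R v" if r: "r \<in> {s..t}" for r
  proof (cases "r = s \<or> r = t")
    case True
    then show ?thesis using v by (auto simp: algebra_simps)
  next
    case False
    then have r': "s < r" "r < t" using r by auto
    have E: "F i (q r - q s) = \<kappa> * (r - s)" "F i (q t - q r) = \<kappa> * (t - r)" "F i (q t - q s) = \<kappa> * (t - s)"
      using eq[of s r] eq[of r t] eq[of s t] r' by auto
    have nz: "q r - q s \<noteq> 0"
    proof
      assume "q r - q s = 0"
      then show False using E(1) k r' by simp
    qed
    have "F i ((q r - q s) + (q t - q r)) = F i (q r - q s) + F i (q t - q r)"
      using E by (simp add: algebra_simps)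
    then obtain l where l: "l \<ge> 0" "q t - q r = l *\<^sub>R (q r - q s)" using strict nz by blast
    have "\<kappa> * (t - r) = F i (l *\<^sub>R (q r - q s))" using E(2) l(2) by simp
    also have "\<dots> = \<kappa> * (l * (r - s))" unfolding homog[OF l(1)] E(1) by (rule mult.left_commute)
    finally have l': "t - r = l * (r - s)" using k by simp
    have "(1 + l) *\<^sub>R (q r - q s) = (q r - q s) + (q t - q r)" unfolding l(2) by (simp add: scaleR_add_left)
    also have "\<dots> = (t - s) *\<^sub>R v" using v by simp
    also have "t - s = (1 + l) * (r - s)" using l' by (simp add: algebra_simps)
    finally have "(1 + l) *\<^sub>R (q r - q s) = (1 + l) *\<^sub>R ((r - s) *\<^sub>R v)" by (simp only: scaleR_scaleR)
    then have "q r - q s = (r - s) *\<^sub>R v" by (rule scaleR_left_imp_eq[rotated]) (use l(1) in simp)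
    then show ?thesis by (simp add: algebra_simps)
  qed
  then show ?thesis using Fv unfolding q_def by blast
qed

text \<open>Cut the first smooth piece after \<open>t\<close> down to the range where
  \<open>c\<close> minimizes and apply \<open>minimizing_piece_straight\<close>. Halving
  \<open>\<epsilon>\<close> keeps the times strictly inside that range.\<close>

lemma right_germ:
  assumes g: "geo \<kappa> D c" and t: "t \<in> D" "b \<in> D" "t < b"
  obtains i u v a where "0 < a" "{t..t + a} \<subseteq> D" "straight c t (t + a) i (\<lambda>r. u + (r - t) *\<^sub>R v)" "F i v = \<kappa>"
proof -
  have D: "{t..b} \<subseteq> D" using interval_Icc g t unfolding geo_def by blast
  have "piecewise_smooth M x D c" using g unfolding geo_def by blast
  then obtain n \<tau> where n: "\<tau> 0 = t" "\<tau> (n::nat) = b" and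
    sub: "\<And>l. l < n \<Longrightarrow> \<tau> l < \<tau> (Suc l) \<and> (\<exists>i\<in>I. (\<forall>t\<in>{\<tau> l..\<tau> (Suc l)}. c t \<in> mc i) \<and>
                 smooth_curve_on (\<tau> l) (\<tau> (Suc l)) (\<lambda>t. coord i (c t)))"
    using D t(3) unfolding piecewise_smooth_def by blast
  have "0 < n" using n t(3) by (metis gr0I less_irrefl)
  then obtain i where i: "i \<in> I" "\<forall>r\<in>{t..\<tau> 1}. c r \<in> mc i" "smooth_curve_on t (\<tau> 1) (\<lambda>t. coord i (c t))"
    and lt: "t < \<tau> 1" using sub[of 0] n by auto
  obtain g' where p: "piece c t (\<tau> 1) i g'" using smooth_piece[OF lt i] .
  obtain \<epsilon> where e: "\<epsilon> > 0" "\<forall>t1\<in>D. \<forall>t2\<in>D. t1 < t2 \<and> \<bar>t1 - t\<bar> < \<epsilon> \<and> \<bar>t2 - t\<bar> < \<epsilon> \<longrightarrow>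
        tdist M x (c t1) (c t2) = \<kappa> * (t2 - t1)"
    using g t(1) unfolding geo_def by blast
  define a where "a = min (min (\<tau> 1 - t) (b - t)) (\<epsilon> / 2)"
  have a: "0 < a" "t + a \<le> \<tau> 1" "t + a \<le> b" "a < \<epsilon>" using lt t e by (auto simp: a_def)
  have D': "{t..t + a} \<subseteq> D" using D a by auto
  have "\<exists>v. F i v = \<kappa> \<and> (\<forall>r\<in>{t..t + a}. coord i (c r) = coord i (c t) + (r - t) *\<^sub>R v)"
  proof (rule minimizing_piece_straight[OF g _ D'])
    show "piece c t (t + a) i g'" using piece_restrict[OF p] a by auto
    show "tdist M x (c t1) (c t2) = \<kappa> * (t2 - t1)" if t12: "t \<le> t1" "t1 < t2" "t2 \<le> t + a" for t1 t2
    proof -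
      have "t1 \<in> D" "t2 \<in> D" using subsetD[OF D', of t1] subsetD[OF D', of t2] t12 by simp_all
      then show ?thesis using e(2)[rule_format, of t1 t2] t12 a(4) by simp
    qed
  qed
  then obtain v where v: "F i v = \<kappa>" "\<And>r. r \<in> {t..t + a} \<Longrightarrow> coord i (c r) = coord i (c t) + (r - t) *\<^sub>R v"
    by blast
  have "straight c t (t + a) i (\<lambda>r. coord i (c t) + (r - t) *\<^sub>R v)"
    unfolding straight_def
  proof (intro conjI ballI)
    fix r assume r: "r \<in> {t..t + a}"
    then have "c r \<in> mc i" using i(2) a by auto
    then show "coord i (c t) + (r - t) *\<^sub>R v \<in> sec i" "c r = pnt i (coord i (c t) + (r - t) *\<^sub>R v)"
      using coord_mcone[OF i(1)] v(2)[OF r] by metis+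
  qed (use i in simp)
  then show ?thesis using that a(1) D' v(1) by blast
qed

lemma left_germ:
  assumes g: "geo \<kappa> D c" and t: "b \<in> D" "t \<in> D" "b < t"
  obtains i u v a where "0 < a" "{t - a..t} \<subseteq> D" "straight c (t - a) t i (\<lambda>r. u + (r - t) *\<^sub>R v)" "F i v = \<kappa>"
proof -
  have D: "{b..t} \<subseteq> D" using interval_Icc g t unfolding geo_def by blast
  have "piecewise_smooth M x D c" using g unfolding geo_def by blast
  then obtain n \<tau> where n: "\<tau> 0 = b" "\<tau> (n::nat) = t" and
    sub: "\<And>l. l < n \<Longrightarrow> \<tau> l < \<tau> (Suc l) \<and> (\<exists>i\<in>I. (\<forall>t\<in>{\<tau> l..\<tau> (Suc l)}. c t \<in> mc i) \<and>
                 smooth_curve_on (\<tau> l) (\<tau> (Suc l)) (\<lambda>t. coord i (c t)))"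
    using D t(3) unfolding piecewise_smooth_def by blast
  have "0 < n" using n t(3) by (metis gr0I less_irrefl)
  then obtain m where m: "n = Suc m" using gr0_implies_Suc by blast
  obtain i where i: "i \<in> I" "\<forall>r\<in>{\<tau> m..t}. c r \<in> mc i" "smooth_curve_on (\<tau> m) t (\<lambda>t. coord i (c t))"
    and lt: "\<tau> m < t" using sub[of m] n m by auto
  obtain g' where p: "piece c (\<tau> m) t i g'" using smooth_piece[OF lt i] .
  obtain \<epsilon> where e: "\<epsilon> > 0" "\<forall>t1\<in>D. \<forall>t2\<in>D. t1 < t2 \<and> \<bar>t1 - t\<bar> < \<epsilon> \<and> \<bar>t2 - t\<bar> < \<epsilon> \<longrightarrow>
        tdist M x (c t1) (c t2) = \<kappa> * (t2 - t1)"
    using g t(2) unfolding geo_def by blast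
  define a where "a = min (min (t - \<tau> m) (t - b)) (\<epsilon> / 2)"
  have a: "0 < a" "\<tau> m \<le> t - a" "b \<le> t - a" "a < \<epsilon>" using lt t e by (auto simp: a_def)
  have D': "{t - a..t} \<subseteq> D" using D a by auto
  have "\<exists>v. F i v = \<kappa> \<and> (\<forall>r\<in>{t - a..t}. coord i (c r) = coord i (c (t - a)) + (r - (t - a)) *\<^sub>R v)"
  proof (rule minimizing_piece_straight[OF g _ D'])
    show "piece c (t - a) t i g'" using piece_restrict[OF p] a by auto
    show "tdist M x (c t1) (c t2) = \<kappa> * (t2 - t1)" if t12: "t - a \<le> t1" "t1 < t2" "t2 \<le> t" for t1 t2
    proof -
      have "t1 \<in> D" "t2 \<in> D" using subsetD[OF D', of t1] subsetD[OF D', of t2] t12 by simp_all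
      then show ?thesis using e(2)[rule_format, of t1 t2] t12 a(4) by simp
    qed
  qed
  then obtain v where v: "F i v = \<kappa>" "\<And>r. r \<in> {t - a..t} \<Longrightarrow> coord i (c r) = coord i (c (t - a)) + (r - (t - a)) *\<^sub>R v"
    by blast
  \<comment> \<open>The line is re-based at its right end \<open>t\<close>, the time at which germs
    from both sides are compared.\<close>
  define u where "u = coord i (c (t - a)) + a *\<^sub>R v"
  have u: "coord i (c (t - a)) + (r - (t - a)) *\<^sub>R v = u + (r - t) *\<^sub>R v" for r
    by (simp add: u_def algebra_simps)
  have "straight c (t - a) t i (\<lambda>r. u + (r - t) *\<^sub>R v)"
    unfolding straight_def
  proof (intro conjI ballI)
    fix r assume r: "r \<in> {t - a..t}"
    then have "c r \<in> mc i" using i(2) a by auto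
    then show "u + (r - t) *\<^sub>R v \<in> sec i" "c r = pnt i (u + (r - t) *\<^sub>R v)"
      using coord_mcone[OF i(1)] v(2)[OF r] u by metis+
  qed (use i in simp)
  then show ?thesis using that a(1) D' v(1) by blast
qed

text \<open>Snell's law: the two supporting covectors agree on the common edge. The sign conditions say that
  the line leaves one cone and enters the other.\<close>

definition cross :: "'i \<Rightarrow> real^2 \<Rightarrow> real^2 \<Rightarrow> 'i \<Rightarrow> real^2 \<Rightarrow> real^2 \<Rightarrow> bool" where
  "cross i u v j u' v' \<longleftrightarrow> i \<in> I \<and> j \<in> I \<and> i \<noteq> j \<and> F i v = F j v' \<and>
     (\<exists>y\<in>Y i \<inter> Y j. \<exists>s>0. u = s *\<^sub>R e i y \<and> u' = s *\<^sub>R e j y \<and> xi i v (e i y) = xi j v' (e j y) \<and>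
        co i (oth i y) v < 0 \<and> 0 < co j (oth j y) v')"

lemma crossI:
  assumes "i \<in> I" "j \<in> I" "i \<noteq> j" "F i v = F j v'" "y \<in> Y i" "y \<in> Y j" "0 < s" "u = s *\<^sub>R e i y" "u' = s *\<^sub>R e j y"
    "xi i v (e i y) = xi j v' (e j y)" "co i (oth i y) v < 0" "0 < co j (oth j y) v'"
  shows "cross i u v j u' v'"
  unfolding cross_def using assms by blast

lemma straight_at: "straight c s t i l \<Longrightarrow> r \<in> {s..t} \<Longrightarrow> l r \<in> sec i \<and> c r = pnt i (l r)"
  by (simp add: straight_def)

text \<open>The chord from time \<open>t - h\<close> to \<open>t + h\<close> is no shorter than the
  curve, which yields \<open>F i v + F i v' \<le> F i (v + v')\<close>: equality in the triangle
  inequality, for vectors of equal norm.\<close>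

lemma corner_straight:
  assumes g: "geo \<kappa> D c" and a: "0 < a" "{t - a..t + a} \<subseteq> D"
    and l: "straight c (t - a) t i (\<lambda>r. u + (r - t) *\<^sub>R v)" "F i v = \<kappa>"
    and r: "straight c t (t + a) i (\<lambda>r. u' + (r - t) *\<^sub>R v')" "F i v' = \<kappa>"
  shows "u' = u" "v' = v"
proof -
  have i: "i \<in> I" using l by (simp add: straight_def)
  have k: "0 < \<kappa>" using g by (simp add: geo_def)
  interpret scgauge "F i" by (rule gaugeI[OF i])
  have "coord i (c t) = u" "coord i (c t) = u'" using straight_coord[OF l(1), of t] straight_coord[OF r(1), of t] a by auto
  then show uu: "u' = u" by simp
  have "t \<in> D" using a by auto
  then obtain \<epsilon> where e: "\<epsilon> > 0" "\<forall>t1\<in>D. \<forall>t2\<in>D. t1 < t2 \<and> \<bar>t1 - t\<bar> < \<epsilon> \<and> \<bar>t2 - t\<bar> < \<epsilon> \<longrightarrow>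
        tdist M x (c t1) (c t2) = \<kappa> * (t2 - t1)"
    using g unfolding geo_def by blast
  define h where "h = min a (\<epsilon> / 2)"
  have h: "0 < h" "h \<le> a" "h < \<epsilon>" using a e by (auto simp: h_def)
  have dist: "tdist M x (c (t - h)) (c (t + h)) = \<kappa> * (2 * h)"
  proof -
    have "t - h \<in> D" "t + h \<in> D" using subsetD[OF a(2), of "t - h"] subsetD[OF a(2), of "t + h"] h by simp_all
    then show ?thesis using e(2)[rule_format, of "t - h" "t + h"] h by simp
  qed
  have p: "c (t - h) = pnt i (u - h *\<^sub>R v)" "u - h *\<^sub>R v \<in> sec i"
    using l(1) h unfolding straight_def by (auto dest!: bspec[of _ _ "t - h"])
  have q: "c (t + h) = pnt i (u + h *\<^sub>R v')" "u + h *\<^sub>R v' \<in> sec i"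
    using r(1) h uu unfolding straight_def by (auto dest!: bspec[of _ _ "t + h"])
  have "tdist M x (c (t - h)) (c (t + h)) \<le> F i ((u + h *\<^sub>R v') - (u - h *\<^sub>R v)) + F i ((u + h *\<^sub>R v') - (u + h *\<^sub>R v'))"
    unfolding p q by (rule tdist_two_segments[OF i i p(2) q(2,2,2)]) simp
  also have "(u + h *\<^sub>R v') - (u - h *\<^sub>R v) = h *\<^sub>R (v + v')" by (simp add: algebra_simps)
  finally have "\<kappa> * (2 * h) \<le> h * F i (v + v')" using dist homog[of h "v + v'"] h by simp
  then have "2 * \<kappa> \<le> F i (v + v')" using h by (simp add: mult.commute[of \<kappa>] mult.assoc)
  then have eq: "F i (v + v') = F i v + F i v'" using triangle[of v v'] l(2) r(2) by simp
  have "v \<noteq> 0" using l(2) k by auto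
  then obtain m where m: "m \<ge> 0" "v' = m *\<^sub>R v" using strict[OF eq] by blast
  then have "\<kappa> = m * \<kappa>" using homog[OF m(1), of v] l(2) r(2) by simp
  then have "m = 1" using k by simp
  then show "v' = v" using m by simp
qed

text \<open>First variation: moving the crossing point along the edge cannot shorten the path, so
  the derivative of its length vanishes at the actual crossing point.\<close>

lemma corner_snell:
  assumes g: "geo \<kappa> D c" and a: "0 < a" "{t - a..t + a} \<subseteq> D"
    and l: "straight c (t - a) t i (\<lambda>r. u + (r - t) *\<^sub>R v)" "F i v = \<kappa>"
    and r: "straight c t (t + a) j (\<lambda>r. u' + (r - t) *\<^sub>R v')" "F j v' = \<kappa>"
    and y: "y \<in> Y i" "y \<in> Y j" and s: "0 < s" "u = s *\<^sub>R e i y" "u' = s *\<^sub>R e j y"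
  shows "xi i v (e i y) = xi j v' (e j y)"
proof -
  have ij: "i \<in> I" "j \<in> I" using l r by (auto simp: straight_def)
  have k: "0 < \<kappa>" using g by (simp add: geo_def)
  interpret Fi: scgauge "F i" by (rule gaugeI[OF ij(1)])
  interpret Fj: scgauge "F j" by (rule gaugeI[OF ij(2)])
  have v0: "v \<noteq> 0" "v' \<noteq> 0" using l(2) r(2) k by auto
  have "t \<in> D" using a by auto
  then obtain \<epsilon> where e: "\<epsilon> > 0" "\<forall>t1\<in>D. \<forall>t2\<in>D. t1 < t2 \<and> \<bar>t1 - t\<bar> < \<epsilon> \<and> \<bar>t2 - t\<bar> < \<epsilon> \<longrightarrow>
        tdist M x (c t1) (c t2) = \<kappa> * (t2 - t1)"
    using g unfolding geo_def by blast
  define h where "h = min a (\<epsilon> / 2)"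
  have h: "0 < h" "h \<le> a" "h < \<epsilon>" using a e by (auto simp: h_def)
  have dist: "tdist M x (c (t - h)) (c (t + h)) = \<kappa> * (2 * h)"
  proof -
    have "t - h \<in> D" "t + h \<in> D" using subsetD[OF a(2), of "t - h"] subsetD[OF a(2), of "t + h"] h by simp_all
    then show ?thesis using e(2)[rule_format, of "t - h" "t + h"] h by simp
  qed
  have p: "c (t - h) = pnt i (u - h *\<^sub>R v)" "u - h *\<^sub>R v \<in> sec i"
    using l(1) h unfolding straight_def by (auto dest!: bspec[of _ _ "t - h"])
  have q: "c (t + h) = pnt j (u' + h *\<^sub>R v')" "u' + h *\<^sub>R v' \<in> sec j"
    using r(1) h unfolding straight_def by (auto dest!: bspec[of _ _ "t + h"])
  \<comment> \<open>\<open>h * f z\<close> is the length of the path that meets the edge at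
    parameter \<open>s + h * z\<close> instead of \<open>s\<close>; the bound on \<open>z\<close> in
    \<open>min\<close> keeps this point on the ray.\<close>
  define f where "f z = F i (v + z *\<^sub>R e i y) + F j (v' + z *\<^sub>R (- e j y))" for z :: real
  have min: "2 * \<kappa> \<le> f z" if z: "\<bar>z\<bar> < s / h" for z
  proof -
    have "- (s / h) < z" using z by linarith
    then have z': "0 \<le> s + h * z" using h by (simp add: field_simps)
    have "tdist M x (c (t - h)) (c (t + h)) \<le>
        F i ((s + h * z) *\<^sub>R e i y - (u - h *\<^sub>R v)) + F j ((u' + h *\<^sub>R v') - (s + h * z) *\<^sub>R e j y)"
      unfolding p(1) q(1)
      by (rule tdist_two_segments[OF ij p(2) sector_edge[OF ij(1) y(1) z'] sector_edge[OF ij(2) y(2) z'] q(2)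
            pt_edge[OF ij y z']])
    also have "(s + h * z) *\<^sub>R e i y - (u - h *\<^sub>R v) = h *\<^sub>R (v + z *\<^sub>R e i y)"
      by (simp add: s algebra_simps)
    also have "(u' + h *\<^sub>R v') - (s + h * z) *\<^sub>R e j y = h *\<^sub>R (v' + z *\<^sub>R (- e j y))"
      by (simp add: s algebra_simps)
    also have "F i (h *\<^sub>R (v + z *\<^sub>R e i y)) + F j (h *\<^sub>R (v' + z *\<^sub>R (- e j y))) = h * f z"
      unfolding Fi.homog[OF less_imp_le[OF h(1)]] Fj.homog[OF less_imp_le[OF h(1)]] f_def by (simp only: distrib_left)
    finally have "h * (2 * \<kappa>) \<le> h * f z" using dist by (simp add: mult.commute mult.left_commute)
    then show ?thesis using h by simp
  qed
  have f0: "f 0 = 2 * \<kappa>" by (simp add: f_def l(2) r(2))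
  have "(f has_real_derivative xi i v (e i y) + xi j v' (- e j y)) (at 0)"
    unfolding f_def[abs_def]
    using Fi.dF_DERIV[of v 0 "e i y"] Fj.dF_DERIV[of v' 0 "- e j y"] v0
    by (intro DERIV_add) simp_all
  then have "xi i v (e i y) + xi j v' (- e j y) = 0"
    by (rule DERIV_local_min[of _ _ _ "s / h"]) (use min f0 s h in auto)
  then show ?thesis using linear_neg[OF Fj.dF_linear[OF v0(2)], of "e j y"] by simp
qed

text \<open>Within one cone the corner is straight, and a segment that is not radial cannot touch a
  boundary ray from inside. Across an edge Snell's law excludes tangent velocities on either side,
  and the signs required by \<open>cross\<close> follow because each segment stays in its
  sector.\<close>

lemma transversal_corner:
  assumes g: "geo \<kappa> D c" and a: "0 < a" "{t - a..t + a} \<subseteq> D"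
    and l: "straight c (t - a) t i (\<lambda>r. u + (r - t) *\<^sub>R v)" "F i v = \<kappa>"
    and r: "straight c t (t + a) j (\<lambda>r. u' + (r - t) *\<^sub>R v')" "F j v' = \<kappa>"
    and u: "u \<noteq> 0" and tr: "v \<notin> span {u} \<or> v' \<notin> span {u'}"
  shows "i = j \<and> u' = u \<and> v' = v \<and> (\<forall>y\<in>Y i. 0 < co i y u) \<or> cross i u v j u' v'"
proof -
  have ij: "i \<in> I" "j \<in> I" using l r by (auto simp: straight_def)
  have k: "0 < \<kappa>" using g by (simp add: geo_def)
  interpret Fi: scgauge "F i" by (rule gaugeI[OF ij(1)])
  interpret Fj: scgauge "F j" by (rule gaugeI[OF ij(2)])
  have v0: "v \<noteq> 0" "v' \<noteq> 0" using l(2) r(2) k by auto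
  have lS: "u - a *\<^sub>R v \<in> sec i" and uS: "u \<in> sec i" and rS: "u' + a *\<^sub>R v' \<in> sec j" and u'S: "u' \<in> sec j"
    and eq: "pnt i u = pnt j u'"
    using straight_at[OF l(1), of "t - a"] straight_at[OF l(1), of t] straight_at[OF r(1), of t]
      straight_at[OF r(1), of "t + a"] a(1) by simp_all
  show ?thesis
  proof (cases "i = j")
    case True
    note c = corner_straight[OF g a l r[folded True]]
    have "0 < co i y u" if y: "y \<in> Y i" for y
    proof (rule ccontr)
      assume n: "\<not> ?thesis"
      then have z: "co i y u = 0" using uS y sector_iff_all[OF ij(1)] by force
      let ?o = "oth i y"
      have "0 \<le> co i y (u - a *\<^sub>R v)" "0 \<le> co i y (u' + a *\<^sub>R v')"
        using lS rS True y sector_iff_all[OF ij(1)] by auto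
      then have "0 \<le> - (a * co i y v)" "0 \<le> a * co i y v" using z c ij(1) y by simp_all
      then have "a * co i y v = 0" by linarith
      then have vz: "co i y v = 0" using a by simp
      have "u = co i ?o u *\<^sub>R e i ?o" "v = co i ?o v *\<^sub>R e i ?o"
        using co(6)[OF ij(1) y, of u] co(6)[OF ij(1) y, of v] z vz by simp_all
      moreover from this u have "co i ?o u \<noteq> 0" by auto
      ultimately have "v = (co i ?o v / co i ?o u) *\<^sub>R u"
        by (metis nonzero_eq_divide_eq scaleR_scaleR)
      then have "v \<in> span {u}" by (metis span_base span_scale singletonI)
      then show False using tr c by simp
    qed
    then show ?thesis using True c by blast
  next
    case False
    then obtain y s where y: "y \<in> Y i" "y \<in> Y j" and s: "0 < s" "u = s *\<^sub>R e i y" "u' = s *\<^sub>R e j y"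
      using pt_eq_iff[OF ij uS u'S] eq u by auto
    have sn: "xi i v (e i y) = xi j v' (e j y)" by (rule corner_snell[OF g a l r y s])
    have nv: "co i (oth i y) v \<noteq> 0 \<and> co j (oth j y) v' \<noteq> 0"
    proof -
      have par: "z \<in> span {s *\<^sub>R e k y}" "z = co k y z *\<^sub>R e k y" if k: "k \<in> I" "y \<in> Y k" "co k (oth k y) z = 0" for k z
      proof -
        show e: "z = co k y z *\<^sub>R e k y" using co(6)[OF k(1,2), of z] k(3) by simp
        then have "z = (co k y z / s) *\<^sub>R (s *\<^sub>R e k y)" using s by simp
        then show "z \<in> span {s *\<^sub>R e k y}" by (metis span_base span_scale singletonI)
      qed
      \<comment> \<open>A velocity along the edge has covector value \<open>F e\<close> or
        \<open>- F (- e)\<close> on the edge vector, according to its direction. Snell's law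
        transports this extreme value, and \<open>dF_eqD\<close> makes the other velocity tangent as
        well.\<close>
      have lem: "False" if k: "k \<in> I" "y \<in> Y k" "k' \<in> I" "y \<in> Y k'" "co k (oth k y) z = 0" "z \<noteq> 0" "z' \<noteq> 0"
          "z' \<notin> span {s *\<^sub>R e k' y}" "xi k z (e k y) = xi k' z' (e k' y)" for k z k' z'
      proof -
        interpret Fk: scgauge "F k" by (rule gaugeI[OF k(1)])
        interpret Fk': scgauge "F k'" by (rule gaugeI[OF k(3)])
        define m where "m = co k y z"
        have m: "z = m *\<^sub>R e k y" "m \<noteq> 0" using par(2)[OF k(1,2,5)] k(6) by (auto simp: m_def)
        have e0: "e k y \<noteq> 0" "e k' y \<noteq> 0" using e_independent(1) k by auto
        have notpar: "\<not> (\<exists>l\<ge>0. r *\<^sub>R e k' y = l *\<^sub>R z')" if "r \<noteq> 0" for r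
        proof
          assume "\<exists>l\<ge>0. r *\<^sub>R e k' y = l *\<^sub>R z'"
          then obtain l where l: "r *\<^sub>R e k' y = l *\<^sub>R z'" by blast
          then have "l \<noteq> 0" using e0 \<open>r \<noteq> 0\<close> by auto
          then have "z' = inverse l *\<^sub>R (l *\<^sub>R z')" by simp
          also have "\<dots> = (inverse l * r / s) *\<^sub>R (s *\<^sub>R e k' y)" unfolding l[symmetric] using s by simp
          finally show False using k(8) by (metis span_base span_scale singletonI)
        qed
        have lin: "linear (xi k z)" "linear (xi k' z')" using Fk.dF_linear Fk'.dF_linear k by auto
        show False
        proof (cases "0 < m")
          case True
          have "xi k z (e k y) = F k (e k y)"
            using Fk.dF_scale[OF e0(1) True] Fk.dF_self[OF e0(1)] m by simp
          also have "\<dots> = F k' (e k' y)" using edge_norm[OF k(1,3,2,4), of 1] by simp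
          finally show False using Fk'.dF_eqD[OF k(7), of "e k' y"] notpar[of 1] k(9) by simp
        next
          case False
          then have m': "0 < - m" "z = (- m) *\<^sub>R (- e k y)" using m by auto
          have "xi k z (- e k y) = F k (- e k y)"
            using Fk.dF_scale[OF _ m'(1), of "- e k y"] Fk.dF_self[of "- e k y"] m'(2) e0 by simp
          also have "\<dots> = F k' (- e k' y)" using edge_norm[OF k(1,3,2,4), of "- 1"] by simp
          finally have "F k' (- e k' y) \<le> xi k' z' (- e k' y)"
            using k(9) lin by (simp add: linear_neg)
          then show False using Fk'.dF_eqD[OF k(7), of "- e k' y"] notpar[of "- 1"] by simp
        qed
      qed
      have one: "co i (oth i y) v \<noteq> 0 \<longleftrightarrow> v \<notin> span {u}" "co j (oth j y) v' \<noteq> 0 \<longleftrightarrow> v' \<notin> span {u'}"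
      proof -
        have "co k (oth k y) z = 0" if "k \<in> I" "y \<in> Y k" "z \<in> span {s *\<^sub>R e k y}" for k z
        proof -
          obtain r where "z = r *\<^sub>R s *\<^sub>R e k y" using \<open>z \<in> span {s *\<^sub>R e k y}\<close> by (auto simp: span_singleton)
          then show ?thesis using that(1,2) oth(1) co(4) by simp
        qed
        then show "co i (oth i y) v \<noteq> 0 \<longleftrightarrow> v \<notin> span {u}" "co j (oth j y) v' \<noteq> 0 \<longleftrightarrow> v' \<notin> span {u'}"
          using par(1) ij y unfolding s by blast+
      qed
      consider "co i (oth i y) v = 0" "v' \<notin> span {s *\<^sub>R e j y}" | "co j (oth j y) v' = 0" "v \<notin> span {s *\<^sub>R e i y}"
        | "co i (oth i y) v \<noteq> 0 \<and> co j (oth j y) v' \<noteq> 0"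
        using tr one unfolding s by blast
      then show ?thesis
      proof cases
        case 1 then show ?thesis using lem[OF ij(1) y(1) ij(2) y(2) 1(1) v0 1(2) sn] by blast
      next
        case 2 then show ?thesis using lem[OF ij(2) y(2) ij(1) y(1) 2(1) v0(2,1) 2(2) sn[symmetric]] by blast
      qed
    qed
    have o: "oth i y \<in> Y i" "oth j y \<in> Y j" using oth(1) ij y by auto
    have "0 \<le> co i (oth i y) (u - a *\<^sub>R v)" "0 \<le> co j (oth j y) (u' + a *\<^sub>R v')"
      using lS rS o sector_iff_all ij by auto
    then have "0 \<le> - (a * co i (oth i y) v)" "0 \<le> a * co j (oth j y) v'"
      using s ij o y co(4) by simp_all
    then have "co i (oth i y) v < 0" "0 < co j (oth j y) v'"
      using nv a(1) by (auto simp: zero_le_mult_iff mult_le_0_iff)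
    then show ?thesis using crossI[OF ij False _ y s sn] l(2) r(2) by simp
  qed
qed

section \<open>Uniqueness and existence of the refracted direction\<close>

lemma snell_unique:
  assumes j: "j \<in> I" and y: "y \<in> Y j" and s: "xi j v (e j y) = xi j w (e j y)" "F j v = F j w"
    and side: "0 < co j (oth j y) v * co j (oth j y) w"
  shows "v = w"
proof -
  interpret scgauge "F j" by (rule gaugeI[OF j])
  let ?o = "oth j y"
  have o: "?o \<in> Y j" using oth(1)[OF j y] .
  have n: "co j ?o v \<noteq> 0" "co j ?o w \<noteq> 0" using side by auto
  then have vw: "v \<noteq> 0" "w \<noteq> 0" using j o by auto
  define l where "l = co j ?o w / co j ?o v"
  have l: "0 < l" using side unfolding l_def by (auto simp: zero_less_divide_iff zero_less_mult_iff)
  \<comment> \<open>Both vectors point to the same side of the edge, so \<open>l\<close> is positive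
    and \<open>refraction_unique\<close> makes them proportional; the equal norms then fix the
    factor.\<close>
  have "w = l *\<^sub>R v + (co j y w - l * co j y v) *\<^sub>R e j y"
    by (rule co_eqI[OF j y]) (use j y o co(4)[OF j y] n in \<open>auto simp: l_def\<close>)
  then obtain m where m: "m \<ge> 0" "w = m *\<^sub>R v"
    using refraction_unique[OF vw, of l "co j y w - l * co j y v" "e j y"] l s by auto
  then have "F j v = m * F j v" using homog[OF m(1), of v] s(2) by simp
  then have "m = 1" using pos[OF vw(1)] by simp
  then show ?thesis using m by simp
qed

text \<open>The point \<open>u\<close> determines the edge, \<open>neighbour_unique\<close> the cone
  behind it, and \<open>snell_unique\<close> the velocity there.\<close>

lemma cross_unique_right:
  assumes 1: "cross i u v j u' v'" and 2: "cross i u v k u'' v''"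
  shows "j = k \<and> u' = u'' \<and> v' = v''"
proof -
  obtain y s where a: "i \<in> I" "j \<in> I" "i \<noteq> j" "F i v = F j v'" "y \<in> Y i" "y \<in> Y j" "0 < s"
    "u = s *\<^sub>R e i y" "u' = s *\<^sub>R e j y" "xi i v (e i y) = xi j v' (e j y)" "0 < co j (oth j y) v'"
    using 1 unfolding cross_def by blast
  obtain y' s' where b: "k \<in> I" "i \<noteq> k" "F i v = F k v''" "y' \<in> Y i" "y' \<in> Y k" "0 < s'"
    "u = s' *\<^sub>R e i y'" "u'' = s' *\<^sub>R e k y'" "xi i v (e i y') = xi k v'' (e k y')" "0 < co k (oth k y') v''"
    using 2 unfolding cross_def by blast
  have e: "y = y'" "s = s'" using edge_vectors_eq[OF a(1,5) b(4), of s s'] a b by auto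
  have jk: "j = k" using neighbour_unique[of i j k y] a b e by metis
  have "v' = v''" by (rule snell_unique[OF a(2,6)]) (use a b e jk in auto)
  then show ?thesis using jk a b e by simp
qed

lemma cross_unique_left:
  assumes 1: "cross j u' v' i u v" and 2: "cross k u'' v'' i u v"
  shows "j = k \<and> u' = u'' \<and> v' = v''"
proof -
  obtain y s where a: "i \<in> I" "j \<in> I" "i \<noteq> j" "F i v = F j v'" "y \<in> Y i" "y \<in> Y j" "0 < s"
    "u = s *\<^sub>R e i y" "u' = s *\<^sub>R e j y" "xi i v (e i y) = xi j v' (e j y)" "co j (oth j y) v' < 0"
    using 1 unfolding cross_def by auto
  obtain y' s' where b: "k \<in> I" "i \<noteq> k" "F i v = F k v''" "y' \<in> Y i" "y' \<in> Y k" "0 < s'"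
    "u = s' *\<^sub>R e i y'" "u'' = s' *\<^sub>R e k y'" "xi i v (e i y') = xi k v'' (e k y')" "co k (oth k y') v'' < 0"
    using 2 unfolding cross_def by auto
  have e: "y = y'" "s = s'" using edge_vectors_eq[OF a(1,5) b(4), of s s'] a b by auto
  have jk: "j = k" using neighbour_unique[of i j k y] a b e by metis
  have "v' = v''" by (rule snell_unique[OF a(2,6)]) (use a b e jk mult_neg_neg in auto)
  then show ?thesis using jk a b e by simp
qed

text \<open>Transversality of \<open>v\<close> puts the covector value strictly between the bounds
  of \<open>refraction_exists\<close>, and the solution is rescaled to the speed of
  \<open>v\<close>. The sign of \<open>d\<close> selects the side, so both time directions are
  covered.\<close>

lemma snell_exists:
  assumes ij: "i \<in> I" "j \<in> I" and y: "y \<in> Y i" "y \<in> Y j" and v: "co i (oth i y) v \<noteq> 0" and d: "d \<noteq> (0::real)"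
  shows "\<exists>w. F j w = F i v \<and> xi j w (e j y) = xi i v (e i y) \<and> 0 < d * co j (oth j y) w"
proof -
  interpret Fi: scgauge "F i" by (rule gaugeI[OF ij(1)])
  interpret Fj: scgauge "F j" by (rule gaugeI[OF ij(2)])
  have v0: "v \<noteq> 0" using v ij y oth(1) by auto
  have o: "oth i y \<in> Y i" "oth j y \<in> Y j" using oth(1) ij y by auto
  have np: "z \<notin> span {v}" if z: "z = r *\<^sub>R e i y" "r \<noteq> 0" for z r
  proof
    assume "z \<in> span {v}"
    then obtain q where q: "r *\<^sub>R e i y = q *\<^sub>R v" using z by (auto simp: span_singleton)
    have "0 = q * co i (oth i y) v" using arg_cong[OF q, of "co i (oth i y)"] ij o co(4)[OF ij(1) y(1)] by simp
    then have "q = 0" using v by simp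
    then show False using q z e_independent(1)[OF ij(1) y(1)] by simp
  qed
  have up: "xi i v (e i y) < F j (e j y)"
    using Fi.dF_less[OF v0, of "e i y"] np[of "e i y" 1] edge_norm[OF ij y, of 1] by simp
  have "xi i v (- e i y) < F j (- e j y)"
    using Fi.dF_less[OF v0, of "- e i y"] np[of "- e i y" "- 1"] edge_norm[OF ij y, of "- 1"] by simp
  then have dn: "- F j (- e j y) < xi i v (e i y)" using Fi.dF_linear[OF v0] by (simp add: linear_neg)
  let ?w = "d *\<^sub>R e j (oth j y)"
  have ns: "?w \<notin> span {e j y}"
  proof
    assume "?w \<in> span {e j y}"
    then obtain q where "?w = q *\<^sub>R e j y" by (auto simp: span_singleton)
    from arg_cong[OF this, of "co j (oth j y)"] show False
      using ij o d co(4)[OF ij(2) y(2)] by simp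
  qed
  obtain r where r: "xi j (?w + r *\<^sub>R e j y) (e j y) = xi i v (e i y)"
    using Fj.refraction_exists[OF ns dn up] by blast
  define w where "w = ?w + r *\<^sub>R e j y"
  have cw: "co j (oth j y) w = d" using ij o co(4)[OF ij(2) y(2)] by (simp add: w_def)
  then have w0: "w \<noteq> 0" using d ij o by auto
  define l where "l = F i v / F j w"
  have l: "0 < l" using Fi.pos[OF v0] Fj.pos[OF w0] by (simp add: l_def)
  show ?thesis
  proof (intro exI[of _ "l *\<^sub>R w"] conjI)
    show "F j (l *\<^sub>R w) = F i v" using Fj.homog[of l w] l Fj.pos[OF w0] by (simp add: l_def)
    show "xi j (l *\<^sub>R w) (e j y) = xi i v (e i y)" using Fj.dF_scale[OF w0 l] r by (simp add: w_def)
    have "0 < l * (d * d)" using l d by (simp add: zero_less_mult_iff) linarith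
    then show "0 < d * co j (oth j y) (l *\<^sub>R w)" using cw ij o by (simp add: mult.left_commute)
  qed
qed

lemma cross_exists_right:
  assumes i: "i \<in> I" and y: "y \<in> Y i" and s: "0 < s" and v: "co i (oth i y) v < 0"
  shows "\<exists>j u' v'. cross i (s *\<^sub>R e i y) v j u' v'"
proof -
  obtain j where j: "j \<in> I" "j \<noteq> i" "y \<in> Y j" using neighbour_exists[OF i y] by blast
  obtain w where "F j w = F i v" "xi j w (e j y) = xi i v (e i y)" "0 < 1 * co j (oth j y) w"
    using snell_exists[OF i j(1) y j(3), of v 1] v by auto
  then have "cross i (s *\<^sub>R e i y) v j (s *\<^sub>R e j y) w"
    using i j y s v by (intro crossI[of _ _ _ _ y s]) simp_all
  then show ?thesis by blast
qed

lemma cross_exists_left: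
  assumes i: "i \<in> I" and y: "y \<in> Y i" and s: "0 < s" and v: "0 < co i (oth i y) v"
  shows "\<exists>j u' v'. cross j u' v' i (s *\<^sub>R e i y) v"
proof -
  obtain j where j: "j \<in> I" "j \<noteq> i" "y \<in> Y j" using neighbour_exists[OF i y] by blast
  obtain w where "F j w = F i v" "xi j w (e j y) = xi i v (e i y)" "0 < (- 1) * co j (oth j y) w"
    using snell_exists[OF i j(1) y j(3), of v "- 1"] v by auto
  then have "cross j (s *\<^sub>R e j y) w i (s *\<^sub>R e i y) v"
    using i j y s v by (intro crossI[of _ _ _ _ y s]) simp_all
  then show ?thesis by blast
qed

text \<open>Calibration: on the cones of \<open>U\<close>, the function \<open>X - b\<close> cut off between \<open>- m\<close> and \<open>m\<close> does not
  grow faster than arc length; as \<open>m\<close> vanishes on the boundary of \<open>U\<close>, it extends by zero, so that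
  no detour through other cones can be shorter.\<close>

lemma calibration:
  fixes X m :: "'i \<Rightarrow> real^2 \<Rightarrow> real"
  assumes U: "U \<subseteq> I"
    and X: "\<And>k. k \<in> U \<Longrightarrow> linear (X k)" "\<And>k w. k \<in> U \<Longrightarrow> X k w \<le> F k w"
    and m: "\<And>k w w'. k \<in> U \<Longrightarrow> \<bar>m k w - m k w'\<bar> \<le> F k (w - w')"
    and compat: "\<And>k k' p. k \<in> U \<Longrightarrow> k' \<in> U \<Longrightarrow> p \<in> mc k \<Longrightarrow> p \<in> mc k' \<Longrightarrow>
      X k (coord k p) = X k' (coord k' p) \<and> m k (coord k p) = m k' (coord k' p)"
    and bdry: "\<And>k k' p. k \<in> U \<Longrightarrow> k' \<in> I - U \<Longrightarrow> p \<in> mc k \<Longrightarrow> p \<in> mc k' \<Longrightarrow> m k (coord k p) = 0"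
    and c: "\<And>r. \<bar>r - t\<bar> < \<epsilon> \<Longrightarrow> \<exists>k\<in>U. c r \<in> mc k \<and> X k (coord k (c r)) - b = \<kappa> * (r - t) \<and>
      \<bar>\<kappa> * (r - t)\<bar> \<le> m k (coord k (c r))"
    and t: "\<bar>t1 - t\<bar> < \<epsilon>" "\<bar>t2 - t\<bar> < \<epsilon>" "t1 < t2" and ps: "piecewise_smooth M x {t1..t2} c"
  shows "\<kappa> * (t2 - t1) \<le> tdist M x (c t1) (c t2)"
proof -
  define g where "g k w = max (- m k w) (min (X k w - b) (m k w))" for k w
  define f where "f p = (if \<exists>k\<in>U. p \<in> mc k then g (SOME k. k \<in> U \<and> p \<in> mc k) (coord (SOME k. k \<in> U \<and> p \<in> mc k) p) else 0)" for p
  have fU: "f p = g k (coord k p)" if k: "k \<in> U" "p \<in> mc k" for k p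
  proof -
    define l where "l = (SOME k. k \<in> U \<and> p \<in> mc k)"
    have l: "l \<in> U \<and> p \<in> mc l" unfolding l_def by (rule someI[of _ k]) (use k in blast)
    have "f p = g l (coord l p)" unfolding f_def l_def[symmetric] using k by auto
    also have "\<dots> = g k (coord k p)" unfolding g_def using compat[of l k p] l k by simp
    finally show ?thesis .
  qed
  have fn: "f p = 0" if k: "k \<in> I - U" "p \<in> mc k" for k p
  proof (cases "\<exists>l\<in>U. p \<in> mc l")
    case True
    then obtain l where l: "l \<in> U" "p \<in> mc l" by blast
    then show ?thesis using fU[OF l] bdry[OF l(1) k(1) l(2) k(2)] by (simp add: g_def)
  next
    case False
    then show ?thesis unfolding f_def by simp
  qed
  have lip: "g k w - g k v \<le> F k (w - v)" if k: "k \<in> U" for k v w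
  proof -
    have "X k w - X k v \<le> F k (w - v)" using X(2)[OF k, of "w - v"] X(1)[OF k] by (simp add: linear_diff)
    then show ?thesis using m[OF k, of w v] unfolding g_def by linarith
  qed
  have "f (c t2) - f (c t1) \<le> tdist M x (c t1) (c t2)"
  proof (rule tdist_ge[OF ps t(3)])
    fix k v w assume k: "k \<in> I" "v \<in> sec k" "w \<in> sec k"
    show "f (pnt k w) - f (pnt k v) \<le> F k (w - v)"
    proof (cases "k \<in> U")
      case True
      then show ?thesis using fU[OF True, of "pnt k w"] fU[OF True, of "pnt k v"] lip[OF True, of w v] k by simp
    next
      case False
      have "0 \<le> F k (w - v)" using scgauge.nonneg[OF gaugeI[OF k(1)]] .
      then show ?thesis using fn[of k "pnt k w"] fn[of k "pnt k v"] k False by simp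
    qed
  qed
  moreover have "f (c r) = \<kappa> * (r - t)" if r: "\<bar>r - t\<bar> < \<epsilon>" for r
  proof -
    obtain k where k: "k \<in> U" "c r \<in> mc k" "X k (coord k (c r)) - b = \<kappa> * (r - t)"
      "\<bar>\<kappa> * (r - t)\<bar> \<le> m k (coord k (c r))" using c[OF r] by blast
    then show ?thesis using fU[OF k(1,2)] unfolding g_def by linarith
  qed
  ultimately show ?thesis using t by (simp add: algebra_simps)
qed

lemma co_bound:
  assumes "i \<in> I" "y \<in> Y i"
  shows "\<exists>C>0. \<forall>w. \<bar>co i y w\<bar> \<le> C * F i w"
  using scgauge.linear_bound[OF gaugeI[OF assms(1)] co(1)[OF assms]] .

text \<open>The two covectors agree on the common edge by Snell's law and so calibrate together. The
  cut-off is the coordinate along that edge, which vanishes on the outer rays of the two cones;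
  division by \<open>C\<close> bounds its variation by the norm.\<close>

lemma minimal_at_cross:
  assumes cr: "cross i u v j u' v'" and k: "F i v = \<kappa>" "0 < \<kappa>" and a: "0 < a"
    and l: "straight c (t - a) t i (\<lambda>r. u + (r - t) *\<^sub>R v)"
    and r: "straight c t (t + a) j (\<lambda>r. u' + (r - t) *\<^sub>R v')"
  shows "\<exists>\<epsilon>>0. \<forall>t1 t2. \<bar>t1 - t\<bar> < \<epsilon> \<and> \<bar>t2 - t\<bar> < \<epsilon> \<and> t1 < t2 \<and> piecewise_smooth M x {t1..t2} c \<longrightarrow>
    \<kappa> * (t2 - t1) \<le> tdist M x (c t1) (c t2)"
proof -
  obtain y s where ij: "i \<in> I" "j \<in> I" "i \<noteq> j" "F i v = F j v'" and y: "y \<in> Y i" "y \<in> Y j" and s: "0 < s"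
    "u = s *\<^sub>R e i y" "u' = s *\<^sub>R e j y" and sn: "xi i v (e i y) = xi j v' (e j y)"
    using cr unfolding cross_def by blast
  interpret Fi: scgauge "F i" by (rule gaugeI[OF ij(1)])
  interpret Fj: scgauge "F j" by (rule gaugeI[OF ij(2)])
  have v0: "v \<noteq> 0" "v' \<noteq> 0" using k ij(4) by auto
  obtain C1 where C1: "C1 > 0" "\<And>w. \<bar>co i y w\<bar> \<le> C1 * F i w" using co_bound[OF ij(1) y(1)] by blast
  obtain C2 where C2: "C2 > 0" "\<And>w. \<bar>co j y w\<bar> \<le> C2 * F j w" using co_bound[OF ij(2) y(2)] by blast
  define C where "C = max C1 C2"
  have C: "C > 0" using C1 by (simp add: C_def)
  define X where "X k = (if k = i then xi i v else xi j v')" for k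
  define m where "m k w = co k y w / C" for k w
  have yk: "y \<in> Y k" if "k \<in> {i, j}" for k using that y by auto
  have Cb: "\<bar>co k y w\<bar> \<le> C * F k w" if "k \<in> {i, j}" for k w
  proof -
    have "C1 * F i w \<le> C * F i w" "C2 * F j w \<le> C * F j w"
      using Fi.nonneg Fj.nonneg by (auto simp: C_def intro!: mult_right_mono)
    then show ?thesis using that C1(2)[of w] C2(2)[of w] by auto
  qed
  \<comment> \<open>The cut-off is \<open>s / C\<close> at time \<open>t\<close>. For times closer
    to \<open>t\<close> than \<open>s / B\<close> it changes so little that it still dominates the
    absolute value of \<open>\<kappa> * (r - t)\<close>.\<close>
  define B where "B = \<kappa> * C + \<bar>co i y v\<bar> + \<bar>co j y v'\<bar>"
  have B: "0 < B" using k C unfolding B_def by (simp add: add_pos_nonneg)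
  define \<epsilon> where "\<epsilon> = min a (s / B)"
  have e: "0 < \<epsilon>" using a s B by (simp add: \<epsilon>_def)
  have bound: "\<bar>\<kappa> * (r - t)\<bar> \<le> (s + (r - t) * q) / C" if r: "\<bar>r - t\<bar> < \<epsilon>" and q: "\<bar>q\<bar> \<le> \<bar>co i y v\<bar> + \<bar>co j y v'\<bar>" for r q
  proof -
    have "\<bar>r - t\<bar> * B \<le> (s / B) * B" using r B by (intro mult_right_mono) (auto simp: \<epsilon>_def)
    then have 1: "\<bar>r - t\<bar> * B \<le> s" using B by simp
    have "\<bar>r - t\<bar> * \<bar>q\<bar> \<le> \<bar>r - t\<bar> * (\<bar>co i y v\<bar> + \<bar>co j y v'\<bar>)" using q by (intro mult_left_mono) auto
    moreover have "\<bar>(r - t) * q\<bar> = \<bar>r - t\<bar> * \<bar>q\<bar>" by (rule abs_mult)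
    moreover have "\<bar>r - t\<bar> * B = \<bar>r - t\<bar> * (\<kappa> * C) + \<bar>r - t\<bar> * (\<bar>co i y v\<bar> + \<bar>co j y v'\<bar>)"
      by (simp add: B_def distrib_left)
    ultimately have 2: "\<bar>r - t\<bar> * (\<kappa> * C) + \<bar>(r - t) * q\<bar> \<le> s" using 1 by linarith
    have "\<bar>\<kappa> * (r - t)\<bar> * C = \<bar>r - t\<bar> * (\<kappa> * C)" using k by (simp add: abs_mult)
    then have "\<bar>\<kappa> * (r - t)\<bar> * C \<le> s + (r - t) * q" using 2 by linarith
    then show ?thesis using C by (simp add: pos_le_divide_eq)
  qed
  have main: "\<kappa> * (t2 - t1) \<le> tdist M x (c t1) (c t2)"
    if h: "\<bar>t1 - t\<bar> < \<epsilon>" "\<bar>t2 - t\<bar> < \<epsilon>" "t1 < t2" "piecewise_smooth M x {t1..t2} c" for t1 t2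
  proof (rule calibration[where U = "{i, j}" and X = X and m = m and b = "s * xi i v (e i y)", OF _ _ _ _ _ _ _ h])
    show "{i, j} \<subseteq> I" using ij by simp
    show "linear (X k)" if "k \<in> {i, j}" for k using that Fi.dF_linear Fj.dF_linear v0 by (auto simp: X_def)
    show "X k w \<le> F k w" if "k \<in> {i, j}" for k w using that Fi.dF_le[OF v0(1)] Fj.dF_le[OF v0(2)] ij(3) by (auto simp: X_def)
    show "\<bar>m k w - m k w'\<bar> \<le> F k (w - w')" if kk: "k \<in> {i, j}" for k w w'
    proof -
      have "m k w - m k w' = co k y (w - w') / C" using kk ij yk[OF kk] by (auto simp: m_def diff_divide_distrib)
      then show ?thesis using Cb[OF kk, of "w - w'"] C by (simp add: abs_divide pos_divide_le_eq mult.commute)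
    qed
    show "X k (coord k p) = X k' (coord k' p) \<and> m k (coord k p) = m k' (coord k' p)"
      if kk: "k \<in> {i, j}" "k' \<in> {i, j}" "p \<in> mc k" "p \<in> mc k'" for k k' p
    proof (cases "k = k'")
      case False
      then have p: "p \<in> mc i" "p \<in> mc j" using kk by auto
      obtain z where "z \<ge> 0" "coord i p = z *\<^sub>R e i y" "coord j p = z *\<^sub>R e j y"
        using mcone_inter_edge[OF ij(1-3) p y] by blast
      then have "X i (coord i p) = X j (coord j p)" "m i (coord i p) = m j (coord j p)"
        using Fi.dF_linear[OF v0(1)] Fj.dF_linear[OF v0(2)] sn ij y by (auto simp: X_def m_def linear_cmul)
      then show ?thesis using kk False by auto
    qed simp
    show "m k (coord k p) = 0" if kk: "k \<in> {i, j}" "k' \<in> I - {i, j}" "p \<in> mc k" "p \<in> mc k'" for k k' p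
    proof -
      have kI: "k \<in> I" "k' \<in> I" "k \<noteq> k'" using kk ij by auto
      from mcone_inter[OF kI kk(3,4)] show ?thesis
      proof
        assume "\<exists>y\<in>Y k \<inter> Y k'. \<exists>s>0. coord k p = s *\<^sub>R e k y \<and> coord k' p = s *\<^sub>R e k' y"
        then obtain y' z where y': "y' \<in> Y k" "y' \<in> Y k'" "coord k p = z *\<^sub>R e k y'" by blast
        have "y' \<noteq> y"
        proof
          assume "y' = y"
          then show False using neighbour_unique[of i j k' y] ij kI kk y y' by auto
        qed
        then have "y' = oth k y" using oth(3)[OF kI(1) yk[OF kk(1)]] y' by blast
        then show ?thesis using y' kI yk[OF kk(1)] by (simp add: m_def)
      qed (use kI yk[OF kk(1)] in \<open>simp add: m_def\<close>)
    qed
    show "\<exists>k\<in>{i, j}. c r \<in> mc k \<and> X k (coord k (c r)) - s * xi i v (e i y) = \<kappa> * (r - t) \<and> \<bar>\<kappa> * (r - t)\<bar> \<le> m k (coord k (c r))"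
      if r': "\<bar>r - t\<bar> < \<epsilon>" for r
    proof (cases "r \<le> t")
      case True
      then have cr: "coord i (c r) = u + (r - t) *\<^sub>R v \<and> c r \<in> mc i"
        using straight_coord[OF l] r' by (auto simp: \<epsilon>_def)
      moreover have "X i (u + (r - t) *\<^sub>R v) - s * xi i v (e i y) = \<kappa> * (r - t)"
        using Fi.dF_linear[OF v0(1)] Fi.dF_self[OF v0(1)] k by (simp add: X_def s linear_add linear_cmul)
      moreover have "m i (u + (r - t) *\<^sub>R v) = (s + (r - t) * co i y v) / C"
        using ij y by (simp add: m_def s)
      ultimately show ?thesis using bound[OF r', of "co i y v"] by (intro bexI[of _ i]) auto
    next
      case False
      then have cr: "coord j (c r) = u' + (r - t) *\<^sub>R v' \<and> c r \<in> mc j"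
        using straight_coord[OF r] r' by (auto simp: \<epsilon>_def)
      moreover have "X j (u' + (r - t) *\<^sub>R v') - s * xi i v (e i y) = \<kappa> * (r - t)"
        using Fj.dF_linear[OF v0(2)] Fj.dF_self[OF v0(2)] k ij(3,4) sn by (simp add: X_def s linear_add linear_cmul)
      moreover have "m j (u' + (r - t) *\<^sub>R v') = (s + (r - t) * co j y v') / C"
        using ij y by (simp add: m_def s)
      ultimately show ?thesis using bound[OF r', of "co j y v'"] by (intro bexI[of _ j]) auto
    qed
  qed
  show ?thesis using e main by blast
qed

text \<open>Here one covector calibrates, and the cut-off is the smaller of the two coordinates,
  which vanishes on both boundary rays.\<close>

lemma minimal_at_interior:
  assumes i: "i \<in> I" and u: "\<And>y. y \<in> Y i \<Longrightarrow> 0 < co i y u" and k: "F i v = \<kappa>" "0 < \<kappa>" and a: "0 < a"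
    and l: "straight c (t - a) (t + a) i (\<lambda>r. u + (r - t) *\<^sub>R v)"
  shows "\<exists>\<epsilon>>0. \<forall>t1 t2. \<bar>t1 - t\<bar> < \<epsilon> \<and> \<bar>t2 - t\<bar> < \<epsilon> \<and> t1 < t2 \<and> piecewise_smooth M x {t1..t2} c \<longrightarrow>
    \<kappa> * (t2 - t1) \<le> tdist M x (c t1) (c t2)"
proof -
  obtain y where y: "y \<in> Y i" using Y_nonempty[OF i] by blast
  let ?o = "oth i y"
  have o: "?o \<in> Y i" using oth(1)[OF i y] .
  interpret scgauge "F i" by (rule gaugeI[OF i])
  have v0: "v \<noteq> 0" using k by auto
  obtain C1 where C1: "C1 > 0" "\<And>w. \<bar>co i y w\<bar> \<le> C1 * F i w" using co_bound[OF i y] by blast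
  obtain C2 where C2: "C2 > 0" "\<And>w. \<bar>co i ?o w\<bar> \<le> C2 * F i w" using co_bound[OF i o] by blast
  define C where "C = max C1 C2"
  have C: "C > 0" using C1 by (simp add: C_def)
  have Cb: "\<bar>co i z w\<bar> \<le> C * F i w" if "z \<in> {y, ?o}" for z w
  proof -
    have "C1 * F i w \<le> C * F i w" "C2 * F i w \<le> C * F i w"
      using nonneg by (auto simp: C_def intro!: mult_right_mono)
    then show ?thesis using that C1(2)[of w] C2(2)[of w] by auto
  qed
  have zY: "z \<in> Y i" if "z \<in> {y, ?o}" for z using that y o by auto
  have lip: "\<bar>co i z w / C - co i z w' / C\<bar> \<le> F i (w - w')" if z: "z \<in> {y, ?o}" for z w w'
  proof -
    have "co i z w / C - co i z w' / C = co i z (w - w') / C" using i zY[OF z] by (simp add: diff_divide_distrib)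
    then show ?thesis using Cb[OF z, of "w - w'"] C by (simp add: abs_divide pos_divide_le_eq mult.commute)
  qed
  define m where "m k w = min (co i y w / C) (co i ?o w / C)" for k :: 'i and w
  define s where "s = min (co i y u) (co i ?o u)"
  have s: "0 < s" using u y o by (simp add: s_def)
  define B where "B = \<kappa> * C + \<bar>co i y v\<bar> + \<bar>co i ?o v\<bar>"
  have B: "0 < B" using k C unfolding B_def by (simp add: add_pos_nonneg)
  define \<epsilon> where "\<epsilon> = min a (s / B)"
  have e: "0 < \<epsilon>" using a s B by (simp add: \<epsilon>_def)
  have bound: "\<bar>\<kappa> * (r - t)\<bar> \<le> co i z (u + (r - t) *\<^sub>R v) / C" if r: "\<bar>r - t\<bar> < \<epsilon>" and z: "z \<in> {y, ?o}" for r z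
  proof -
    have "\<bar>r - t\<bar> * B \<le> (s / B) * B" using r B by (intro mult_right_mono) (auto simp: \<epsilon>_def)
    then have 1: "\<bar>r - t\<bar> * B \<le> s" using B by simp
    have "\<bar>co i z v\<bar> \<le> \<bar>co i y v\<bar> + \<bar>co i ?o v\<bar>" using z by auto
    then have "\<bar>r - t\<bar> * \<bar>co i z v\<bar> \<le> \<bar>r - t\<bar> * (\<bar>co i y v\<bar> + \<bar>co i ?o v\<bar>)" by (intro mult_left_mono) auto
    moreover have "\<bar>(r - t) * co i z v\<bar> = \<bar>r - t\<bar> * \<bar>co i z v\<bar>" by (rule abs_mult)
    moreover have "\<bar>r - t\<bar> * B = \<bar>r - t\<bar> * (\<kappa> * C) + \<bar>r - t\<bar> * (\<bar>co i y v\<bar> + \<bar>co i ?o v\<bar>)"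
      by (simp add: B_def distrib_left)
    ultimately have 2: "\<bar>r - t\<bar> * (\<kappa> * C) + \<bar>(r - t) * co i z v\<bar> \<le> s" using 1 by linarith
    have "s \<le> co i z u" using z by (auto simp: s_def)
    moreover have "\<bar>\<kappa> * (r - t)\<bar> * C = \<bar>r - t\<bar> * (\<kappa> * C)" using k by (simp add: abs_mult)
    ultimately have "\<bar>\<kappa> * (r - t)\<bar> * C \<le> co i z u + (r - t) * co i z v" using 2 by linarith
    then show ?thesis using C i zY[OF z] by (simp add: pos_le_divide_eq)
  qed
  have main: "\<kappa> * (t2 - t1) \<le> tdist M x (c t1) (c t2)"
    if h: "\<bar>t1 - t\<bar> < \<epsilon>" "\<bar>t2 - t\<bar> < \<epsilon>" "t1 < t2" "piecewise_smooth M x {t1..t2} c" for t1 t2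
  proof (rule calibration[where U = "{i}" and X = "\<lambda>_. xi i v" and m = m and b = "xi i v u", OF _ _ _ _ _ _ _ h])
    show "{i} \<subseteq> I" using i by simp
    show "linear (xi i v)" using dF_linear[OF v0] .
    show "xi i v w \<le> F k w" if "k \<in> {i}" for k w using that dF_le[OF v0] by simp
    show "\<bar>m k w - m k w'\<bar> \<le> F k (w - w')" if kk: "k \<in> {i}" for k w w'
      using lip[of y w w'] lip[of ?o w w'] kk unfolding m_def by simp
    show "m k (coord k p) = 0" if kk: "k \<in> {i}" "k' \<in> I - {i}" "p \<in> mc k" "p \<in> mc k'" for k k' p
    proof -
      have kI: "i \<in> I" "k' \<in> I" "i \<noteq> k'" and p: "p \<in> mc i" and ki: "k = i" using kk i by auto
      from mcone_inter[OF kI p kk(4)] show ?thesis unfolding ki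
      proof
        assume "\<exists>y\<in>Y i \<inter> Y k'. \<exists>s>0. coord i p = s *\<^sub>R e i y \<and> coord k' p = s *\<^sub>R e k' y"
        then obtain y' z where y': "y' \<in> Y i" "0 < z" "coord i p = z *\<^sub>R e i y'" by blast
        then consider "y' = y" | "y' = ?o" using oth(3)[OF i y] by blast
        then show "m i (coord i p) = 0" using y' C i y o co(4,5)[OF i y] by cases (auto simp: m_def)
      qed (use i y o in \<open>simp add: m_def\<close>)
    qed
    show "\<exists>k\<in>{i}. c r \<in> mc k \<and> xi i v (coord k (c r)) - xi i v u = \<kappa> * (r - t) \<and> \<bar>\<kappa> * (r - t)\<bar> \<le> m k (coord k (c r))"
      if r': "\<bar>r - t\<bar> < \<epsilon>" for r
    proof -
      have cr: "coord i (c r) = u + (r - t) *\<^sub>R v \<and> c r \<in> mc i"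
        by (rule straight_coord[OF l]) (use r' in \<open>simp add: \<epsilon>_def abs_less_iff\<close>)
      moreover have "xi i v (u + (r - t) *\<^sub>R v) - xi i v u = \<kappa> * (r - t)"
        using dF_linear[OF v0] dF_self[OF v0] k by (simp add: linear_add linear_cmul)
      moreover have "\<bar>\<kappa> * (r - t)\<bar> \<le> m i (u + (r - t) *\<^sub>R v)"
        using bound[OF r', of y] bound[OF r', of ?o] by (simp add: m_def)
      ultimately show ?thesis by auto
    qed
  qed simp
  show ?thesis using e main by blast
qed

end

section \<open>Finiteness of the number of crossings\<close>

context pf_vertex begin

text \<open>All lines share one time axis, and \<open>\<tau> n\<close> is the time at which piece
  \<open>n\<close> is entered. Integer indices allow growth at both ends. The order of the times is
  a consequence of the signs in \<open>cross\<close>, see \<open>edge_to_edge\<close>.\<close>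

definition chain :: "real \<Rightarrow> int \<Rightarrow> int \<Rightarrow> (int \<Rightarrow> 'i) \<Rightarrow> (int \<Rightarrow> real^2) \<Rightarrow> (int \<Rightarrow> real^2) \<Rightarrow> (int \<Rightarrow> real) \<Rightarrow> bool" where
  "chain \<kappa> A B k b v \<tau> \<longleftrightarrow> A \<le> B \<and> (\<forall>n\<in>{A..B}. k n \<in> I \<and> F (k n) (v n) = \<kappa>) \<and>
     (\<forall>n\<in>{A<..B}. cross (k (n - 1)) (b (n - 1) + \<tau> n *\<^sub>R v (n - 1)) (v (n - 1)) (k n) (b n + \<tau> n *\<^sub>R v n) (v n))"

lemma crossE:
  assumes "cross i u v j u' v'"
  obtains y s where "i \<in> I" "j \<in> I" "i \<noteq> j" "F i v = F j v'" "y \<in> Y i" "y \<in> Y j" "0 < s" "u = s *\<^sub>R e i y"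
    "u' = s *\<^sub>R e j y" "xi i v (e i y) = xi j v' (e j y)" "co i (oth i y) v < 0" "0 < co j (oth j y) v'"
  using assms unfolding cross_def by blast

text \<open>By the signs of the velocity a line cannot leave through the ray by which it enters. The
  coordinate along the exit ray rises from 0 to \<open>s'\<close>, which orders the two
  times.\<close>

lemma edge_to_edge:
  assumes i: "i \<in> I" and y: "y \<in> Y i" "y' \<in> Y i"
    and s: "b + t *\<^sub>R v = s *\<^sub>R e i y" "b + t' *\<^sub>R v = s' *\<^sub>R e i y'" "0 < s" "0 < s'"
    and v: "0 < co i (oth i y) v" "co i (oth i y') v < 0"
  shows "y' = oth i y" "t < t'"
proof -
  have "y' \<noteq> y" using v by auto
  then show o: "y' = oth i y" using oth(3)[OF i y(1)] y(2) by blast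
  have oY: "oth i y \<in> Y i" using oth(1)[OF i y(1)] .
  have "(t' - t) *\<^sub>R v = s' *\<^sub>R e i y' - s *\<^sub>R e i y" unfolding s(1,2)[symmetric] by (simp add: algebra_simps)
  from arg_cong[OF this, of "co i (oth i y)"] have "(t' - t) * co i (oth i y) v = s'"
    using i y oY o co(4,5)[OF i y(1)] by simp
  then have "0 < (t' - t) * co i (oth i y) v" using s by simp
  then show "t < t'" using v(1) by (simp add: zero_less_mult_iff)
qed

text \<open>In the Euclidean plane this is the cosine of the angle between the velocity and the ray.
  For an asymmetric norm negative values are divided by the norm of the opposite vector, which keeps
  the quantity in [-1, 1] and turns them into positive values of the reversed gauge.\<close>

definition potential :: "'i \<Rightarrow> 'a \<Rightarrow> real^2 \<Rightarrow> real" where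
  "potential i y v = (let z = xi i v (e i y) in if 0 \<le> z then z / F i (e i y) else z / F i (- e i y))"

lemma potential_bounds:
  assumes "i \<in> I" "y \<in> Y i" "v \<noteq> 0"
  shows "\<bar>potential i y v\<bar> \<le> 1"
proof -
  interpret scgauge "F i" by (rule gaugeI[OF assms(1)])
  have p: "0 < F i (e i y)" "0 < F i (- e i y)" using pos e_independent(1)[OF assms(1,2)] by simp_all
  show ?thesis using dF_le[OF assms(3), of "e i y"] dF_ge[OF assms(3), of "e i y"] p
    unfolding potential_def Let_def by (auto simp: abs_if divide_le_eq field_simps)
qed

lemma potential_cross:
  assumes "i \<in> I" "j \<in> I" "y \<in> Y i" "y \<in> Y j" "xi i v (e i y) = xi j w (e j y)"
  shows "potential i y v = potential j y w"
  using assms edge_norm[OF assms(1-4), of 1] edge_norm[OF assms(1-4), of "- 1"]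
  unfolding potential_def by (simp add: Let_def)

text \<open>From a nonnegative value the gain is \<open>crossing_step\<close>. If both values are
  negative, it is the same lemma for the reversed gauge, with the line run backwards from
  \<open>oth i y\<close> to \<open>y\<close>. What remains is a change of sign, for which no amount
  is claimed.\<close>

lemma sector_step:
  assumes i: "i \<in> I" and y: "y \<in> Y i"
  shows "\<exists>d>0. \<forall>s s' t v. 0 < s \<longrightarrow> 0 < s' \<longrightarrow> 0 < t \<longrightarrow> v \<noteq> 0 \<longrightarrow>
      s' *\<^sub>R e i (oth i y) = s *\<^sub>R e i y + t *\<^sub>R v \<longrightarrow>
      potential i y v + d \<le> potential i (oth i y) v \<or> potential i y v < 0 \<and> 0 \<le> potential i (oth i y) v"
proof -
  interpret scgauge "F i" by (rule gaugeI[OF i])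
  let ?e = "e i y" and ?e' = "e i (oth i y)"
  have o: "oth i y \<in> Y i" using oth(1)[OF i y] .
  have ns: "?e' \<notin> span {?e}" "?e \<notin> span {?e'}"
    using e_independent(2)[OF i y] e_independent(2)[OF i o] oth(4)[OF i y] by (auto simp: span_singleton)
  have p: "0 < F i ?e" "0 < F i (- ?e)" "0 < F i ?e'" "0 < F i (- ?e')"
    using pos e_independent(1) i y o by simp_all
  obtain d1 where d1: "d1 > 0" "\<forall>s s' t v. 0 < s \<longrightarrow> 0 < s' \<longrightarrow> 0 < t \<longrightarrow> v \<noteq> 0 \<longrightarrow>
      s' *\<^sub>R ?e' = s *\<^sub>R ?e + t *\<^sub>R v \<longrightarrow> 0 \<le> xi i v ?e \<longrightarrow> xi i v ?e / F i ?e + d1 \<le> xi i v ?e' / F i ?e'"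
    using crossing_step[OF ns(2,1)] by blast
  obtain d2 where d2: "d2 > 0" "\<forall>s s' t v. 0 < s \<longrightarrow> 0 < s' \<longrightarrow> 0 < t \<longrightarrow> v \<noteq> 0 \<longrightarrow>
      s' *\<^sub>R ?e = s *\<^sub>R ?e' + t *\<^sub>R v \<longrightarrow> 0 \<le> scgauge.dF (\<lambda>v. F i (- v)) v ?e' \<longrightarrow>
      scgauge.dF (\<lambda>v. F i (- v)) v ?e' / F i (- ?e') + d2 \<le> scgauge.dF (\<lambda>v. F i (- v)) v ?e / F i (- ?e)"
    using scgauge.crossing_step[OF reverse ns] by blast
  show ?thesis
  proof (intro exI[of _ "min d1 d2"] conjI allI impI)
    fix s s' t :: real and v :: "real^2"
    assume h: "0 < s" "0 < s'" "0 < t" "v \<noteq> 0" "s' *\<^sub>R ?e' = s *\<^sub>R ?e + t *\<^sub>R v"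
    have a: "xi i v ?e / F i ?e + d1 \<le> xi i v ?e' / F i ?e'" if "0 \<le> xi i v ?e"
      using d1(2) h that by blast
    have b: "xi i v ?e / F i (- ?e) + d2 \<le> xi i v ?e' / F i (- ?e')" if z: "xi i v ?e' \<le> 0"
    proof -
      have "s *\<^sub>R ?e = s' *\<^sub>R ?e' + t *\<^sub>R (- v)" using h(5) by simp
      moreover have r: "scgauge.dF (\<lambda>v. F i (- v)) (- v) w = - xi i v w" for w
        using reverse_dF[OF gaugeI[OF i], of "- v" w] h(4) by simp
      ultimately have "scgauge.dF (\<lambda>v. F i (- v)) (- v) ?e' / F i (- ?e') + d2 \<le> scgauge.dF (\<lambda>v. F i (- v)) (- v) ?e / F i (- ?e)"
        using d2(2)[rule_format, of s' s t "- v"] h z by simp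
      then show ?thesis unfolding r by simp
    qed
    show "potential i y v + min d1 d2 \<le> potential i (oth i y) v \<or> potential i y v < 0 \<and> 0 \<le> potential i (oth i y) v"
    proof (cases "0 \<le> xi i v ?e")
      case True
      have "0 \<le> xi i v ?e / F i ?e" using True p by simp
      then have "0 < xi i v ?e' / F i ?e'" using a[OF True] d1(1) by linarith
      then have "0 \<le> xi i v ?e'" using p by (simp add: zero_less_divide_iff)
      then show ?thesis using a[OF True] True by (simp add: potential_def min_def)
    next
      case False
      show ?thesis
      proof (cases "0 \<le> xi i v ?e'")
        case True
        then show ?thesis using False p by (simp add: potential_def divide_neg_pos)
      next
        case neg: False
        then show ?thesis using False b by (simp add: potential_def min_def)
      qed
    qed
  qed (use d1 d2 in simp)
qed

lemma uniform_step:
  "\<exists>d>0. \<forall>i\<in>I. \<forall>y\<in>Y i. \<forall>s s' t v. 0 < s \<longrightarrow> 0 < s' \<longrightarrow> 0 < t \<longrightarrow> v \<noteq> 0 \<longrightarrow>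
      s' *\<^sub>R e i (oth i y) = s *\<^sub>R e i y + t *\<^sub>R v \<longrightarrow>
      potential i y v + d \<le> potential i (oth i y) v \<or> potential i y v < 0 \<and> 0 \<le> potential i (oth i y) v"
proof -
  let ?P = "\<lambda>d i y. \<forall>s s' t v. 0 < s \<longrightarrow> 0 < s' \<longrightarrow> 0 < t \<longrightarrow> v \<noteq> 0 \<longrightarrow>
      s' *\<^sub>R e i (oth i y) = s *\<^sub>R e i y + t *\<^sub>R v \<longrightarrow>
      potential i y v + d \<le> potential i (oth i y) v \<or> potential i y v < 0 \<and> 0 \<le> potential i (oth i y) v"
  define S where "S = Sigma I Y"
  have "finite (Y i)" if "i \<in> I" for i
    using Y_nonempty[OF that] oth(3)[OF that] by (metis finite.emptyI finite.insertI)
  then have S: "finite S" unfolding S_def using finite_star by blast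
  have "\<forall>p\<in>S. \<exists>d>0. ?P d (fst p) (snd p)" unfolding S_def using sector_step by auto
  then obtain d where d: "\<And>p. p \<in> S \<Longrightarrow> 0 < d p \<and> ?P (d p) (fst p) (snd p)" by metis
  \<comment> \<open>Inserting 1 keeps the set of gains nonempty.\<close>
  define m where "m = Min (insert 1 (d ` S))"
  have m: "0 < m" unfolding m_def using S d by auto
  have le: "m \<le> d p" if "p \<in> S" for p unfolding m_def using S that by (intro Min_le) auto
  have "?P m i y" if iy: "i \<in> I" "y \<in> Y i" for i y
  proof -
    have p: "(i, y) \<in> S" using iy by (simp add: S_def)
    show ?thesis
    proof (intro allI impI)
      fix s s' t :: real and v :: "real^2"
      assume h: "0 < s" "0 < s'" "0 < t" "v \<noteq> 0" "s' *\<^sub>R e i (oth i y) = s *\<^sub>R e i y + t *\<^sub>R v"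
      have "potential i y v + d (i, y) \<le> potential i (oth i y) v \<or> potential i y v < 0 \<and> 0 \<le> potential i (oth i y) v"
        using d[OF p] h by simp
      then show "potential i y v + m \<le> potential i (oth i y) v \<or> potential i y v < 0 \<and> 0 \<le> potential i (oth i y) v"
        using le[OF p] by linarith
    qed
  qed
  then show ?thesis using m by blast
qed

lemma chain_bounded:
  assumes k: "0 < \<kappa>"
  shows "\<exists>N::nat. \<forall>A B k b v \<tau>. chain \<kappa> A B k b v \<tau> \<longrightarrow> nat (B - A) \<le> N"
proof -
  obtain d where d: "0 < d" "\<forall>i\<in>I. \<forall>y\<in>Y i. \<forall>s s' t v. 0 < s \<longrightarrow> 0 < s' \<longrightarrow> 0 < t \<longrightarrow> v \<noteq> 0 \<longrightarrow>
      s' *\<^sub>R e i (oth i y) = s *\<^sub>R e i y + t *\<^sub>R v \<longrightarrow>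
      potential i y v + d \<le> potential i (oth i y) v \<or> potential i y v < 0 \<and> 0 \<le> potential i (oth i y) v"
    using uniform_step by (elim exE conjE)
  \<comment> \<open>\<open>2 + d\<close> is the width of the interval [-1, 1 + d] that contains the
    corrected quantity \<open>q\<close> below.\<close>
  obtain N :: nat where N: "2 + d < N * d" using reals_Archimedean3[OF d(1)] by blast
  have "nat (B - A) \<le> N + 1" if ch: "chain \<kappa> A B k b v \<tau>" for A B k b v \<tau>
  proof (rule ccontr)
    assume big: "\<not> ?thesis"
    have kI: "k n \<in> I" "v n \<noteq> 0" if "n \<in> {A..B}" for n
    proof -
      show "k n \<in> I" using ch that by (simp add: chain_def)
      then interpret scgauge "F (k n)" by (rule gaugeI)
      have "F (k n) (v n) = \<kappa>" using ch that by (simp add: chain_def)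
      then show "v n \<noteq> 0" using k zero by force
    qed
    have cr: "cross (k (n - 1)) (b (n - 1) + \<tau> n *\<^sub>R v (n - 1)) (v (n - 1)) (k n) (b n + \<tau> n *\<^sub>R v n) (v n)"
      if "n \<in> {A<..B}" for n using ch that by (simp add: chain_def)
    have "\<forall>n\<in>{A<..B}. \<exists>y s. y \<in> Y (k (n - 1)) \<and> y \<in> Y (k n) \<and> 0 < s \<and>
        b (n - 1) + \<tau> n *\<^sub>R v (n - 1) = s *\<^sub>R e (k (n - 1)) y \<and> b n + \<tau> n *\<^sub>R v n = s *\<^sub>R e (k n) y \<and>
        xi (k (n - 1)) (v (n - 1)) (e (k (n - 1)) y) = xi (k n) (v n) (e (k n) y) \<and>
        co (k (n - 1)) (oth (k (n - 1)) y) (v (n - 1)) < 0 \<and> 0 < co (k n) (oth (k n) y) (v n)"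
    proof
      fix n assume "n \<in> {A<..B}"
      from cr[OF this] show "\<exists>y s. y \<in> Y (k (n - 1)) \<and> y \<in> Y (k n) \<and> 0 < s \<and>
        b (n - 1) + \<tau> n *\<^sub>R v (n - 1) = s *\<^sub>R e (k (n - 1)) y \<and> b n + \<tau> n *\<^sub>R v n = s *\<^sub>R e (k n) y \<and>
        xi (k (n - 1)) (v (n - 1)) (e (k (n - 1)) y) = xi (k n) (v n) (e (k n) y) \<and>
        co (k (n - 1)) (oth (k (n - 1)) y) (v (n - 1)) < 0 \<and> 0 < co (k n) (oth (k n) y) (v n)"
        by (rule crossE) blast
    qed
    then obtain y s where ys: "\<And>n. n \<in> {A<..B} \<Longrightarrow> y n \<in> Y (k (n - 1)) \<and> y n \<in> Y (k n) \<and> 0 < s n \<and>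
        b (n - 1) + \<tau> n *\<^sub>R v (n - 1) = s n *\<^sub>R e (k (n - 1)) (y n) \<and> b n + \<tau> n *\<^sub>R v n = s n *\<^sub>R e (k n) (y n) \<and>
        xi (k (n - 1)) (v (n - 1)) (e (k (n - 1)) (y n)) = xi (k n) (v n) (e (k n) (y n)) \<and>
        co (k (n - 1)) (oth (k (n - 1)) (y n)) (v (n - 1)) < 0 \<and> 0 < co (k n) (oth (k n) (y n)) (v n)"
      by metis
    define p where "p n = potential (k n) (y n) (v n)" for n
    \<comment> \<open>Adding \<open>d\<close> once the value is nonnegative turns the exceptional
      change of sign into a gain of \<open>d\<close> too, so \<open>q\<close> grows by
      \<open>d\<close> at every step.\<close>
    define q where "q n = p n + (if 0 \<le> p n then d else 0)" for n
    have step: "q n + d \<le> q (n + 1)" if n: "A < n" "n < B" for n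
    proof -
      have n1: "n \<in> {A<..B}" "n + 1 \<in> {A<..B}" "n \<in> {A..B}" "n + 1 \<in> {A..B}" using n by auto
      note a = ys[OF n1(1)] and c = ys[OF n1(2), simplified]
      have yY: "y n \<in> Y (k n)" "y (n + 1) \<in> Y (k n)" using a c by auto
      have o: "y (n + 1) = oth (k n) (y n)" "\<tau> n < \<tau> (n + 1)"
        using edge_to_edge[OF kI(1)[OF n1(3)] yY, of "b n" "\<tau> n" "v n" "s n" "\<tau> (n + 1)" "s (n + 1)"] a c by auto
      have eq: "s (n + 1) *\<^sub>R e (k n) (oth (k n) (y n)) = s n *\<^sub>R e (k n) (y n) + (\<tau> (n + 1) - \<tau> n) *\<^sub>R v n"
      proof -
        have "s (n + 1) *\<^sub>R e (k n) (y (n + 1)) = b n + \<tau> (n + 1) *\<^sub>R v n" using c by simp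
        also have "\<dots> = (b n + \<tau> n *\<^sub>R v n) + (\<tau> (n + 1) - \<tau> n) *\<^sub>R v n" by (simp add: algebra_simps)
        also have "b n + \<tau> n *\<^sub>R v n = s n *\<^sub>R e (k n) (y n)" using a by simp
        finally show ?thesis using o by simp
      qed
      have "potential (k n) (y n) (v n) + d \<le> potential (k n) (oth (k n) (y n)) (v n) \<or>
          potential (k n) (y n) (v n) < 0 \<and> 0 \<le> potential (k n) (oth (k n) (y n)) (v n)"
        by (rule d(2)[rule_format, OF kI(1)[OF n1(3)] yY(1) _ _ _ kI(2)[OF n1(3)] eq]) (use a c o in auto)
      moreover have "potential (k n) (y (n + 1)) (v n) = potential (k (n + 1)) (y (n + 1)) (v (n + 1))"
        by (rule potential_cross) (use kI(1) n1 c in auto)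
      ultimately have "p n + d \<le> p (n + 1) \<or> p n < 0 \<and> 0 \<le> p (n + 1)" using o by (simp add: p_def)
      then show ?thesis using d(1) by (auto simp: q_def)
    qed
    \<comment> \<open>Counting starts at \<open>A + 1\<close>, the first index that has an entry
      edge.\<close>
    have ind: "m < nat (B - A) \<Longrightarrow> q (A + 1) + m * d \<le> q (A + 1 + int m)" for m
    proof (induction m)
      case (Suc m)
      then have "q (A + 1 + int m) + d \<le> q (A + 1 + int m + 1)" by (intro step) auto
      then show ?case using Suc by (simp add: algebra_simps)
    qed simp
    have qb: "\<bar>p n\<bar> \<le> 1" if n: "n \<in> {A<..B}" for n
      unfolding p_def by (rule potential_bounds) (use kI[of n] ys[OF n] n in auto)
    have "q (A + 1) + (N + 1) * d \<le> q (A + 1 + int (N + 1))" by (rule ind) (use big in auto)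
    moreover have "- 1 \<le> q (A + 1)" using qb[of "A + 1"] big d(1) by (auto simp: q_def)
    moreover have "q (A + 1 + int (N + 1)) \<le> 1 + d" using qb[of "A + 1 + int (N + 1)"] big d(1) by (auto simp: q_def)
    ultimately show False using N d(1) by (simp add: algebra_simps)
  qed
  then show ?thesis by blast
qed

section \<open>Extending a chain at its ends\<close>

definition inside :: "'i \<Rightarrow> real^2 \<Rightarrow> bool" where
  "inside i u \<longleftrightarrow> (\<forall>y\<in>Y i. 0 < co i y u)"

lemma inside_iff: "\<lbrakk>i \<in> I; y \<in> Y i\<rbrakk> \<Longrightarrow> inside i u \<longleftrightarrow> 0 < co i y u \<and> 0 < co i (oth i y) u"
  unfolding inside_def using oth(3) by (metis insert_iff singletonD)

lemma inside_sector: "i \<in> I \<Longrightarrow> inside i u \<Longrightarrow> u \<in> sec i"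
  by (auto simp: inside_def sector_iff_all intro: less_imp_le)

text \<open>A velocity outside the sector has a negative coordinate; the coordinate that reaches 0
  first decides the exit ray. As the line misses the apex, the other coordinate is still positive at
  that time.\<close>

lemma exit_edge:
  assumes i: "i \<in> I" and u: "inside i u" and v: "v \<notin> sec i" and nz: "\<And>t. u + t *\<^sub>R v \<noteq> 0"
  shows "\<exists>t y s. 0 < t \<and> y \<in> Y i \<and> 0 < s \<and> u + t *\<^sub>R v = s *\<^sub>R e i y \<and> co i (oth i y) v < 0"
proof -
  have main: ?thesis if z: "z \<in> Y i" "co i z v < 0" and
    min: "co i (oth i z) v < 0 \<Longrightarrow> co i z u / (- co i z v) \<le> co i (oth i z) u / (- co i (oth i z) v)" for z
  proof -
    define t where "t = co i z u / (- co i z v)"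
    have o: "oth i z \<in> Y i" "oth i (oth i z) = z" using oth[OF i z(1)] by auto
    have uz: "0 < co i z u" "0 < co i (oth i z) u" using u z o by (auto simp: inside_def)
    have t: "0 < t" using uz z by (simp add: t_def divide_pos_neg)
    have z0: "co i z (u + t *\<^sub>R v) = 0" using i z by (simp add: t_def)
    have o0: "0 \<le> co i (oth i z) (u + t *\<^sub>R v)"
    proof (cases "co i (oth i z) v < 0")
      case True
      have "t * (- co i (oth i z) v) \<le> (co i (oth i z) u / (- co i (oth i z) v)) * (- co i (oth i z) v)"
        using min[OF True] True by (intro mult_right_mono) (auto simp: t_def)
      then show ?thesis using True i o by simp
    next
      case False
      then show ?thesis using t uz i o by simp
    qed
    define s where "s = co i (oth i z) (u + t *\<^sub>R v)"
    have eq: "u + t *\<^sub>R v = s *\<^sub>R e i (oth i z)"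
      using co(6)[OF i z(1), of "u + t *\<^sub>R v"] z0 by (simp add: s_def)
    have "s \<noteq> 0" using eq nz[of t] by auto
    then have "0 < s" using o0 by (simp add: s_def)
    then show ?thesis using t eq o z by metis
  qed
  obtain z where z: "z \<in> Y i" "co i z v < 0" using v sector_iff_all[OF i] not_le by blast
  have o: "oth i z \<in> Y i" "oth i (oth i z) = z" using oth[OF i z(1)] by auto
  show ?thesis
  proof (cases "co i (oth i z) v < 0 \<and> co i (oth i z) u / (- co i (oth i z) v) < co i z u / (- co i z v)")
    case True
    then show ?thesis using main[of "oth i z"] o by simp
  next
    case False
    show ?thesis
    proof (rule main[OF z])
      assume "co i (oth i z) v < 0"
      then show "co i z u / (- co i z v) \<le> co i (oth i z) u / (- co i (oth i z) v)" using False by linarith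
    qed
  qed
qed

lemma entering_interior:
  assumes i: "i \<in> I" and y: "y \<in> Y i" and s: "0 < s" and v: "0 < co i (oth i y) v"
  shows "\<exists>h>0. inside i (s *\<^sub>R e i y + h *\<^sub>R v)"
proof -
  have o: "oth i y \<in> Y i" using oth(1)[OF i y] .
  define K where "K = 1 + \<bar>co i y v\<bar>"
  have K: "0 < K" "\<bar>co i y v\<bar> \<le> K" by (auto simp: K_def)
  \<comment> \<open>Small enough that the coordinate along the edge loses at most half of
    \<open>s\<close>.\<close>
  define h where "h = s / (2 * K)"
  have h: "0 < h" using s K by (simp add: h_def)
  have "h * \<bar>co i y v\<bar> \<le> h * K" using h K(2) by (intro mult_left_mono) auto
  also have "h * K = s / 2" using K(1) by (simp add: h_def)
  finally have "\<bar>h * co i y v\<bar> \<le> s / 2" using h by (simp add: abs_mult)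
  then have "0 < co i y (s *\<^sub>R e i y + h *\<^sub>R v)" using i y s by simp
  moreover have "0 < co i (oth i y) (s *\<^sub>R e i y + h *\<^sub>R v)" using i y o v h co(4)[OF i y] by simp
  ultimately show ?thesis using h inside_iff[OF i y] by blast
qed

text \<open>A transversal line meets the line spanned by the edge only once, and this happens away
  from the apex.\<close>

lemma edge_line_nonzero:
  assumes i: "i \<in> I" and y: "y \<in> Y i" and s: "0 < s" and v: "co i (oth i y) v \<noteq> 0"
    and l: "b + t *\<^sub>R v = s *\<^sub>R e i y"
  shows "b + r *\<^sub>R v \<noteq> 0"
proof
  assume z: "b + r *\<^sub>R v = 0"
  have o: "oth i y \<in> Y i" using oth(1)[OF i y] .
  have eq: "(t - r) *\<^sub>R v = s *\<^sub>R e i y"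
  proof -
    have "(t - r) *\<^sub>R v = (b + t *\<^sub>R v) - (b + r *\<^sub>R v)" by (simp add: algebra_simps)
    then show ?thesis unfolding l z by simp
  qed
  from arg_cong[OF eq, of "co i (oth i y)"] have "(t - r) * co i (oth i y) v = 0"
    using i y o co(4)[OF i y] by simp
  then have "t - r = 0" using v by simp
  then show False using eq s e_independent(1)[OF i y] by simp
qed

lemma chain_lines_nonzero:
  assumes ch: "chain \<kappa> A B k b v \<tau>" and n: "n \<in> {A..B}" and AB: "A < B"
  shows "b n + t *\<^sub>R v n \<noteq> 0"
proof (cases "A < n")
  case True
  then have "cross (k (n - 1)) (b (n - 1) + \<tau> n *\<^sub>R v (n - 1)) (v (n - 1)) (k n) (b n + \<tau> n *\<^sub>R v n) (v n)"
    using ch n by (simp add: chain_def)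
  then obtain y s where "k n \<in> I" "y \<in> Y (k n)" "0 < s" "b n + \<tau> n *\<^sub>R v n = s *\<^sub>R e (k n) y"
    "0 < co (k n) (oth (k n) y) (v n)" by (rule crossE) blast
  then show ?thesis using edge_line_nonzero by (metis less_irrefl)
next
  case False
  then have "n + 1 \<in> {A<..B}" using n AB by auto
  then have "cross (k (n + 1 - 1)) (b (n + 1 - 1) + \<tau> (n + 1) *\<^sub>R v (n + 1 - 1)) (v (n + 1 - 1))
      (k (n + 1)) (b (n + 1) + \<tau> (n + 1) *\<^sub>R v (n + 1)) (v (n + 1))"
    using ch unfolding chain_def by blast
  then obtain y s where "k n \<in> I" "y \<in> Y (k n)" "0 < s" "b n + \<tau> (n + 1) *\<^sub>R v n = s *\<^sub>R e (k n) y"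
    "co (k n) (oth (k n) y) (v n) < 0" unfolding add_diff_cancel_right' by (rule crossE) blast
  then show ?thesis using edge_line_nonzero by (metis less_irrefl)
qed

lemma chain_end_interior:
  assumes ch: "chain \<kappa> A B k b v \<tau>" and AB: "A < B"
  shows "\<exists>t. inside (k B) (b B + t *\<^sub>R v B)" "\<exists>t. inside (k A) (b A + t *\<^sub>R v A)"
proof -
  have "cross (k (B - 1)) (b (B - 1) + \<tau> B *\<^sub>R v (B - 1)) (v (B - 1)) (k B) (b B + \<tau> B *\<^sub>R v B) (v B)"
    using ch AB by (simp add: chain_def)
  then obtain y s where y: "k B \<in> I" "y \<in> Y (k B)" "0 < s" "b B + \<tau> B *\<^sub>R v B = s *\<^sub>R e (k B) y"
    "0 < co (k B) (oth (k B) y) (v B)" by (rule crossE) blast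
  obtain h where "inside (k B) (s *\<^sub>R e (k B) y + h *\<^sub>R v B)" using entering_interior[OF y(1,2,3,5)] by blast
  then have "inside (k B) (b B + (\<tau> B + h) *\<^sub>R v B)" unfolding y(4)[symmetric] by (simp add: algebra_simps)
  then show "\<exists>t. inside (k B) (b B + t *\<^sub>R v B)" by blast
  have "A + 1 \<in> {A<..B}" using AB by auto
  then have "cross (k (A + 1 - 1)) (b (A + 1 - 1) + \<tau> (A + 1) *\<^sub>R v (A + 1 - 1)) (v (A + 1 - 1))
      (k (A + 1)) (b (A + 1) + \<tau> (A + 1) *\<^sub>R v (A + 1)) (v (A + 1))"
    using ch unfolding chain_def by blast
  then obtain y s where y: "k A \<in> I" "y \<in> Y (k A)" "0 < s" "b A + \<tau> (A + 1) *\<^sub>R v A = s *\<^sub>R e (k A) y"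
    "co (k A) (oth (k A) y) (v A) < 0" unfolding add_diff_cancel_right' by (rule crossE) blast
  have "0 < co (k A) (oth (k A) y) (- v A)" using y oth(1) by simp
  then obtain h where "inside (k A) (s *\<^sub>R e (k A) y + h *\<^sub>R (- v A))" using entering_interior[OF y(1,2,3)] by blast
  then have "inside (k A) (b A + (\<tau> (A + 1) - h) *\<^sub>R v A)" unfolding y(4)[symmetric] by (simp add: algebra_simps)
  then show "\<exists>t. inside (k A) (b A + t *\<^sub>R v A)" by blast
qed

lemma chain_append:
  assumes ch: "chain \<kappa> A B k b v \<tau>" and u: "inside (k B) (b B + t0 *\<^sub>R v B)"
    and nz: "\<And>t. b B + t *\<^sub>R v B \<noteq> 0" and v: "v B \<notin> sec (k B)"
  shows "\<exists>j b' v' t. chain \<kappa> A (B + 1) (k(B + 1 := j)) (b(B + 1 := b')) (v(B + 1 := v')) (\<tau>(B + 1 := t))"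
proof -
  have kB: "k B \<in> I" "F (k B) (v B) = \<kappa>" using ch by (auto simp: chain_def)
  have "(b B + t0 *\<^sub>R v B) + t *\<^sub>R v B \<noteq> 0" for t using nz[of "t0 + t"] by (simp add: algebra_simps)
  then obtain t y s where t: "y \<in> Y (k B)" "0 < s" "(b B + t0 *\<^sub>R v B) + t *\<^sub>R v B = s *\<^sub>R e (k B) y"
    "co (k B) (oth (k B) y) (v B) < 0" using exit_edge[OF kB(1) u v] by blast
  have eq: "b B + (t0 + t) *\<^sub>R v B = s *\<^sub>R e (k B) y" using t(3) by (simp add: algebra_simps)
  obtain j u' v' where c: "cross (k B) (b B + (t0 + t) *\<^sub>R v B) (v B) j u' v'"
    using cross_exists_right[OF kB(1) t(1,2,4)] unfolding eq by blast
  have j: "j \<in> I" "F j v' = \<kappa>" using c kB unfolding cross_def by auto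
  \<comment> \<open>The base point is chosen so that the new line is at \<open>u'\<close> at the
    crossing time \<open>t0 + t\<close>.\<close>
  have "chain \<kappa> A (B + 1) (k(B + 1 := j)) (b(B + 1 := u' - (t0 + t) *\<^sub>R v')) (v(B + 1 := v')) (\<tau>(B + 1 := t0 + t))"
    unfolding chain_def
  proof (intro conjI ballI)
    fix n assume n: "n \<in> {A<..B + 1}"
    show "cross ((k(B + 1 := j)) (n - 1)) ((b(B + 1 := u' - (t0 + t) *\<^sub>R v')) (n - 1) + (\<tau>(B + 1 := t0 + t)) n *\<^sub>R (v(B + 1 := v')) (n - 1))
          ((v(B + 1 := v')) (n - 1)) ((k(B + 1 := j)) n)
          ((b(B + 1 := u' - (t0 + t) *\<^sub>R v')) n + (\<tau>(B + 1 := t0 + t)) n *\<^sub>R (v(B + 1 := v')) n) ((v(B + 1 := v')) n)"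
    proof (cases "n = B + 1")
      case True then show ?thesis using c by simp
    next
      case False
      then show ?thesis using n ch unfolding chain_def by auto
    qed
  qed (use ch j in \<open>auto simp: chain_def\<close>)
  then show ?thesis by blast
qed

lemma chain_prepend:
  assumes ch: "chain \<kappa> A B k b v \<tau>" and u: "inside (k A) (b A + t0 *\<^sub>R v A)"
    and nz: "\<And>t. b A + t *\<^sub>R v A \<noteq> 0" and v: "- v A \<notin> sec (k A)"
  shows "\<exists>j b' v' t. chain \<kappa> (A - 1) B (k(A - 1 := j)) (b(A - 1 := b')) (v(A - 1 := v')) (\<tau>(A := t))"
proof -
  have kA: "k A \<in> I" "F (k A) (v A) = \<kappa>" using ch by (auto simp: chain_def)
  have "(b A + t0 *\<^sub>R v A) + t *\<^sub>R (- v A) \<noteq> 0" for t using nz[of "t0 - t"] by (simp add: algebra_simps)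
  then obtain t y s where t: "y \<in> Y (k A)" "0 < s" "(b A + t0 *\<^sub>R v A) + t *\<^sub>R (- v A) = s *\<^sub>R e (k A) y"
    "co (k A) (oth (k A) y) (- v A) < 0" using exit_edge[OF kA(1) u v] by blast
  have eq: "b A + (t0 - t) *\<^sub>R v A = s *\<^sub>R e (k A) y" using t(3) by (simp add: algebra_simps)
  have "0 < co (k A) (oth (k A) y) (v A)" using t(4) kA oth(1) t(1) by simp
  then obtain j u' v' where c: "cross j u' v' (k A) (b A + (t0 - t) *\<^sub>R v A) (v A)"
    using cross_exists_left[OF kA(1) t(1,2)] unfolding eq by blast
  have j: "j \<in> I" "F j v' = \<kappa>" using c kA unfolding cross_def by auto
  have "chain \<kappa> (A - 1) B (k(A - 1 := j)) (b(A - 1 := u' - (t0 - t) *\<^sub>R v')) (v(A - 1 := v')) (\<tau>(A := t0 - t))"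
    unfolding chain_def
  proof (intro conjI ballI)
    fix n assume n: "n \<in> {A - 1<..B}"
    show "cross ((k(A - 1 := j)) (n - 1)) ((b(A - 1 := u' - (t0 - t) *\<^sub>R v')) (n - 1) + (\<tau>(A := t0 - t)) n *\<^sub>R (v(A - 1 := v')) (n - 1))
          ((v(A - 1 := v')) (n - 1)) ((k(A - 1 := j)) n)
          ((b(A - 1 := u' - (t0 - t) *\<^sub>R v')) n + (\<tau>(A := t0 - t)) n *\<^sub>R (v(A - 1 := v')) n) ((v(A - 1 := v')) n)"
    proof (cases "n = A")
      case True then show ?thesis using c by simp
    next
      case False
      then show ?thesis using n ch unfolding chain_def by auto
    qed
  qed (use ch j in \<open>auto simp: chain_def\<close>)
  then show ?thesis by blast
qed

text \<open>\<open>chain_bounded\<close> provides a longest chain with the given line at index 0. If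
  its last velocity, or its reversed first one, pointed out of the sector, the line would reach a
  further edge and the chain could be extended.\<close>

lemma maximal_chain:
  assumes i: "i \<in> I" and k: "0 < \<kappa>" "F i w = \<kappa>" and u: "inside i (a + t0 *\<^sub>R w)" and nz: "\<And>t. a + t *\<^sub>R w \<noteq> 0"
  obtains A B k b v \<tau> where "chain \<kappa> A B k b v \<tau>" "A \<le> 0" "0 \<le> B" "A < B" "k 0 = i" "b 0 = a" "v 0 = w"
    "v B \<in> sec (k B)" "- v A \<in> sec (k A)"
proof -
  define P where "P m \<longleftrightarrow> (\<exists>A B k b v \<tau>. chain \<kappa> A B k b v \<tau> \<and> A \<le> 0 \<and> 0 \<le> B \<and> k 0 = i \<and> b 0 = a \<and> v 0 = w \<and>
    m = nat (B - A))" for m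
  have "chain \<kappa> 0 0 (\<lambda>_. i) (\<lambda>_. a) (\<lambda>_. w) (\<lambda>_. 0)" using i k by (simp add: chain_def)
  then have "P 0" unfolding P_def
    by (intro exI[of _ 0] exI[of _ "\<lambda>_. i"] exI[of _ "\<lambda>_. a"] exI[of _ "\<lambda>_. w"] exI[of _ "\<lambda>_. 0"]) simp
  obtain N where N: "\<And>A B k b v \<tau>. chain \<kappa> A B k b v \<tau> \<Longrightarrow> nat (B - A) \<le> N" using chain_bounded[OF k(1)] by blast
  have bd: "m' \<le> N" if "P m'" for m' using that N unfolding P_def by blast
  define m where "m = Greatest P"
  have m: "P m" "\<And>m'. P m' \<Longrightarrow> m' \<le> m"
    unfolding m_def using GreatestI_nat[of P 0 N] Greatest_le_nat[of P _ N] \<open>P 0\<close> bd by auto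
  from m(1) obtain A B k' b v \<tau> where ch: "chain \<kappa> A B k' b v \<tau>" and AB: "A \<le> 0" "0 \<le> B" and init: "k' 0 = i" "b 0 = a" "v 0 = w"
    and mm: "m = nat (B - A)" unfolding P_def by blast
  have nzB: "b B + t *\<^sub>R v B \<noteq> 0" "b A + t *\<^sub>R v A \<noteq> 0" for t
  proof (atomize (full), cases "A < B")
    case True
    then show "b B + t *\<^sub>R v B \<noteq> 0 \<and> b A + t *\<^sub>R v A \<noteq> 0"
      using chain_lines_nonzero[OF ch _ True, of B t] chain_lines_nonzero[OF ch _ True, of A t] by simp
  next
    case False
    then have "A = 0" "B = 0" using AB by auto
    then show "b B + t *\<^sub>R v B \<noteq> 0 \<and> b A + t *\<^sub>R v A \<noteq> 0" using nz init by simp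
  qed
  have inB: "\<exists>t. inside (k' B) (b B + t *\<^sub>R v B)" "\<exists>t. inside (k' A) (b A + t *\<^sub>R v A)"
  proof -
    show "\<exists>t. inside (k' B) (b B + t *\<^sub>R v B)"
    proof (cases "A < B")
      case False then have "B = 0" using AB by simp
      then show ?thesis using u init by auto
    qed (rule chain_end_interior(1)[OF ch])
    show "\<exists>t. inside (k' A) (b A + t *\<^sub>R v A)"
    proof (cases "A < B")
      case False then have "A = 0" using AB by simp
      then show ?thesis using u init by auto
    qed (rule chain_end_interior(2)[OF ch])
  qed
  have vB: "v B \<in> sec (k' B)"
  proof (rule ccontr)
    assume n: "\<not> ?thesis"
    obtain t where "inside (k' B) (b B + t *\<^sub>R v B)" using inB by blast
    from chain_append[OF ch this nzB(1) n] obtain j b' v' t' where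
      "chain \<kappa> A (B + 1) (k'(B + 1 := j)) (b(B + 1 := b')) (v(B + 1 := v')) (\<tau>(B + 1 := t'))" by blast
    then have "P (nat (B + 1 - A))"
      unfolding P_def using AB init
      by (intro exI[of _ A] exI[of _ "B + 1"] exI[of _ "k'(B + 1 := j)"] exI[of _ "b(B + 1 := b')"] exI[of _ "v(B + 1 := v')"]
          exI[of _ "\<tau>(B + 1 := t')"]) simp
    then show False using m(2) mm AB by fastforce
  qed
  have vA: "- v A \<in> sec (k' A)"
  proof (rule ccontr)
    assume n: "\<not> ?thesis"
    obtain t where "inside (k' A) (b A + t *\<^sub>R v A)" using inB by blast
    from chain_prepend[OF ch this nzB(2) n] obtain j b' v' t' where
      "chain \<kappa> (A - 1) B (k'(A - 1 := j)) (b(A - 1 := b')) (v(A - 1 := v')) (\<tau>(A := t'))" by blast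
    then have "P (nat (B - (A - 1)))"
      unfolding P_def using AB init
      by (intro exI[of _ "A - 1"] exI[of _ B] exI[of _ "k'(A - 1 := j)"] exI[of _ "b(A - 1 := b')"] exI[of _ "v(A - 1 := v')"]
          exI[of _ "\<tau>(A := t')"]) simp
    then show False using m(2) mm AB by fastforce
  qed
  \<comment> \<open>A chain with a single line would have both \<open>w\<close> and
    \<open>- w\<close> in a sector, which contains no line.\<close>
  have "A < B"
  proof (rule ccontr)
    assume "\<not> A < B"
    then have "A = 0" "B = 0" using AB by auto
    then have ws: "w \<in> sec i" "- w \<in> sec i" using vA vB init by auto
    obtain y where y: "y \<in> Y i" using Y_nonempty[OF i] by blast
    have "co i y w = 0" "co i (oth i y) w = 0"
      using ws oth(1)[OF i y] i y unfolding sector_iff[OF i y] by simp_all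
    then have "w = 0" using co(6)[OF i y, of w] by simp
    moreover have "F i 0 = 0" using scgauge.zero[OF gaugeI[OF i]] .
    ultimately show False using k by simp
  qed
  then show ?thesis using that ch AB init vA vB by blast
qed

end

section \<open>The geodesic through a maximal chain\<close>

context pf_vertex begin

text \<open>Points inside a cone lie on no boundary ray, so the gluing identifies them with nothing
  else.\<close>

lemma pt_interior_eq:
  assumes "i \<in> I" "j \<in> I" "w \<in> sec i" "inside j u" "pnt i w = pnt j u"
  shows "i = j \<and> w = u"
proof -
  obtain y0 where y0: "y0 \<in> Y j" using Y_nonempty[OF assms(2)] by blast
  have "u \<noteq> 0" using assms(2,4) y0 by (auto simp: inside_def)
  moreover have "\<not> (\<exists>y\<in>Y i \<inter> Y j. \<exists>s>0. w = s *\<^sub>R e i y \<and> u = s *\<^sub>R e j y)"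
  proof
    assume "\<exists>y\<in>Y i \<inter> Y j. \<exists>s>0. w = s *\<^sub>R e i y \<and> u = s *\<^sub>R e j y"
    then obtain y s where y: "y \<in> Y j" "u = s *\<^sub>R e j y" by blast
    then have "co j (oth j y) u = 0" using assms(2) oth(1) co(4)[OF assms(2) y(1)] by simp
    then show False using assms(2,4) y oth(1) unfolding inside_def by force
  qed
  ultimately show ?thesis using pt_eq_iff[OF assms(1,2,3) inside_sector[OF assms(2,4)]] assms(5) by blast
qed

lemma cross_not_interior: "cross i u v j u' v' \<Longrightarrow> \<not> inside i u \<and> \<not> inside j u'"
proof (erule crossE)
  fix y s
  assume h: "i \<in> I" "j \<in> I" "y \<in> Y i" "y \<in> Y j" "u = s *\<^sub>R e i y" "u' = s *\<^sub>R e j y"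
  then have "co i (oth i y) u = 0" "co j (oth j y) u' = 0" using oth(1) by simp_all
  then show ?thesis using h oth(1) unfolding inside_def by force
qed

text \<open>The subdivision clause of \<open>piecewise_smooth\<close>, isolated because it is
  additive over adjacent intervals and can therefore be proved by bisection.\<close>

definition subdivided :: "(real \<Rightarrow> ('i \<times> (real^2)) set) \<Rightarrow> real \<Rightarrow> real \<Rightarrow> bool" where
  "subdivided c a b \<longleftrightarrow> (\<exists>(n::nat) \<tau>. \<tau> 0 = a \<and> \<tau> n = b \<and> (\<forall>l<n. \<tau> l < \<tau> (Suc l) \<and>
     (\<exists>i\<in>I. (\<forall>t\<in>{\<tau> l..\<tau> (Suc l)}. c t \<in> mc i) \<and> smooth_curve_on (\<tau> l) (\<tau> (Suc l)) (\<lambda>t. coord i (c t)))))"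

lemma subdivided_trans:
  assumes "subdivided c p q" "subdivided c q r"
  shows "subdivided c p r"
proof -
  obtain n \<tau> where 1: "\<tau> 0 = p" "\<tau> (n::nat) = q" "\<And>l. l < n \<Longrightarrow> \<tau> l < \<tau> (Suc l) \<and>
     (\<exists>i\<in>I. (\<forall>t\<in>{\<tau> l..\<tau> (Suc l)}. c t \<in> mc i) \<and> smooth_curve_on (\<tau> l) (\<tau> (Suc l)) (\<lambda>t. coord i (c t)))"
    using assms(1) unfolding subdivided_def by blast
  obtain m \<sigma> where 2: "\<sigma> 0 = q" "\<sigma> (m::nat) = r" "\<And>l. l < m \<Longrightarrow> \<sigma> l < \<sigma> (Suc l) \<and>
     (\<exists>i\<in>I. (\<forall>t\<in>{\<sigma> l..\<sigma> (Suc l)}. c t \<in> mc i) \<and> smooth_curve_on (\<sigma> l) (\<sigma> (Suc l)) (\<lambda>t. coord i (c t)))"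
    using assms(2) unfolding subdivided_def by blast
  define \<rho> where "\<rho> l = (if l \<le> n then \<tau> l else \<sigma> (l - n))" for l
  have "\<rho> l < \<rho> (Suc l) \<and>
     (\<exists>i\<in>I. (\<forall>t\<in>{\<rho> l..\<rho> (Suc l)}. c t \<in> mc i) \<and> smooth_curve_on (\<rho> l) (\<rho> (Suc l)) (\<lambda>t. coord i (c t)))"
    if l: "l < n + m" for l
  proof (cases "l < n")
    case True
    then have "\<rho> l = \<tau> l" "\<rho> (Suc l) = \<tau> (Suc l)" by (auto simp: \<rho>_def)
    then show ?thesis using 1(3)[OF True] by simp
  next
    case False
    then have "\<rho> l = \<sigma> (l - n)" "\<rho> (Suc l) = \<sigma> (Suc (l - n))"
      using 1(2) 2(1) by (auto simp: \<rho>_def Suc_diff_le)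
    moreover have "l - n < m" using l False by simp
    ultimately show ?thesis using 2(3)[of "l - n"] by simp
  qed
  moreover have "\<rho> 0 = p" using 1(1) by (simp add: \<rho>_def)
  moreover have "\<rho> (n + m) = r" using 1(2) 2(1,2) by (cases m) (auto simp: \<rho>_def)
  ultimately show ?thesis unfolding subdivided_def by blast
qed

lemma subdivided_straight:
  assumes "straight c s t i (\<lambda>r. u + (r - q) *\<^sub>R w)" "s \<le> p" "p \<le> p'" "p' \<le> t"
  shows "subdivided c p p'"
proof (cases "p = p'")
  case True
  then show ?thesis unfolding subdivided_def by (intro exI[of _ "0::nat"] exI[of _ "\<lambda>_. p"]) simp
next
  case False
  have st: "straight c p p' i (\<lambda>r. u + (r - q) *\<^sub>R w)" using assms by (auto simp: straight_def)
  have "smooth_curve_on p p' (\<lambda>r. coord i (c r))" using straight_smooth[OF st] .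
  moreover have "\<forall>t\<in>{p..p'}. c t \<in> mc i" "i \<in> I" using straight_coord[OF st] st by (auto simp: straight_def)
  ultimately have "smooth_curve_on p p' (\<lambda>r. coord i (c r))" "\<forall>t\<in>{p..p'}. c t \<in> mc i" "i \<in> I" by blast+
  then show ?thesis using False assms(3) unfolding subdivided_def
    by (intro exI[of _ "1::nat"] exI[of _ "\<lambda>l::nat. if l = 0 then p else p'"]) auto
qed

end

text \<open>By the two end conditions the first line stays in its cone for all earlier times and the
  last one for all later times; the pieces thus cover the whole time axis.\<close>

locale full_chain = pf_vertex M x for M :: "('a, 'i) pf_surface" and x :: 'a +
  fixes \<kappa> :: real and lo hi :: int and cn :: "int \<Rightarrow> 'i" and ba ve :: "int \<Rightarrow> real^2" and \<tau> :: "int \<Rightarrow> real"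
  assumes ch: "chain \<kappa> lo hi cn ba ve \<tau>" and lohi: "lo < hi" and kappa: "0 < \<kappa>"
    and last: "ve hi \<in> sector M x (cn hi)" and first: "- ve lo \<in> sector M x (cn lo)"
begin

definition line :: "int \<Rightarrow> real \<Rightarrow> real^2" where "line n t = ba n + t *\<^sub>R ve n"

lemma line_shift: "line n t = line n r + (t - r) *\<^sub>R ve n"
  by (simp add: line_def algebra_simps)

lemma cn: "lo \<le> n \<Longrightarrow> n \<le> hi \<Longrightarrow> cn n \<in> I" and speed: "lo \<le> n \<Longrightarrow> n \<le> hi \<Longrightarrow> F (cn n) (ve n) = \<kappa>"
  using ch by (auto simp: chain_def)

lemma crossing:
  "lo < n \<Longrightarrow> n \<le> hi \<Longrightarrow> cross (cn (n - 1)) (line (n - 1) (\<tau> n)) (ve (n - 1)) (cn n) (line n (\<tau> n)) (ve n)"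
  using ch by (simp add: chain_def line_def)

lemma entry:
  assumes "lo < n" "n \<le> hi"
  obtains y s where "y \<in> Y (cn n)" "0 < s" "line n (\<tau> n) = s *\<^sub>R e (cn n) y" "0 < co (cn n) (oth (cn n) y) (ve n)"
  using crossing[OF assms] by (rule crossE) (rule that)

lemma exit:
  assumes "lo \<le> n" "n < hi"
  obtains y s where "y \<in> Y (cn n)" "0 < s" "line n (\<tau> (n + 1)) = s *\<^sub>R e (cn n) y" "co (cn n) (oth (cn n) y) (ve n) < 0"
proof -
  have "cross (cn n) (line n (\<tau> (n + 1))) (ve n) (cn (n + 1)) (line (n + 1) (\<tau> (n + 1))) (ve (n + 1))"
    using crossing[of "n + 1"] assms by simp
  then show ?thesis by (rule crossE) (rule that)
qed

lemma passage:
  assumes n: "lo < n" "n < hi"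
  obtains y s s' where "y \<in> Y (cn n)" "0 < s" "line n (\<tau> n) = s *\<^sub>R e (cn n) y" "0 < co (cn n) (oth (cn n) y) (ve n)"
    "0 < s'" "line n (\<tau> (n + 1)) = s' *\<^sub>R e (cn n) (oth (cn n) y)" "co (cn n) y (ve n) < 0" "\<tau> n < \<tau> (n + 1)"
proof -
  have n': "lo \<le> n" "n \<le> hi" using n by auto
  obtain y s where y: "y \<in> Y (cn n)" "0 < s" "line n (\<tau> n) = s *\<^sub>R e (cn n) y" "0 < co (cn n) (oth (cn n) y) (ve n)"
    by (rule entry[OF n(1) n'(2)])
  obtain y' s' where y': "y' \<in> Y (cn n)" "0 < s'" "line n (\<tau> (n + 1)) = s' *\<^sub>R e (cn n) y'" "co (cn n) (oth (cn n) y') (ve n) < 0"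
    by (rule exit[OF n'(1) n(2)])
  have "y' = oth (cn n) y" "\<tau> n < \<tau> (n + 1)"
    using edge_to_edge[OF cn[OF n'] y(1) y'(1) y(3)[unfolded line_def] y'(3)[unfolded line_def] y(2) y'(2) y(4) y'(4)] by auto
  then show ?thesis using that[OF y y'(2)] y' oth(4)[OF cn[OF n'] y(1)] by simp
qed

lemma tau_less:
  assumes "lo < m" "m < n" "n \<le> hi"
  shows "\<tau> m < \<tau> n"
proof -
  have "m + 1 \<le> n" using assms by simp
  then show ?thesis using assms(3)
  proof (induction n rule: int_ge_induct)
    case base
    then show ?case using passage[of m] assms(1) by auto
  next
    case (step n)
    have "\<tau> n < \<tau> (n + 1)" using passage[of n] assms(1) step by auto
    then show ?case using step by simp
  qed
qed

text \<open>\<open>\<tau>\<close> has a meaning only at crossings, that is from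
  \<open>lo + 1\<close> to \<open>hi\<close>, so the first and the last piece get half-infinite time
  intervals.\<close>

definition dom :: "int \<Rightarrow> real \<Rightarrow> bool" where
  "dom n t \<longleftrightarrow> lo \<le> n \<and> n \<le> hi \<and> (lo < n \<longrightarrow> \<tau> n \<le> t) \<and> (n < hi \<longrightarrow> t \<le> \<tau> (n + 1))"

definition sdom :: "int \<Rightarrow> real \<Rightarrow> bool" where
  "sdom n t \<longleftrightarrow> lo \<le> n \<and> n \<le> hi \<and> (lo < n \<longrightarrow> \<tau> n < t) \<and> (n < hi \<longrightarrow> t < \<tau> (n + 1))"

lemma dom_cases:
  assumes "dom n t"
  obtains "sdom n t" | "lo < n" "t = \<tau> n" | "n < hi" "t = \<tau> (n + 1)"
  using assms unfolding dom_def sdom_def by linarith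

lemma dom_between: "dom n s \<Longrightarrow> dom n t \<Longrightarrow> s \<le> r \<Longrightarrow> r \<le> t \<Longrightarrow> dom n r"
  unfolding dom_def by auto

lemma sdom_between: "dom n s \<Longrightarrow> dom n t \<Longrightarrow> s < r \<Longrightarrow> r < t \<Longrightarrow> sdom n r"
  unfolding dom_def sdom_def by auto

lemma sdom_dom: "sdom n t \<Longrightarrow> dom n t"
  unfolding dom_def sdom_def by auto

lemma dom_cn: "dom n t \<Longrightarrow> cn n \<in> I"
  using cn by (simp add: dom_def)

text \<open>On a middle piece one coordinate vanishes at entry and grows, while the other decreases
  to 0 at exit. On an end piece the coordinate along the crossed edge is positive at the crossing
  and, as the outward velocity is in the sector, does not decrease away from it.\<close>

lemma sdom_interior:
  assumes d: "sdom n t"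
  shows "inside (cn n) (line n t)"
proof -
  have n: "lo \<le> n" "n \<le> hi" using d by (auto simp: sdom_def)
  note i = cn[OF n]
  have cl: "co (cn n) z (line n t) = co (cn n) z (line n r) + (t - r) * co (cn n) z (ve n)" if "z \<in> Y (cn n)" for z r
    unfolding line_shift[of n t r] using i that by simp
  show ?thesis
  proof (cases "lo < n")
    case lt: True
    show ?thesis
    proof (cases "n < hi")
      case True
      obtain y s s' where p: "y \<in> Y (cn n)" "0 < s" "line n (\<tau> n) = s *\<^sub>R e (cn n) y" "0 < co (cn n) (oth (cn n) y) (ve n)"
        "0 < s'" "line n (\<tau> (n + 1)) = s' *\<^sub>R e (cn n) (oth (cn n) y)" "co (cn n) y (ve n) < 0" "\<tau> n < \<tau> (n + 1)"
        by (rule passage[OF lt True])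
      have "0 < (t - \<tau> n) * co (cn n) (oth (cn n) y) (ve n)" using d lt p by (simp add: sdom_def)
      moreover have "0 < (t - \<tau> (n + 1)) * co (cn n) y (ve n)" using d True p by (simp add: sdom_def mult_neg_neg)
      ultimately show ?thesis
        using cl[OF oth(1)[OF i p(1)], of "\<tau> n"] cl[OF p(1), of "\<tau> (n + 1)"] co(4)[OF i p(1)] i p oth(1)[OF i p(1)]
        unfolding inside_iff[OF i p(1)] by simp
    next
      case False
      then have nh: "n = hi" using n by simp
      obtain y s where p: "y \<in> Y (cn n)" "0 < s" "line n (\<tau> n) = s *\<^sub>R e (cn n) y" "0 < co (cn n) (oth (cn n) y) (ve n)"
        by (rule entry[OF lt n(2)])
      have "0 < (t - \<tau> n) * co (cn n) (oth (cn n) y) (ve n)" using d lt p by (simp add: sdom_def)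
      moreover have "0 \<le> (t - \<tau> n) * co (cn n) y (ve n)"
        using d lt last nh p(1) sector_iff[OF i p(1)] by (simp add: sdom_def)
      ultimately show ?thesis
        using cl[OF oth(1)[OF i p(1)], of "\<tau> n"] cl[OF p(1), of "\<tau> n"] co(4)[OF i p(1)] i p oth(1)[OF i p(1)]
        unfolding inside_iff[OF i p(1)] by simp
    qed
  next
    case False
    then have nl: "n = lo" "n < hi" using n lohi by auto
    obtain y s where p: "y \<in> Y (cn n)" "0 < s" "line n (\<tau> (n + 1)) = s *\<^sub>R e (cn n) y" "co (cn n) (oth (cn n) y) (ve n) < 0"
      by (rule exit[OF n(1) nl(2)])
    have t: "t < \<tau> (n + 1)" using d nl by (simp add: sdom_def)
    then have "0 < (t - \<tau> (n + 1)) * co (cn n) (oth (cn n) y) (ve n)" using p by (simp add: mult_neg_neg)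
    moreover have "co (cn n) y (ve n) \<le> 0" using first nl(1) p(1) i sector_iff[OF i p(1)] by simp
    then have "0 \<le> (t - \<tau> (n + 1)) * co (cn n) y (ve n)" using t by (simp add: mult_nonpos_nonpos)
    ultimately show ?thesis
      using cl[OF oth(1)[OF i p(1)], of "\<tau> (n + 1)"] cl[OF p(1), of "\<tau> (n + 1)"] co(4)[OF i p(1)] i p oth(1)[OF i p(1)]
      unfolding inside_iff[OF i p(1)] by simp
  qed
qed

lemma dom_sector:
  assumes d: "dom n t"
  shows "line n t \<in> sec (cn n)"
  using d
proof (cases rule: dom_cases)
  case 1
  then show ?thesis using inside_sector[OF dom_cn[OF d]] sdom_interior by blast
next
  case 2
  then obtain y s where "y \<in> Y (cn n)" "0 < s" "line n (\<tau> n) = s *\<^sub>R e (cn n) y"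
    using entry[of n] d unfolding dom_def by metis
  then show ?thesis using 2 sector_edge[OF dom_cn[OF d]] by simp
next
  case 3
  then obtain y s where "y \<in> Y (cn n)" "0 < s" "line n (\<tau> (n + 1)) = s *\<^sub>R e (cn n) y"
    using exit[of n] d unfolding dom_def by metis
  then show ?thesis using 3 sector_edge[OF dom_cn[OF d]] by simp
qed

lemma dom_exists: "\<exists>n. dom n t"
proof -
  define S where "S = {n \<in> {lo..hi}. n = lo \<or> \<tau> n \<le> t}"
  have S: "finite S" "lo \<in> S"
  proof -
    show "finite S" by (rule finite_subset[of _ "{lo..hi}"]) (auto simp: S_def)
    show "lo \<in> S" using lohi by (simp add: S_def)
  qed
  define n where "n = Max S"
  have n: "n \<in> S" unfolding n_def using S by (intro Max_in) auto
  have "n + 1 \<notin> S"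
  proof
    assume "n + 1 \<in> S"
    then have "n + 1 \<le> n" unfolding n_def using S(1) by (rule Max_ge[rotated])
    then show False by simp
  qed
  then have "dom n t" using n by (auto simp: S_def dom_def)
  then show ?thesis by blast
qed

text \<open>The crossing times increase strictly, so pieces that are further apart have disjoint
  time intervals.\<close>

lemma dom_adjacent:
  assumes "dom m t" "dom n t" "m < n"
  shows "n = m + 1" "t = \<tau> n"
proof -
  have h: "t \<le> \<tau> (m + 1)" "\<tau> n \<le> t" "lo < m + 1" "n \<le> hi" using assms by (auto simp: dom_def)
  show "n = m + 1"
  proof (rule ccontr)
    assume "n \<noteq> m + 1"
    then have "\<tau> (m + 1) < \<tau> n" using tau_less[of "m + 1" n] h assms(3) by simp
    then show False using h by simp
  qed
  then show "t = \<tau> n" using h by simp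
qed

text \<open>A choice of \<open>n\<close> arises only at a crossing time, where the two adjacent
  lines describe the same point of the glued cone; see \<open>curve_eq\<close>.\<close>

definition curve :: "real \<Rightarrow> ('i \<times> (real^2)) set" where
  "curve t = (let n = SOME n. dom n t in pnt (cn n) (line n t))"

lemma crossing_point:
  assumes "lo < n" "n \<le> hi"
  shows "pnt (cn (n - 1)) (line (n - 1) (\<tau> n)) = pnt (cn n) (line n (\<tau> n))"
proof -
  from crossing[OF assms] obtain y s where "cn (n - 1) \<in> I" "cn n \<in> I" "y \<in> Y (cn (n - 1))" "y \<in> Y (cn n)" "0 < s"
    and l: "line (n - 1) (\<tau> n) = s *\<^sub>R e (cn (n - 1)) y" "line n (\<tau> n) = s *\<^sub>R e (cn n) y" by (rule crossE) blast
  then show ?thesis unfolding l by (intro pt_edge) simp_all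
qed

lemma curve_eq:
  assumes d: "dom n t"
  shows "curve t = pnt (cn n) (line n t)"
proof -
  define m where "m = (SOME n. dom n t)"
  have m: "dom m t" unfolding m_def using d by (rule someI)
  have c: "curve t = pnt (cn m) (line m t)" by (simp add: curve_def m_def Let_def)
  consider "m = n" | "m < n" | "n < m" by linarith
  then show ?thesis
  proof cases
    case 2
    then have "n = m + 1" "t = \<tau> n" using dom_adjacent[OF m d] by auto
    then show ?thesis using c crossing_point[of n] m d 2 by (auto simp: dom_def)
  next
    case 3
    then have "m = n + 1" "t = \<tau> m" using dom_adjacent[OF d m] by auto
    then show ?thesis using c crossing_point[of m] m d 3 by (auto simp: dom_def)
  qed (use c in simp)
qed

lemma curve_straight:
  assumes "dom n s" "dom n t"
  shows "straight curve s t (cn n) (\<lambda>r. line n q + (r - q) *\<^sub>R ve n)"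
  unfolding straight_def line_shift[symmetric]
proof (intro conjI ballI)
  show "cn n \<in> I" by (rule dom_cn[OF assms(1)])
  fix r assume "r \<in> {s..t}"
  then have d: "dom n r" using dom_between[OF assms] by simp
  show "line n r \<in> sec (cn n)" "curve r = pnt (cn n) (line n r)" using dom_sector[OF d] curve_eq[OF d] by auto
qed

lemma right_room:
  assumes "lo \<le> n" "n \<le> hi" "n < hi \<Longrightarrow> t < \<tau> (n + 1)" "lo < n \<Longrightarrow> \<tau> n \<le> t"
  shows "\<exists>a>0. dom n (t + a)"
proof -
  define a where "a = (if n < hi then \<tau> (n + 1) - t else 1)"
  have a: "0 < a" using assms(3) by (simp add: a_def)
  have "\<tau> n \<le> t + a" if "lo < n" using assms(4)[OF that] a by linarith
  then have "dom n (t + a)" using assms(1,2) unfolding dom_def by (auto simp: a_def)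
  then show ?thesis using a by blast
qed

lemma left_room:
  assumes "lo \<le> n" "n \<le> hi" "n < hi \<Longrightarrow> t \<le> \<tau> (n + 1)" "lo < n \<Longrightarrow> \<tau> n < t"
  shows "\<exists>a>0. dom n (t - a)"
proof -
  define a where "a = (if lo < n then t - \<tau> n else 1)"
  have a: "0 < a" using assms(4) by (simp add: a_def)
  have "t - a \<le> \<tau> (n + 1)" if "n < hi" using assms(3)[OF that] a by linarith
  then have "dom n (t - a)" using assms(1,2) unfolding dom_def by (auto simp: a_def)
  then show ?thesis using a by blast
qed

lemma local_form:
  obtains (inner) n a where "0 < a" "sdom n t" "dom n (t - a)" "dom n t" "dom n (t + a)"
  | (corner) n a where "0 < a" "lo < n" "n \<le> hi" "t = \<tau> n" "dom (n - 1) (t - a)" "dom (n - 1) t" "dom n t" "dom n (t + a)"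
proof -
  have shrink: "\<exists>c>0. dom m (t - c) \<and> dom n (t + c)" if h: "dom m t" "dom n t" "0 < a" "0 < b" "dom m (t - a)" "dom n (t + b)" for m n a b
  proof (intro exI[of _ "min a b"] conjI)
    show "dom m (t - min a b)" using dom_between[OF h(5,1)] h(3,4) by simp
    show "dom n (t + min a b)" using dom_between[OF h(2,6)] h(3,4) by simp
  qed (use h in simp)
  have cross_case: thesis if n: "lo < n" "n \<le> hi" "t = \<tau> n" for n
  proof -
    have d: "dom (n - 1) t" "dom n t"
      using n tau_less[of "n - 1" n] tau_less[of n "n + 1"] by (auto simp: dom_def)
    obtain a where a: "0 < a" "dom n (t + a)"
      using right_room[of n t] n tau_less[of n "n + 1"] by auto
    obtain b where b: "0 < b" "dom (n - 1) (t - b)"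
      using left_room[of "n - 1" t] n tau_less[of "n - 1" n] by auto
    obtain c where "0 < c" "dom (n - 1) (t - c)" "dom n (t + c)" using shrink[OF d b(1) a(1) b(2) a(2)] by blast
    then show thesis using corner n d by blast
  qed
  obtain n where n: "dom n t" using dom_exists by blast
  then show thesis
  proof (cases rule: dom_cases)
    case 1
    then obtain a b where "0 < a" "dom n (t - a)" "0 < b" "dom n (t + b)"
      using left_room[of n t] right_room[of n t] unfolding sdom_def by (metis less_imp_le)
    then obtain c where "0 < c" "dom n (t - c)" "dom n (t + c)" using shrink[OF n n] by blast
    then show thesis using inner 1 n by blast
  next
    case 2
    then show thesis using cross_case n by (auto simp: dom_def)
  next
    case 3
    then show thesis using cross_case[of "n + 1"] n by (auto simp: dom_def)
  qed
qed

lemma curve_outgoing: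
  assumes "dom n t" "dom n (t + a)" "0 < a"
  shows "outgoing M x UNIV curve t (cn n) (ve n)"
  using piece_outgoing[OF straight_piece[OF curve_straight[OF assms(1,2)]]] assms(3) by simp

lemma curve_incoming:
  assumes "dom n (t - a)" "dom n t" "0 < a"
  shows "incoming M x UNIV curve t (cn n) (ve n)"
  using piece_incoming[OF straight_piece[OF curve_straight[OF assms(1,2)]]] assms(3) by simp

lemma curve_right: "\<exists>n a. 0 < a \<and> dom n t \<and> dom n (t + a)"
  by (rule local_form[of t]) blast+

lemma curve_left: "\<exists>n a. 0 < a \<and> dom n t \<and> dom n (t - a)"
  by (rule local_form[of t]) blast+

lemma curve_speed:
  assumes "outgoing M x UNIV curve t i w \<or> incoming M x UNIV curve t i w"
  shows "F i w = \<kappa>"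
  using assms
proof
  assume o: "outgoing M x UNIV curve t i w"
  obtain n a where n: "0 < a" "dom n t" "dom n (t + a)" using curve_right by blast
  then have "F i w = F (cn n) (ve n)" using outgoing_norm_unique[OF o curve_outgoing[OF n(2,3,1)]] by simp
  then show ?thesis using speed n by (simp add: dom_def)
next
  assume o: "incoming M x UNIV curve t i w"
  obtain n a where n: "0 < a" "dom n t" "dom n (t - a)" using curve_left by blast
  then have "F i w = F (cn n) (ve n)" using incoming_norm_unique[OF o curve_incoming[OF n(3,2,1)]] by simp
  then show ?thesis using speed n by (simp add: dom_def)
qed

lemma curve_subdivided:
  assumes "p \<le> q"
  shows "subdivided curve p q"
  using assms
\<comment> \<open>Bisection reduces the claim to short intervals around a time \<open>t\<close>, on
  each side of which the curve is straight.\<close>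
proof (rule Bolzano)
  show "subdivided curve p r" if "subdivided curve p q" "subdivided curve q r" for p q r
    using subdivided_trans that by blast
  fix t
  obtain n a where n: "0 < a" "dom n t" "dom n (t + a)" using curve_right by blast
  obtain m c where m: "0 < c" "dom m t" "dom m (t - c)" using curve_left by blast
  show "\<exists>d>0. \<forall>a b. a \<le> t \<and> t \<le> b \<and> b - a < d \<longrightarrow> subdivided curve a b"
  proof (intro exI[of _ "min a c"] conjI allI impI)
    fix p q assume h: "p \<le> t \<and> t \<le> q \<and> q - p < min a c"
    have "subdivided curve p t"
      by (rule subdivided_straight[OF curve_straight[OF m(3,2), of 0]]) (use h in auto)
    moreover have "subdivided curve t q"
      by (rule subdivided_straight[OF curve_straight[OF n(2,3), of 0]]) (use h in auto)
    ultimately show "subdivided curve p q" by (rule subdivided_trans)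
  qed (use n m in simp)
qed

lemma curve_piecewise_smooth: "piecewise_smooth M x UNIV curve"
  unfolding piecewise_smooth_def
proof (intro conjI ballI allI impI)
  fix t
  obtain n where "dom n t" using dom_exists by blast
  then show "curve t \<in> tcone M x" using curve_eq dom_cn dom_sector tcone_iff by blast
next
  fix a b :: real assume "a < b"
  then show "\<exists>(n::nat) \<tau>. \<tau> 0 = a \<and> \<tau> n = b \<and> (\<forall>l<n. \<tau> l < \<tau> (Suc l) \<and>
     (\<exists>i\<in>I. (\<forall>t\<in>{\<tau> l..\<tau> (Suc l)}. curve t \<in> mc i) \<and> smooth_curve_on (\<tau> l) (\<tau> (Suc l)) (\<lambda>t. coord i (curve t))))"
    using curve_subdivided[of a b] unfolding subdivided_def by simp
qed

lemma curve_minimal: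
  "\<exists>\<epsilon>>0. \<forall>t1 t2. \<bar>t1 - t\<bar> < \<epsilon> \<and> \<bar>t2 - t\<bar> < \<epsilon> \<and> t1 < t2 \<and> piecewise_smooth M x {t1..t2} curve \<longrightarrow>
    \<kappa> * (t2 - t1) \<le> tdist M x (curve t1) (curve t2)"
proof (cases rule: local_form[of t])
  case (inner n a)
  show ?thesis
    by (rule minimal_at_interior[OF dom_cn[OF inner(4)] _ _ kappa inner(1) curve_straight[OF inner(3,5)]])
      (use sdom_interior[OF inner(2)] speed inner(4) in \<open>auto simp: inside_def dom_def\<close>)
next
  case (corner n a)
  have c: "cross (cn (n - 1)) (line (n - 1) t) (ve (n - 1)) (cn n) (line n t) (ve n)"
    using crossing[OF corner(2,3)] corner(4) by simp
  show ?thesis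
    by (rule minimal_at_cross[OF c _ kappa corner(1) curve_straight[OF corner(5,6)] curve_straight[OF corner(7,8)]])
      (use speed[of "n - 1"] corner in simp)
qed

lemma curve_geo: "geo \<kappa> UNIV curve"
  unfolding geo_def
proof (intro conjI ballI allI impI)
  show "is_interval (UNIV :: real set)" by simp
  show "piecewise_smooth M x UNIV curve" by (rule curve_piecewise_smooth)
  show "0 < \<kappa>" by (rule kappa)
  show "F i v = \<kappa>" if "outgoing M x UNIV curve t i v \<or> incoming M x UNIV curve t i v" for t i v
    using curve_speed that by blast
  fix t
  obtain \<epsilon> where e: "0 < \<epsilon>" "\<And>t1 t2. \<bar>t1 - t\<bar> < \<epsilon> \<and> \<bar>t2 - t\<bar> < \<epsilon> \<and> t1 < t2 \<and> piecewise_smooth M x {t1..t2} curve \<Longrightarrow>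
    \<kappa> * (t2 - t1) \<le> tdist M x (curve t1) (curve t2)" using curve_minimal[of t] by blast
  show "\<exists>\<epsilon>>0. \<forall>t1\<in>UNIV. \<forall>t2\<in>UNIV. t1 < t2 \<and> \<bar>t1 - t\<bar> < \<epsilon> \<and> \<bar>t2 - t\<bar> < \<epsilon> \<longrightarrow>
      tdist M x (curve t1) (curve t2) = \<kappa> * (t2 - t1)"
  proof (intro exI[of _ \<epsilon>] conjI ballI impI antisym)
    fix t1 t2 assume h: "t1 < t2 \<and> \<bar>t1 - t\<bar> < \<epsilon> \<and> \<bar>t2 - t\<bar> < \<epsilon>"
    have ps: "piecewise_smooth M x {t1..t2} curve"
      by (rule piecewise_smooth_subset[OF curve_piecewise_smooth]) simp
    show "\<kappa> * (t2 - t1) \<le> tdist M x (curve t1) (curve t2)" using e(2) h ps by blast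
    have "curve_length M x t1 t2 curve = \<kappa> * (t2 - t1)"
      by (rule constant_speed_length[OF _ curve_piecewise_smooth]) (use curve_speed h in auto)
    then show "tdist M x (curve t1) (curve t2) \<le> \<kappa> * (t2 - t1)" using tdist_le[OF ps] h by simp
  qed (use e in simp)
qed

end

section \<open>A straight initial segment of the given geodesic\<close>

context pf_vertex begin

lemma straight_restrict: "straight c s t i l \<Longrightarrow> s \<le> s' \<Longrightarrow> t' \<le> t \<Longrightarrow> straight c s' t' i l"
  by (simp add: straight_def)

lemma straight_transfer: "straight c s t i l \<Longrightarrow> (\<And>r. r \<in> {s..t} \<Longrightarrow> c' r = c r) \<Longrightarrow> straight c' s t i l"
  by (simp add: straight_def)

text \<open>The initial velocity may be given in the coordinates of another cone than the one in which the
  curve is a straight segment; then it would be tangent to an edge.\<close>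

lemma one_sided_velocity:
  assumes ij: "i \<in> I" "j \<in> I" and A: "at t within A \<noteq> bot" "t \<in> A"
    and c: "\<And>s. s \<in> A \<Longrightarrow> c s \<in> mc i" "\<And>s. s \<in> A \<Longrightarrow> c s \<in> mc j"
    and l: "\<And>s. s \<in> A \<Longrightarrow> coord j (c s) = u + (s - t) *\<^sub>R w"
    and v: "((\<lambda>s. coord i (c s)) has_vector_derivative v) (at t within A)"
    and ap: "c t \<noteq> apex M x" and tr: "v \<notin> span {coord i (c t)}"
  shows "i = j \<and> v = w"
proof -
  have eq: "i = j"
  proof (rule ccontr)
    assume ne: "i \<noteq> j"
    have "coord i (c t) \<noteq> 0"
      using coord_mcone[OF ij(1) c(1)[OF A(2)]] ap apex_pt[OF ij(1)] by metis
    then obtain y s0 where y: "y \<in> Y i" "y \<in> Y j" "s0 > 0" "coord i (c t) = s0 *\<^sub>R e i y"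
      using mcone_inter[OF ij ne c(1)[OF A(2)] c(2)[OF A(2)]] by blast
    have o: "oth i y \<in> Y i" using oth(1)[OF ij(1) y(1)] .
    have z: "co i (oth i y) (coord i (c s)) = 0" if sA: "s \<in> A" for s
    proof -
      obtain r where "coord i (c s) = r *\<^sub>R e i y" using mcone_inter_edge[OF ij ne c(1)[OF sA] c(2)[OF sA] y(1,2)] by blast
      then show ?thesis using ij o co(4)[OF ij(1) y(1)] by simp
    qed
    have bl: "bounded_linear (co i (oth i y))" using co(1)[OF ij(1) o] linear_conv_bounded_linear by blast
    have "((\<lambda>s. co i (oth i y) (coord i (c s))) has_vector_derivative co i (oth i y) v) (at t within A)"
      by (rule bounded_linear.has_vector_derivative[OF bl v])
    moreover have "((\<lambda>s. co i (oth i y) (coord i (c s))) has_vector_derivative 0) (at t within A)"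
      by (rule has_vector_derivative_transform[OF A(2) _ has_vector_derivative_const[of 0]]) (use z in auto)
    ultimately have "co i (oth i y) v = 0" using vector_derivative_unique_within[OF A(1)] by blast
    then have "v = co i y v *\<^sub>R e i y" using co(6)[OF ij(1) y(1), of v] by simp
    also have "\<dots> = (co i y v / s0) *\<^sub>R coord i (c t)" using y by simp
    finally show False using tr by (metis span_base span_scale singletonI)
  qed
  have "((\<lambda>s. u + (s - t) *\<^sub>R w) has_vector_derivative w) (at t within A)"
    by (auto intro!: derivative_eq_intros)
  then have "((\<lambda>s. coord i (c s)) has_vector_derivative w) (at t within A)"
    by (rule has_vector_derivative_transform[OF A(2), rotated]) (use l eq in auto)
  then show ?thesis using eq vector_derivative_unique_within[OF A(1) v] by blast
qed

text \<open>A coordinate that is nonnegative at both ends and not positive half way vanishes at both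
  ends; then \<open>u\<close> and \<open>w\<close> would both lie along one boundary ray.\<close>

lemma mid_interior:
  assumes i: "i \<in> I" and u: "u \<in> sec i" "u + h *\<^sub>R w \<in> sec i" "h \<noteq> 0" "u \<noteq> 0" and tr: "w \<notin> span {u}"
  shows "inside i (u + (h / 2) *\<^sub>R w)"
  unfolding inside_def
proof (rule ballI, rule ccontr)
  fix z assume z: "z \<in> Y i" and n: "\<not> 0 < co i z (u + (h / 2) *\<^sub>R w)"
  have a: "0 \<le> co i z u" "0 \<le> co i z u + h * co i z w" using u(1,2) z i sector_iff_all[OF i] by force+
  have "co i z u + (h / 2) * co i z w \<le> 0" using n i z by simp
  then have "co i z u = 0" "h * co i z w = 0" using a by linarith+
  then have c: "co i z u = 0" "co i z w = 0" using u(3) by auto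
  let ?o = "oth i z"
  have eu: "u = co i ?o u *\<^sub>R e i ?o" and ew: "w = co i ?o w *\<^sub>R e i ?o"
    using co(6)[OF i z, of u] co(6)[OF i z, of w] c by simp_all
  have "co i ?o u \<noteq> 0" using eu u(4) by auto
  then have "w = (co i ?o w / co i ?o u) *\<^sub>R u"
    using eu ew by (metis nonzero_eq_divide_eq scaleR_scaleR)
  then show False using tr by (metis span_base span_scale singletonI)
qed

lemma transversal_nonzero:
  assumes "u \<noteq> 0" "w \<notin> span {u}"
  shows "u + r *\<^sub>R w \<noteq> 0"
proof
  assume z: "u + r *\<^sub>R w = 0"
  then have "r \<noteq> 0" using assms(1) by auto
  have "w = (1 / r) *\<^sub>R (r *\<^sub>R w)" using \<open>r \<noteq> 0\<close> by simp
  also have "r *\<^sub>R w = - u" using z by (simp add: add_eq_0_iff)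
  finally have "w = (- 1 / r) *\<^sub>R u" by simp
  then show False using assms(2) by (metis span_base span_scale singletonI)
qed

text \<open>At the given time the point may lie on an edge. Half way along the straight germ it is
  inside a cone, and the line misses the apex because its velocity is not radial. These are the data
  that \<open>maximal_chain\<close> starts from.\<close>

lemma initial_line:
  assumes g: "geo \<kappa> D c" and t: "t \<in> D" and ap: "c t \<noteq> apex M x"
    and v: "outgoing M x D c t i v \<or> incoming M x D c t i v" and tr: "v \<notin> span {coord i (c t)}"
  shows "\<exists>T a b w. 0 < a \<and> {T - a..T + a} \<subseteq> D \<and> straight c (T - a) (T + a) i (\<lambda>r. b + r *\<^sub>R w) \<and>
    inside i (b + T *\<^sub>R w) \<and> F i w = \<kappa> \<and> (\<forall>r. b + r *\<^sub>R w \<noteq> 0)"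
proof -
  have i: "i \<in> I" using v by (auto simp: outgoing_def incoming_def)
  \<comment> \<open>\<open>h\<close> is the signed duration of the germ, positive for an outgoing
    and negative for an incoming velocity; the new time is \<open>t + h / 2\<close>.\<close>
  have fin: ?thesis if h: "0 < a" "\<bar>h\<bar> = 2 * a" "{(t + h / 2) - a..(t + h / 2) + a} \<subseteq> D"
    "straight c ((t + h / 2) - a) ((t + h / 2) + a) i (\<lambda>r. u + (r - t) *\<^sub>R w)" "F i w = \<kappa>" "w \<notin> span {u}" "u \<noteq> 0"
    "u \<in> sec i" "u + h *\<^sub>R w \<in> sec i" for a h u w
  proof (intro exI conjI allI)
    have r: "(u - t *\<^sub>R w) + r *\<^sub>R w = u + (r - t) *\<^sub>R w" for r by (simp add: algebra_simps)
    show "straight c ((t + h / 2) - a) ((t + h / 2) + a) i (\<lambda>r. (u - t *\<^sub>R w) + r *\<^sub>R w)" unfolding r by (rule h(4))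
    show "inside i ((u - t *\<^sub>R w) + (t + h / 2) *\<^sub>R w)"
      unfolding r using mid_interior[OF i h(8,9) _ h(7,6)] h(1,2) by force
    show "(u - t *\<^sub>R w) + r *\<^sub>R w \<noteq> 0" for r unfolding r by (rule transversal_nonzero[OF h(7,6)])
  qed (use h in simp_all)
  show ?thesis using v
  proof
    assume o: "outgoing M x D c t i v"
    then obtain a0 where a0: "0 < a0" "{t..t + a0} \<subseteq> D" "\<And>s. s \<in> {t..t + a0} \<Longrightarrow> c s \<in> mc i"
      and d: "((\<lambda>s. coord i (c s)) has_vector_derivative v) (at_right t)" unfolding outgoing_def by blast
    have "t + a0 \<in> D" "t < t + a0" using a0 by auto
    then obtain j u w a1 where a1: "0 < a1" "{t..t + a1} \<subseteq> D" and st: "straight c t (t + a1) j (\<lambda>r. u + (r - t) *\<^sub>R w)"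
      and k: "F j w = \<kappa>" by (rule right_germ[OF g t])
    have j: "j \<in> I" using st by (simp add: straight_def)
    define a where "a = min a0 a1"
    have a: "0 < a" "a \<le> a0" "a \<le> a1" using a0 a1 by (auto simp: a_def)
    have at: "at t within {t..t + a} = at_right t" using a by (intro at_within_Icc_at_right) simp
    have ijw: "i = j \<and> v = w"
    proof (rule one_sided_velocity[OF i j, of t "{t..t + a}" c u w v])
      show "at t within {t..t + a} \<noteq> bot" unfolding at by simp
      show "((\<lambda>s. coord i (c s)) has_vector_derivative v) (at t within {t..t + a})" unfolding at by (rule d)
    qed (use a a0 straight_coord[OF st] ap tr in auto)
    have cu: "coord i (c t) = u" using straight_coord[OF st, of t] a1 ijw by simp
    have "c t = pnt i u" using straight_at[OF st, of t] a1 ijw by simp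
    then have u0: "u \<noteq> 0" using ap apex_pt[OF i] by auto
    show ?thesis
    proof (rule fin[of "a / 2" a u w])
      show "straight c ((t + a / 2) - a / 2) ((t + a / 2) + a / 2) i (\<lambda>r. u + (r - t) *\<^sub>R w)"
        using straight_restrict[OF st, of t "t + a"] a ijw by (simp add: add.commute)
      show "{t + a / 2 - a / 2..t + a / 2 + a / 2} \<subseteq> D" using a1(2) a by auto
      show "u \<in> sec i" "u + a *\<^sub>R w \<in> sec i"
        using straight_at[OF st, of t] straight_at[OF st, of "t + a"] a ijw by simp_all
    qed (use a k ijw tr cu u0 in simp_all)
  next
    assume o: "incoming M x D c t i v"
    then obtain a0 where a0: "0 < a0" "{t - a0..t} \<subseteq> D" "\<And>s. s \<in> {t - a0..t} \<Longrightarrow> c s \<in> mc i"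
      and d: "((\<lambda>s. coord i (c s)) has_vector_derivative v) (at_left t)" unfolding incoming_def by blast
    have "t - a0 \<in> D" "t - a0 < t" using a0 by auto
    then obtain j u w a1 where a1: "0 < a1" "{t - a1..t} \<subseteq> D" and st: "straight c (t - a1) t j (\<lambda>r. u + (r - t) *\<^sub>R w)"
      and k: "F j w = \<kappa>" using left_germ[OF g _ t] by metis
    have j: "j \<in> I" using st by (simp add: straight_def)
    define a where "a = min a0 a1"
    have a: "0 < a" "a \<le> a0" "a \<le> a1" using a0 a1 by (auto simp: a_def)
    have at: "at t within {t - a..t} = at_left t" using a by (intro at_within_Icc_at_left) simp
    have ijw: "i = j \<and> v = w"
    proof (rule one_sided_velocity[OF i j, of t "{t - a..t}" c u w v])
      show "at t within {t - a..t} \<noteq> bot" unfolding at by simp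
      show "((\<lambda>s. coord i (c s)) has_vector_derivative v) (at t within {t - a..t})" unfolding at by (rule d)
    qed (use a a0 straight_coord[OF st] ap tr in auto)
    have cu: "coord i (c t) = u" using straight_coord[OF st, of t] a1 ijw by simp
    have "c t = pnt i u" using straight_at[OF st, of t] a1 ijw by simp
    then have u0: "u \<noteq> 0" using ap apex_pt[OF i] by auto
    show ?thesis
    proof (rule fin[of "a / 2" "- a" u w])
      show "straight c ((t + (- a) / 2) - a / 2) ((t + (- a) / 2) + a / 2) i (\<lambda>r. u + (r - t) *\<^sub>R w)"
      proof -
        have "t + (- a) / 2 - a / 2 = t - a" "t + (- a) / 2 + a / 2 = t" by simp_all
        then show ?thesis using straight_restrict[OF st, of "t - a" t] a ijw by simp
      qed
      show "{t + - a / 2 - a / 2..t + - a / 2 + a / 2} \<subseteq> D" using a1(2) a by auto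
      show "u \<in> sec i" "u + (- a) *\<^sub>R w \<in> sec i"
        using straight_at[OF st, of t] straight_at[OF st, of "t - a"] a ijw by simp_all
    qed (use a k ijw tr cu u0 in simp_all)
  qed
qed

lemma cone_edge_shared:
  assumes ij: "i \<in> I" "j \<in> I" "i \<noteq> j" and y: "y \<in> Y i" "y \<in> Y j"
  shows "cone_edge M x (mc i \<inter> mc j)"
  unfolding cone_edge_def
proof (rule bexI[where x = i], rule bexI[where x = j], intro conjI exI[where x = "e i y"])
  have c0: "coord i (apex M x) = 0" using apex_pt[OF ij(1)] ij by simp
  show "mc i \<inter> mc j = ray M x i (apex M x) (e i y)"
    unfolding ray_def c0
  proof (intro equalityI subsetI)
    fix p assume p: "p \<in> mc i \<inter> mc j"
    then obtain s where "0 \<le> s" "coord i p = s *\<^sub>R e i y" using mcone_inter_edge[OF ij _ _ y] by blast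
    then show "p \<in> {pnt i (0 + s *\<^sub>R e i y) |s. 0 \<le> s}" using coord_mcone(2)[OF ij(1), of p] p by force
  next
    fix p assume "p \<in> {pnt i (0 + s *\<^sub>R e i y) |s. 0 \<le> s}"
    then obtain s where s: "0 \<le> s" "p = pnt i (s *\<^sub>R e i y)" by auto
    have "p = pnt j (s *\<^sub>R e j y)" using pt_edge[OF ij(1,2) y s(1)] s(2) by (rule trans[rotated])
    moreover have "pnt i (s *\<^sub>R e i y) \<in> mc i" "pnt j (s *\<^sub>R e j y) \<in> mc j" using s(1) ij y by simp_all
    ultimately show "p \<in> mc i \<inter> mc j" using s(2) by (metis IntI)
  qed
qed (use ij e_independent(1)[OF ij(1) y(1)] in simp_all)

end

section \<open>Uniqueness of the extension\<close>

context full_chain begin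

lemma line_nonzero: "lo \<le> n \<Longrightarrow> n \<le> hi \<Longrightarrow> line n t \<noteq> 0"
  using chain_lines_nonzero[OF ch _ lohi, of n t] by (simp add: line_def)

text \<open>A radial velocity would carry the line through the apex, which the lines of a chain
  avoid.\<close>

lemma velocity_transversal:
  assumes n: "lo \<le> n" "n \<le> hi"
  shows "ve n \<notin> span {line n t}"
proof
  assume "ve n \<in> span {line n t}"
  then obtain q where q: "ve n = q *\<^sub>R line n t" by (auto simp: span_singleton)
  interpret scgauge "F (cn n)" by (rule gaugeI[OF cn[OF n]])
  have "ve n \<noteq> 0" using speed[OF n] kappa by auto
  then have q0: "q \<noteq> 0" using q by auto
  have "line n (t - 1 / q) = line n t + (- (1 / q)) *\<^sub>R ve n" using line_shift[of n "t - 1 / q" t] by simp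
  also have "(- (1 / q)) *\<^sub>R ve n = - line n t" using q0 unfolding q by simp
  finally have "line n (t - 1 / q) = 0" by simp
  then show False using line_nonzero[OF n] by blast
qed

lemma local_pieces:
  obtains m n a where "0 < a" "dom m (t - a)" "dom m t" "dom n t" "dom n (t + a)"
    "m = n \<and> inside (cn m) (line m t) \<or> cross (cn m) (line m t) (ve m) (cn n) (line n t) (ve n)"
proof (cases rule: local_form[of t])
  case (inner n a)
  then show ?thesis using that[of a n n] sdom_interior by blast
next
  case (corner n a)
  have "cross (cn (n - 1)) (line (n - 1) t) (ve (n - 1)) (cn n) (line n t) (ve n)"
    using crossing[OF corner(2,3)] corner(4) by simp
  then show ?thesis using that[of a "n - 1" n] corner by blast
qed

text \<open>Just before \<open>s\<close> the geodesic is a line of the chain, so its velocity is not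
  radial and \<open>transversal_corner\<close> applies. Whether the chain is inside a cone or on an
  edge at time \<open>s\<close> selects one of its two cases, and the refraction is unique.\<close>

lemma agree_right:
  assumes g: "geo \<kappa> D c" and s: "p < s" "s < q" "{p..q} \<subseteq> D" and ag: "\<And>r. r \<in> {p..s} \<Longrightarrow> c r = curve r"
  shows "\<exists>a>0. \<forall>r\<in>{s..s + a}. c r = curve r"
proof -
  have sD: "s \<in> D" "q \<in> D" using s by auto
  obtain j u w a1 where a1: "0 < a1" "{s..s + a1} \<subseteq> D" and R: "straight c s (s + a1) j (\<lambda>r. u + (r - s) *\<^sub>R w)" "F j w = \<kappa>"
    by (rule right_germ[OF g sD s(2)])
  obtain m n a2 where a2: "0 < a2" and d: "dom m (s - a2)" "dom m s" "dom n s" "dom n (s + a2)"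
    and alt: "m = n \<and> inside (cn m) (line m s) \<or> cross (cn m) (line m s) (ve m) (cn n) (line n s) (ve n)"
    by (rule local_pieces[of s])
  have mn: "lo \<le> m" "m \<le> hi" "lo \<le> n" "n \<le> hi" using d by (auto simp: dom_def)
  define a where "a = min (min a1 a2) (min (s - p) (q - s))"
  have a: "0 < a" "a \<le> a1" "a \<le> a2" "p \<le> s - a" "s + a \<le> q" using a1 a2 s by (auto simp: a_def)
  have "straight curve (s - a) s (cn m) (\<lambda>r. line m s + (r - s) *\<^sub>R ve m)"
    using straight_restrict[OF curve_straight[OF d(1,2), of s], of "s - a" s] a by simp
  then have L: "straight c (s - a) s (cn m) (\<lambda>r. line m s + (r - s) *\<^sub>R ve m)"
    by (rule straight_transfer) (use ag a in auto)
  have R': "straight c s (s + a) j (\<lambda>r. u + (r - s) *\<^sub>R w)" using straight_restrict[OF R(1), of s "s + a"] a by simp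
  have D': "{s - a..s + a} \<subseteq> D" using s(3) a by auto
  have tc: "cn m = j \<and> u = line m s \<and> w = ve m \<and> (\<forall>y\<in>Y (cn m). 0 < co (cn m) y (line m s)) \<or>
      cross (cn m) (line m s) (ve m) j u w"
    by (rule transversal_corner[OF g a(1) D' L speed[OF mn(1,2)] R' R(2) line_nonzero[OF mn(1,2)]])
      (use velocity_transversal[OF mn(1,2)] in blast)
  have eq: "j = cn n \<and> u = line n s \<and> w = ve n"
    using alt
  proof
    assume h: "m = n \<and> inside (cn m) (line m s)"
    then have "\<not> cross (cn m) (line m s) (ve m) j u w" using cross_not_interior by blast
    then show ?thesis using tc h by blast
  next
    assume h: "cross (cn m) (line m s) (ve m) (cn n) (line n s) (ve n)"
    then have "\<not> inside (cn m) (line m s)" using cross_not_interior by blast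
    then have "cross (cn m) (line m s) (ve m) j u w" using tc unfolding inside_def by blast
    then show ?thesis using cross_unique_right[OF _ h] by blast
  qed
  have "c r = curve r" if r: "r \<in> {s..s + a}" for r
  proof -
    have "c r = pnt (cn n) (line n r)" using straight_at[OF R' r] eq line_shift[of n r s] by simp
    moreover have "dom n r" using dom_between[OF d(3,4)] r a by simp
    ultimately show ?thesis using curve_eq by simp
  qed
  then show ?thesis using a(1) by blast
qed

lemma agree_left:
  assumes g: "geo \<kappa> D c" and s: "p < s" "s < q" "{p..q} \<subseteq> D" and ag: "\<And>r. r \<in> {s..q} \<Longrightarrow> c r = curve r"
  shows "\<exists>a>0. \<forall>r\<in>{s - a..s}. c r = curve r"
proof -
  have sD: "p \<in> D" "s \<in> D" using s by auto
  obtain j u w a1 where a1: "0 < a1" "{s - a1..s} \<subseteq> D" and L: "straight c (s - a1) s j (\<lambda>r. u + (r - s) *\<^sub>R w)" "F j w = \<kappa>"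
    by (rule left_germ[OF g sD s(1)])
  obtain m n a2 where a2: "0 < a2" and d: "dom m (s - a2)" "dom m s" "dom n s" "dom n (s + a2)"
    and alt: "m = n \<and> inside (cn m) (line m s) \<or> cross (cn m) (line m s) (ve m) (cn n) (line n s) (ve n)"
    by (rule local_pieces[of s])
  have mn: "lo \<le> m" "m \<le> hi" "lo \<le> n" "n \<le> hi" using d by (auto simp: dom_def)
  define a where "a = min (min a1 a2) (min (s - p) (q - s))"
  have a: "0 < a" "a \<le> a1" "a \<le> a2" "p \<le> s - a" "s + a \<le> q" using a1 a2 s by (auto simp: a_def)
  have "straight curve s (s + a) (cn n) (\<lambda>r. line n s + (r - s) *\<^sub>R ve n)"
    using straight_restrict[OF curve_straight[OF d(3,4), of s], of s "s + a"] a by simp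
  then have R: "straight c s (s + a) (cn n) (\<lambda>r. line n s + (r - s) *\<^sub>R ve n)"
    by (rule straight_transfer) (use ag a in auto)
  have L': "straight c (s - a) s j (\<lambda>r. u + (r - s) *\<^sub>R w)" using straight_restrict[OF L(1), of "s - a" s] a by simp
  have D': "{s - a..s + a} \<subseteq> D" using s(3) a by auto
  have j: "j \<in> I" using L by (simp add: straight_def)
  have "pnt j u = pnt (cn n) (line n s)" "u \<in> sec j"
    using straight_at[OF L', of s] straight_at[OF R, of s] a(1) by simp_all
  moreover have "pnt (cn n) (line n s) \<noteq> apex M x"
    using line_nonzero[OF mn(3,4)] dom_sector[OF d(3)] dom_cn[OF d(3)] by simp
  ultimately have u0: "u \<noteq> 0" using apex_pt[OF j] by metis
  have tc: "j = cn n \<and> line n s = u \<and> ve n = w \<and> (\<forall>y\<in>Y j. 0 < co j y u) \<or> cross j u w (cn n) (line n s) (ve n)"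
    by (rule transversal_corner[OF g a(1) D' L' L(2) R speed[OF mn(3,4)] u0])
      (use velocity_transversal[OF mn(3,4)] in blast)
  have eq: "j = cn m \<and> u = line m s \<and> w = ve m"
    using alt
  proof
    assume h: "m = n \<and> inside (cn m) (line m s)"
    then have "\<not> cross j u w (cn n) (line n s) (ve n)" using cross_not_interior by blast
    then show ?thesis using tc h by blast
  next
    assume h: "cross (cn m) (line m s) (ve m) (cn n) (line n s) (ve n)"
    then have "\<not> inside (cn n) (line n s)" using cross_not_interior by blast
    then have "cross j u w (cn n) (line n s) (ve n)" using tc unfolding inside_def by blast
    then show ?thesis using cross_unique_left[OF _ h] by blast
  qed
  have "c r = curve r" if r: "r \<in> {s - a..s}" for r
  proof -
    have "c r = pnt (cn m) (line m r)" using straight_at[OF L' r] eq line_shift[of m r s] by simp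
    moreover have "dom m r" using dom_between[OF d(1,2)] r a by simp
    ultimately show ?thesis using curve_eq by simp
  qed
  then show ?thesis using a(1) by blast
qed

text \<open>Two lines that agree at two points of the interior of a cone agree everywhere.\<close>

lemma limit_agree:
  assumes h: "h \<noteq> 0" and d: "dom n s" "sdom n (s + h)" "sdom n (s + 2 * h)"
    and l: "j \<in> I" "\<And>r. r \<in> {s, s + h, s + 2 * h} \<Longrightarrow> u + (r - s) *\<^sub>R w \<in> sec j \<and> c r = pnt j (u + (r - s) *\<^sub>R w)"
    and ag: "c (s + h) = curve (s + h)" "c (s + 2 * h) = curve (s + 2 * h)"
  shows "c s = curve s"
proof -
  have I: "cn n \<in> I" using dom_cn d by blast
  have "pnt j (u + h *\<^sub>R w) = pnt (cn n) (line n (s + h))"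
    using l(2)[of "s + h"] ag(1) curve_eq[OF sdom_dom[OF d(2)]] by simp
  moreover have "u + h *\<^sub>R w \<in> sec j" using l(2)[of "s + h"] by simp
  ultimately have 1: "j = cn n" "u + h *\<^sub>R w = line n (s + h)"
    using pt_interior_eq[OF l(1) I _ sdom_interior[OF d(2)]] by blast+
  have "pnt j (u + (2 * h) *\<^sub>R w) = pnt (cn n) (line n (s + 2 * h))"
    using l(2)[of "s + 2 * h"] ag(2) curve_eq[OF sdom_dom[OF d(3)]] by simp
  moreover have "u + (2 * h) *\<^sub>R w \<in> sec j" using l(2)[of "s + 2 * h"] by simp
  ultimately have 2: "u + (2 * h) *\<^sub>R w = line n (s + 2 * h)"
    using pt_interior_eq[OF l(1) I _ sdom_interior[OF d(3)]] by blast
  have "u = 2 *\<^sub>R (u + h *\<^sub>R w) - (u + (2 * h) *\<^sub>R w)" by (simp add: algebra_simps scaleR_2)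
  also have "\<dots> = 2 *\<^sub>R line n (s + h) - line n (s + 2 * h)" unfolding 1 2 ..
  also have "\<dots> = line n s" unfolding line_shift[of n "s + h" s] line_shift[of n "s + 2 * h" s]
    by (simp add: algebra_simps scaleR_2)
  finally have "u = line n s" .
  then show ?thesis using l(2)[of s] 1 curve_eq[OF d(1)] by simp
qed

text \<open>The closing step of the supremum argument: the value at \<open>s\<close> is recovered
  from two earlier points on straight germs, in place of continuity.\<close>

lemma agree_left_limit:
  assumes g: "geo \<kappa>' D c" and s: "p < s" "{p..s} \<subseteq> D" and ag: "\<And>r. p \<le> r \<Longrightarrow> r < s \<Longrightarrow> c r = curve r"
  shows "c s = curve s"
proof -
  have sD: "p \<in> D" "s \<in> D" using s by auto
  obtain j u w a1 where a1: "0 < a1" "{s - a1..s} \<subseteq> D" and L: "straight c (s - a1) s j (\<lambda>r. u + (r - s) *\<^sub>R w)"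
    by (rule left_germ[OF g sD s(1)])
  obtain n a2 where a2: "0 < a2" "dom n s" "dom n (s - a2)" using curve_left by blast
  \<comment> \<open>A third, so that the two test times \<open>s - h\<close> and
    \<open>s - 2 * h\<close> are strictly inside all three ranges.\<close>
  define h where "h = min (min a1 a2) (s - p) / 3"
  have h: "0 < h" "3 * h \<le> a1" "3 * h \<le> a2" "3 * h \<le> s - p" using a1 a2 s by (auto simp: h_def)
  show ?thesis
  proof (rule limit_agree[of "- h" n s j u w])
    show "sdom n (s + - h)" "sdom n (s + 2 * - h)" using sdom_between[OF a2(3,2)] h by simp_all
    show "j \<in> I" using L by (simp add: straight_def)
    show "u + (r - s) *\<^sub>R w \<in> sec j \<and> c r = pnt j (u + (r - s) *\<^sub>R w)" if "r \<in> {s, s + - h, s + 2 * - h}" for r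
      by (rule straight_at[OF L]) (use that h in auto)
  qed (use a2 h ag in auto)
qed

lemma agree_right_limit:
  assumes g: "geo \<kappa>' D c" and s: "s < q" "{s..q} \<subseteq> D" and ag: "\<And>r. s < r \<Longrightarrow> r \<le> q \<Longrightarrow> c r = curve r"
  shows "c s = curve s"
proof -
  have sD: "s \<in> D" "q \<in> D" using s by auto
  obtain j u w a1 where a1: "0 < a1" "{s..s + a1} \<subseteq> D" and R: "straight c s (s + a1) j (\<lambda>r. u + (r - s) *\<^sub>R w)"
    by (rule right_germ[OF g sD s(1)])
  obtain n a2 where a2: "0 < a2" "dom n s" "dom n (s + a2)" using curve_right by blast
  define h where "h = min (min a1 a2) (q - s) / 3"
  have h: "0 < h" "3 * h \<le> a1" "3 * h \<le> a2" "3 * h \<le> q - s" using a1 a2 s by (auto simp: h_def)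
  show ?thesis
  proof (rule limit_agree[of h n s j u w])
    show "sdom n (s + h)" "sdom n (s + 2 * h)" using sdom_between[OF a2(2,3)] h by simp_all
    show "j \<in> I" using R by (simp add: straight_def)
    show "u + (r - s) *\<^sub>R w \<in> sec j \<and> c r = pnt j (u + (r - s) *\<^sub>R w)" if "r \<in> {s, s + h, s + 2 * h}" for r
      by (rule straight_at[OF R]) (use that h in auto)
  qed (use a2 h ag in auto)
qed

text \<open>Another extension could a priori have another speed; an outgoing vector on a common
  stretch compares the two.\<close>

lemma agree_speed:
  assumes g: "geo \<kappa>' D c" and pq: "p < q" "{p..q} \<subseteq> D" and ag: "\<And>r. r \<in> {p..q} \<Longrightarrow> c r = curve r"
  shows "\<kappa>' = \<kappa>"
proof -
  obtain n a2 where a2: "0 < a2" "dom n p" "dom n (p + a2)" using curve_right by blast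
  define a where "a = min a2 (q - p)"
  have a: "0 < a" "a \<le> a2" "p + a \<le> q" using a2 pq by (auto simp: a_def)
  have "straight curve p (p + a) (cn n) (\<lambda>r. line n p + (r - p) *\<^sub>R ve n)"
    using straight_restrict[OF curve_straight[OF a2(2,3), of p], of p "p + a"] a by simp
  then have "straight c p (p + a) (cn n) (\<lambda>r. line n p + (r - p) *\<^sub>R ve n)"
    by (rule straight_transfer) (use ag a in auto)
  then have "piece c p (p + a) (cn n) (\<lambda>_. ve n)" using straight_piece a by simp
  then have "outgoing M x D c p (cn n) (ve n)" by (rule piece_outgoing) (use a pq in auto)
  then have "F (cn n) (ve n) = \<kappa>'" using g pq unfolding geo_def by (meson atLeastAtMost_iff less_imp_le order_refl subsetD)
  then show ?thesis using speed a2 by (simp add: dom_def)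
qed

text \<open>A connectedness argument in both time directions: the limit lemmas include the end of
  the maximal stretch of agreement, and \<open>agree_right\<close> and \<open>agree_left\<close>
  prolong it.\<close>

lemma agree_everywhere:
  assumes g: "geo \<kappa>' D c" and pq: "p < q" "{p..q} \<subseteq> D" and ag: "\<And>r. r \<in> {p..q} \<Longrightarrow> c r = curve r" and t: "t \<in> D"
  shows "c t = curve t"
proof -
  have gk: "geo \<kappa> D c" using g agree_speed[OF g pq ag] by simp
  have iv: "is_interval D" using g by (simp add: geo_def)
  have pqD: "p \<in> D" "q \<in> D" using pq by auto
  consider "t \<in> {p..q}" | "q < t" | "t < p" by force
  then show ?thesis
  proof cases
    case 1 then show ?thesis by (rule ag)
  next
    case 2
    have D: "{p..t} \<subseteq> D" using interval_Icc[OF iv pqD(1) t] .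
    define S where "S = {s \<in> {q..t}. \<forall>r\<in>{p..s}. c r = curve r}"
    define s where "s = Sup S"
    have S: "q \<in> S" "bdd_above S" using 2 ag by (auto simp: S_def intro!: bdd_aboveI[of _ t])
    have qs: "q \<le> s" unfolding s_def by (rule cSup_upper[OF S])
    have st: "s \<le> t" unfolding s_def by (rule cSup_least) (use S in \<open>auto simp: S_def\<close>)
    have lt: "c r = curve r" if r: "p \<le> r" "r < s" for r
    proof -
      obtain s' where "s' \<in> S" "r < s'" using less_cSupE[of r S] r(2) S(1) unfolding s_def by blast
      then show ?thesis using r by (simp add: S_def)
    qed
    have "c s = curve s" by (rule agree_left_limit[OF g _ _ lt]) (use pq qs st D in auto)
    then have ag': "c r = curve r" if "r \<in> {p..s}" for r using lt[of r] that by (cases "r = s") auto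
    have "s = t"
    proof (rule ccontr)
      assume "s \<noteq> t"
      then have "s < t" using st by simp
      then obtain a where a: "0 < a" "\<forall>r\<in>{s..s + a}. c r = curve r"
        using agree_right[OF gk _ _ D ag', of s] pq qs by auto
      define s' where "s' = min (s + a) t"
      have "s' \<in> S" unfolding S_def
      proof (intro CollectI conjI ballI)
        show "s' \<in> {q..t}" using a qs \<open>s < t\<close> by (auto simp: s'_def)
        show "c r = curve r" if "r \<in> {p..s'}" for r
          using ag'[of r] a(2) that by (cases "r \<le> s") (auto simp: s'_def)
      qed
      then have "s' \<le> s" unfolding s_def using S(2) by (rule cSup_upper)
      then show False using a(1) \<open>s < t\<close> by (auto simp: s'_def)
    qed
    then show ?thesis using \<open>c s = curve s\<close> by simp
  next
    case 3
    have D: "{t..q} \<subseteq> D" using interval_Icc[OF iv t pqD(2)] .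
    define S where "S = {s \<in> {t..p}. \<forall>r\<in>{s..q}. c r = curve r}"
    define s where "s = Inf S"
    have S: "p \<in> S" "bdd_below S" using 3 ag by (auto simp: S_def intro!: bdd_belowI[of _ t])
    have qs: "s \<le> p" unfolding s_def by (rule cInf_lower[OF S])
    have st: "t \<le> s" unfolding s_def by (rule cInf_greatest) (use S in \<open>auto simp: S_def\<close>)
    have lt: "c r = curve r" if r: "s < r" "r \<le> q" for r
    proof -
      have "\<exists>s'\<in>S. s' < r" using cInf_lessD[of S r] r(1) S(1) unfolding s_def by blast
      then obtain s' where "s' \<in> S" "s' < r" by blast
      then show ?thesis using r by (simp add: S_def)
    qed
    have "c s = curve s" by (rule agree_right_limit[OF g _ _ lt]) (use pq qs st D in auto)
    then have ag': "c r = curve r" if "r \<in> {s..q}" for r using lt[of r] that by (cases "r = s") auto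
    have "s = t"
    proof (rule ccontr)
      assume "s \<noteq> t"
      then have "t < s" using st by simp
      then obtain a where a: "0 < a" "\<forall>r\<in>{s - a..s}. c r = curve r"
        using agree_left[OF gk _ _ D ag', of s] pq qs by auto
      define s' where "s' = max (s - a) t"
      have "s' \<in> S" unfolding S_def
      proof (intro CollectI conjI ballI)
        show "s' \<in> {t..p}" using a qs \<open>t < s\<close> by (auto simp: s'_def)
        show "c r = curve r" if "r \<in> {s'..q}" for r
          using ag'[of r] a(2) that by (cases "s \<le> r") (auto simp: s'_def)
      qed
      then have "s \<le> s'" unfolding s_def using S(2) by (rule cInf_lower)
      then show False using a(1) \<open>t < s\<close> by (auto simp: s'_def)
    qed
    then show ?thesis using \<open>c s = curve s\<close> by simp
  qed
qed

end

section \<open>Decomposition into rays and segments\<close>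

context full_chain begin

lemma dom_tau:
  assumes "lo < n" "n \<le> hi"
  shows "dom n (\<tau> n)" "dom (n - 1) (\<tau> n)"
  using assms tau_less[of "n - 1" n] tau_less[of n "n + 1"] by (auto simp: dom_def)

text \<open>Two different cones share at most one edge, so a return to the previous cone would leave
  through the edge of entry, against the signs of the velocity.\<close>

lemma no_turning_back:
  assumes n: "lo < n" "n < hi"
  shows "cn (n - 1) \<noteq> cn (n + 1)"
proof
  assume eq: "cn (n - 1) = cn (n + 1)"
  have "cross (cn (n - 1)) (line (n - 1) (\<tau> n)) (ve (n - 1)) (cn n) (line n (\<tau> n)) (ve n)"
    using crossing[of n] n by simp
  then obtain y where y: "cn (n - 1) \<in> I" "cn n \<in> I" "cn (n - 1) \<noteq> cn n" "y \<in> Y (cn (n - 1))" "y \<in> Y (cn n)"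
    "0 < co (cn n) (oth (cn n) y) (ve n)"
    by (rule crossE) blast
  have "cross (cn n) (line n (\<tau> (n + 1))) (ve n) (cn (n + 1)) (line (n + 1) (\<tau> (n + 1))) (ve (n + 1))"
    using crossing[of "n + 1"] n by simp
  then obtain y' where y': "y' \<in> Y (cn n)" "y' \<in> Y (cn (n + 1))" "co (cn n) (oth (cn n) y') (ve n) < 0"
    by (rule crossE) blast
  have "y' = y" using shared_edge_unique[OF y(1-5)] y' eq by simp
  then show False using y y' by simp
qed

text \<open>An edge lies in two different cones, whereas a point inside a cone belongs to that cone
  only.\<close>

lemma interior_not_in_edge:
  assumes d: "sdom n t" and E: "cone_edge M x E"
  shows "curve t \<notin> E"
proof
  assume "curve t \<in> E"
  then obtain i j where ij: "i \<in> I" "j \<in> I" "i \<noteq> j" "curve t \<in> mc i" "curve t \<in> mc j"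
    using E unfolding cone_edge_def by blast
  have "k = cn n" if k: "k \<in> I" "curve t \<in> mc k" for k
  proof -
    obtain v where "v \<in> sec k" "curve t = pnt k v" using mcone_iff[OF k(1)] k(2) by blast
    then show ?thesis
      using pt_interior_eq[OF k(1) dom_cn[OF sdom_dom[OF d]] _ sdom_interior[OF d]] curve_eq[OF sdom_dom[OF d]] by metis
  qed
  then show False using ij by metis
qed

lemma coord_curve: "dom n t \<Longrightarrow> coord (cn n) (curve t) = line n t"
  by (simp add: curve_eq dom_cn dom_sector)

lemma curve_mcone: "dom n t \<Longrightarrow> curve t \<in> mc (cn n)"
  by (simp add: curve_eq dom_cn dom_sector)

lemma first_ray: "ray M x (cn lo) (curve (\<tau> (lo + 1))) (- ve lo) = curve ` {..\<tau> (lo + 1)}"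
proof -
  have d: "dom lo t" if "t \<le> \<tau> (lo + 1)" for t using that lohi by (simp add: dom_def)
  have p: "pnt (cn lo) (line lo (\<tau> (lo + 1)) + s *\<^sub>R (- ve lo)) = curve (\<tau> (lo + 1) - s)" if "0 \<le> s" for s
    using curve_eq[OF d[of "\<tau> (lo + 1) - s"]] that line_shift[of lo "\<tau> (lo + 1) - s" "\<tau> (lo + 1)"] by simp
  show ?thesis
    unfolding ray_def coord_curve[OF d[OF order_refl]]
  proof (intro equalityI subsetI)
    fix q assume "q \<in> {pnt (cn lo) (line lo (\<tau> (lo + 1)) + s *\<^sub>R (- ve lo)) |s. 0 \<le> s}"
    then obtain s where "0 \<le> s" "q = curve (\<tau> (lo + 1) - s)" using p by auto
    then show "q \<in> curve ` {..\<tau> (lo + 1)}" by auto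
  next
    fix q assume "q \<in> curve ` {..\<tau> (lo + 1)}"
    then obtain t where t: "t \<le> \<tau> (lo + 1)" "q = curve t" by auto
    then have "q = pnt (cn lo) (line lo (\<tau> (lo + 1)) + (\<tau> (lo + 1) - t) *\<^sub>R (- ve lo))" using p[of "\<tau> (lo + 1) - t"] by simp
    then show "q \<in> {pnt (cn lo) (line lo (\<tau> (lo + 1)) + s *\<^sub>R (- ve lo)) |s. 0 \<le> s}"
      using t(1) by (intro CollectI exI[of _ "\<tau> (lo + 1) - t"]) simp
  qed
qed

lemma last_ray: "ray M x (cn hi) (curve (\<tau> hi)) (ve hi) = curve ` {\<tau> hi..}"
proof -
  have d: "dom hi t" if "\<tau> hi \<le> t" for t using that lohi by (simp add: dom_def)
  have p: "pnt (cn hi) (line hi (\<tau> hi) + s *\<^sub>R ve hi) = curve (\<tau> hi + s)" if "0 \<le> s" for s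
    using curve_eq[OF d[of "\<tau> hi + s"]] that line_shift[of hi "\<tau> hi + s" "\<tau> hi"] by simp
  show ?thesis
    unfolding ray_def coord_curve[OF d[OF order_refl]]
  proof (intro equalityI subsetI)
    fix q assume "q \<in> {pnt (cn hi) (line hi (\<tau> hi) + s *\<^sub>R ve hi) |s. 0 \<le> s}"
    then obtain s where "0 \<le> s" "q = curve (\<tau> hi + s)" using p by auto
    then show "q \<in> curve ` {\<tau> hi..}" by auto
  next
    fix q assume "q \<in> curve ` {\<tau> hi..}"
    then obtain t where t: "\<tau> hi \<le> t" "q = curve t" by auto
    then have "q = pnt (cn hi) (line hi (\<tau> hi) + (t - \<tau> hi) *\<^sub>R ve hi)" using p[of "t - \<tau> hi"] by simp
    then show "q \<in> {pnt (cn hi) (line hi (\<tau> hi) + s *\<^sub>R ve hi) |s. 0 \<le> s}"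
      using t(1) by (intro CollectI exI[of _ "t - \<tau> hi"]) simp
  qed
qed

lemma middle_segment:
  assumes n: "lo < n" "n < hi"
  shows "segment M x (cn n) (curve (\<tau> n)) (curve (\<tau> (n + 1))) = curve ` {\<tau> n..\<tau> (n + 1)}"
proof -
  have d: "dom n (\<tau> n)" "dom n (\<tau> (n + 1))" using dom_tau[of n] dom_tau[of "n + 1"] n by auto
  have lt: "\<tau> n < \<tau> (n + 1)" using tau_less n by simp
  have "closed_segment (line n (\<tau> n)) (line n (\<tau> (n + 1))) = line n ` closed_segment (\<tau> n) (\<tau> (n + 1))"
  proof -
    have "(1 - u) *\<^sub>R line n p + u *\<^sub>R line n q = line n ((1 - u) *\<^sub>R p + u *\<^sub>R q)" for u p q
      by (simp add: line_def algebra_simps)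
    then show ?thesis unfolding closed_segment_def by auto
  qed
  also have "closed_segment (\<tau> n) (\<tau> (n + 1)) = {\<tau> n..\<tau> (n + 1)}" using lt by (simp add: closed_segment_eq_real_ivl)
  finally have "segment M x (cn n) (curve (\<tau> n)) (curve (\<tau> (n + 1))) = (\<lambda>t. pnt (cn n) (line n t)) ` {\<tau> n..\<tau> (n + 1)}"
    unfolding segment_def coord_curve[OF d(1)] coord_curve[OF d(2)] by (simp add: image_image)
  also have "\<dots> = curve ` {\<tau> n..\<tau> (n + 1)}"
  proof (rule image_cong[OF refl])
    fix t assume "t \<in> {\<tau> n..\<tau> (n + 1)}"
    then have "dom n t" using dom_between[OF d] by simp
    then show "pnt (cn n) (line n t) = curve t" using curve_eq by simp
  qed
  finally show ?thesis .
qed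

lemma curve_range:
  "range curve = curve ` {..\<tau> (lo + 1)} \<union> (\<Union>n\<in>{lo<..<hi}. curve ` {\<tau> n..\<tau> (n + 1)}) \<union> curve ` {\<tau> hi..}"
proof (intro equalityI subsetI)
  fix q assume "q \<in> range curve"
  then obtain t where t: "q = curve t" by blast
  obtain n where n: "dom n t" using dom_exists by blast
  consider "n = lo" | "n = hi" | "lo < n \<and> n < hi" using n unfolding dom_def by linarith
  then show "q \<in> curve ` {..\<tau> (lo + 1)} \<union> (\<Union>n\<in>{lo<..<hi}. curve ` {\<tau> n..\<tau> (n + 1)}) \<union> curve ` {\<tau> hi..}"
  proof cases
    case 1
    then have "t \<in> {..\<tau> (lo + 1)}" using n lohi by (simp add: dom_def)
    then show ?thesis using t by blast
  next
    case 2
    then have "t \<in> {\<tau> hi..}" using n lohi by (simp add: dom_def)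
    then show ?thesis using t by blast
  next
    case 3
    then have "t \<in> {\<tau> n..\<tau> (n + 1)}" "n \<in> {lo<..<hi}" using n by (simp_all add: dom_def)
    then show ?thesis using t by blast
  qed
qed blast

lemma curve_decomposition:
  "\<exists>(m::nat) (k :: nat \<Rightarrow> 'i) (p :: nat \<Rightarrow> ('i \<times> (real^2)) set) (\<sigma> :: nat \<Rightarrow> real)
          (vin :: real^2) (vout :: real^2).
        1 \<le> m \<and>
        consecutive_cones M x m k \<and>
        (\<forall>i\<in>{1..m}. p i \<noteq> apex M x \<and> p i \<in> mcone M x (k (i - 1)) \<inter> mcone M x (k i)) \<and>
        strict_mono_on {1..m} \<sigma> \<and> (\<forall>i\<in>{1..m}. curve (\<sigma> i) = p i) \<and>
        incoming M x UNIV curve (\<sigma> 1) (k 0) vin \<and>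
        outgoing M x UNIV curve (\<sigma> m) (k m) vout \<and>
        range curve = ray M x (k 0) (p 1) (- vin) \<union>
          (\<Union>i\<in>{1..<m}. segment M x (k i) (p i) (p (i + 1))) \<union>
          ray M x (k m) (p m) vout \<and>
        ray M x (k 0) (p 1) (- vin) \<subseteq> mcone M x (k 0) \<and>
        (\<forall>i\<in>{1..<m}. segment M x (k i) (p i) (p (i + 1)) \<subseteq> mcone M x (k i)) \<and>
        ray M x (k m) (p m) vout \<subseteq> mcone M x (k m) \<and>
        apex M x \<notin> range curve \<and>
        (\<forall>E. cone_edge M x E \<longrightarrow>
           \<not> ray M x (k 0) (p 1) (- vin) \<subseteq> E \<and>
           (\<forall>i\<in>{1..<m}. \<not> segment M x (k i) (p i) (p (i + 1)) \<subseteq> E) \<and>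
           \<not> ray M x (k m) (p m) vout \<subseteq> E)"
proof -
  define m where "m = nat (hi - lo)"
  \<comment> \<open>Crossing \<open>i\<close> is the entry into piece \<open>lo + i\<close>, so it
    separates the cones \<open>k (i - 1)\<close> and \<open>k i\<close>.\<close>
  define \<sigma> where "\<sigma> i = \<tau> (lo + int i)" for i
  define k where "k i = cn (lo + int i)" for i
  define p where "p i = curve (\<sigma> i)" for i
  have m: "1 \<le> m" "lo + int m = hi" using lohi by (auto simp: m_def)
  have k0: "k 0 = cn lo" "k m = cn hi" "\<sigma> 1 = \<tau> (lo + 1)" "\<sigma> m = \<tau> hi" using m by (auto simp: k_def \<sigma>_def)
  have pre: "lo + int (i - 1) = lo + int i - 1" if "1 \<le> i" for i using that by (simp add: of_nat_diff)
  have R1: "ray M x (k 0) (p 1) (- ve lo) = curve ` {..\<tau> (lo + 1)}"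
    unfolding p_def k0 by (rule first_ray)
  have R2: "ray M x (k m) (p m) (ve hi) = curve ` {\<tau> hi..}"
    unfolding p_def k0 by (rule last_ray)
  have S: "segment M x (k i) (p i) (p (i + 1)) = curve ` {\<tau> (lo + int i)..\<tau> (lo + int i + 1)}" if "i \<in> {1..<m}" for i
    using middle_segment[of "lo + int i"] that m by (simp add: k_def p_def \<sigma>_def ac_simps)
  have dlo: "dom lo t" if "t \<le> \<tau> (lo + 1)" for t using that lohi by (simp add: dom_def)
  have dhi: "dom hi t" if "\<tau> hi \<le> t" for t using that lohi by (simp add: dom_def)
  have dmid: "dom (lo + int i) t" if "i \<in> {1..<m}" "t \<in> {\<tau> (lo + int i)..\<tau> (lo + int i + 1)}" for i t
    using that m by (simp add: dom_def)
  have 1: "consecutive_cones M x m k"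
    unfolding consecutive_cones_def
  proof (intro conjI ballI allI impI)
    show "k i \<in> I" if "i \<le> m" for i unfolding k_def using that m by (intro cn) auto
    fix i assume i: "i \<in> {1..m}"
    then have n: "lo < lo + int i" "lo + int i \<le> hi" using m by auto
    have ki: "k (i - 1) = cn (lo + int i - 1)" "k i = cn (lo + int i)"
      using i unfolding k_def by (subst pre) simp_all
    from crossing[OF n] obtain y where y: "k (i - 1) \<in> I" "k i \<in> I" "k (i - 1) \<noteq> k i" "y \<in> Y (k (i - 1))" "y \<in> Y (k i)"
      unfolding ki by (rule crossE) blast
    show "k (i - 1) \<noteq> k i" by (rule y(3))
    show "cone_edge M x (mc (k (i - 1)) \<inter> mc (k i))" by (rule cone_edge_shared[OF y])
  next
    fix i assume i: "i \<in> {1..<m}"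
    have "lo + int (i - 1) = lo + int i - 1" using i by (intro pre) simp
    moreover have "lo + int (i + 1) = lo + int i + 1" by simp
    moreover have "cn (lo + int i - 1) \<noteq> cn (lo + int i + 1)" using i m by (intro no_turning_back) auto
    ultimately show "k (i - 1) \<noteq> k (i + 1)" unfolding k_def by metis
  qed
  have 2: "p i \<noteq> apex M x \<and> p i \<in> mc (k (i - 1)) \<inter> mc (k i)" if i: "i \<in> {1..m}" for i
  proof -
    have n: "lo < lo + int i" "lo + int i \<le> hi" using i m by auto
    note d = dom_tau[OF n]
    have "p i = pnt (k i) (line (lo + int i) (\<tau> (lo + int i)))" using curve_eq[OF d(1)] by (simp add: p_def \<sigma>_def k_def)
    then have "p i \<noteq> apex M x"
      using line_nonzero[of "lo + int i"] n dom_cn[OF d(1)] dom_sector[OF d(1)] by (simp add: k_def)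
    moreover have eq: "lo + int (i - 1) = lo + int i - 1" using i by (intro pre) simp
    moreover have "p i \<in> mc (k (i - 1))" unfolding p_def \<sigma>_def k_def eq by (rule curve_mcone[OF d(2)])
    moreover have "p i \<in> mc (k i)" unfolding p_def \<sigma>_def k_def by (rule curve_mcone[OF d(1)])
    ultimately show ?thesis by blast
  qed
  have 3: "strict_mono_on {1..m} \<sigma>"
    by (rule strict_mono_onI) (use tau_less m in \<open>auto simp: \<sigma>_def\<close>)
  have 4: "incoming M x UNIV curve (\<sigma> 1) (k 0) (ve lo)"
    unfolding k0 by (rule curve_incoming[of lo _ 1]) (use dlo in auto)
  have 5: "outgoing M x UNIV curve (\<sigma> m) (k m) (ve hi)"
    unfolding k0 by (rule curve_outgoing[of hi _ 1]) (use dhi in auto)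
  have 6: "range curve = ray M x (k 0) (p 1) (- ve lo) \<union> (\<Union>i\<in>{1..<m}. segment M x (k i) (p i) (p (i + 1))) \<union>
      ray M x (k m) (p m) (ve hi)"
  proof -
    have "(\<Union>i\<in>{1..<m}. segment M x (k i) (p i) (p (i + 1))) = (\<Union>i\<in>{1..<m}. curve ` {\<tau> (lo + int i)..\<tau> (lo + int i + 1)})"
      by (rule SUP_cong[OF refl S])
    also have "\<dots> = (\<Union>n\<in>(\<lambda>i. lo + int i) ` {1..<m}. curve ` {\<tau> n..\<tau> (n + 1)})" by simp
    also have "(\<lambda>i. lo + int i) ` {1..<m} = {lo<..<hi}"
    proof (intro equalityI subsetI)
      fix n assume "n \<in> {lo<..<hi}"
      then show "n \<in> (\<lambda>i. lo + int i) ` {1..<m}" by (intro image_eqI[of _ _ "nat (n - lo)"]) (auto simp: m_def)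
    qed (use m in auto)
    finally show ?thesis unfolding R1 R2 curve_range by simp
  qed
  have 7: "ray M x (k 0) (p 1) (- ve lo) \<subseteq> mc (k 0)" unfolding R1 unfolding k0 using curve_mcone[OF dlo] by auto
  have 8: "segment M x (k i) (p i) (p (i + 1)) \<subseteq> mc (k i)" if "i \<in> {1..<m}" for i
    unfolding S[OF that] unfolding k_def using curve_mcone[OF dmid[OF that]] by blast
  have 9: "ray M x (k m) (p m) (ve hi) \<subseteq> mc (k m)" unfolding R2 unfolding k0 using curve_mcone[OF dhi] by auto
  have 10: "apex M x \<notin> range curve"
  proof
    assume "apex M x \<in> range curve"
    then obtain t where t: "curve t = apex M x" by (metis imageE)
    obtain n where d: "dom n t" using dom_exists by blast
    then have "pnt (cn n) (line n t) \<noteq> apex M x"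
      using line_nonzero[of n t] dom_cn[OF d] dom_sector[OF d] by (simp add: dom_def)
    then show False using t curve_eq[OF d] by simp
  qed
  have 11: "\<not> ray M x (k 0) (p 1) (- ve lo) \<subseteq> E \<and> (\<forall>i\<in>{1..<m}. \<not> segment M x (k i) (p i) (p (i + 1)) \<subseteq> E) \<and>
      \<not> ray M x (k m) (p m) (ve hi) \<subseteq> E" if E: "cone_edge M x E" for E
  proof (intro conjI ballI)
    \<comment> \<open>One unit of time before the first crossing the curve is inside a cone, and an
      edge contains no such point; the other pieces are treated alike, with one unit after the last
      crossing and the midpoint between two crossings.\<close>
    have "sdom lo (\<tau> (lo + 1) - 1)" using lohi by (simp add: sdom_def)
    moreover have "curve (\<tau> (lo + 1) - 1) \<in> curve ` {..\<tau> (lo + 1)}" by (rule imageI) simp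
    ultimately show "\<not> ray M x (k 0) (p 1) (- ve lo) \<subseteq> E"
      unfolding R1 using interior_not_in_edge E by blast
    have "sdom hi (\<tau> hi + 1)" using lohi by (simp add: sdom_def)
    moreover have "curve (\<tau> hi + 1) \<in> curve ` {\<tau> hi..}" by (rule imageI) simp
    ultimately show "\<not> ray M x (k m) (p m) (ve hi) \<subseteq> E"
      unfolding R2 using interior_not_in_edge E by blast
    fix i assume i: "i \<in> {1..<m}"
    let ?n = "lo + int i"
    have n: "lo < ?n" "?n < hi" using i m by auto
    have lt: "\<tau> ?n < \<tau> (?n + 1)" using tau_less n by simp
    define t where "t = (\<tau> ?n + \<tau> (?n + 1)) / 2"
    have t: "\<tau> ?n < t" "t < \<tau> (?n + 1)" using lt by (auto simp: t_def)
    have "sdom ?n t" using n t by (simp add: sdom_def)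
    moreover have "curve t \<in> curve ` {\<tau> ?n..\<tau> (?n + 1)}" using t by (intro imageI) simp
    ultimately show "\<not> segment M x (k i) (p i) (p (i + 1)) \<subseteq> E"
      unfolding S[OF i] using interior_not_in_edge E by blast
  qed
  show ?thesis
    by (rule exI[of _ m], rule exI[of _ k], rule exI[of _ p], rule exI[of _ \<sigma>], rule exI[of _ "ve lo"], rule exI[of _ "ve hi"])
      (intro conjI, (use m(1) 1 2 3 4 5 6 7 8 9 10 11 in \<open>simp add: p_def\<close>)+)
qed

end

theorem theorem5p2:
  fixes M :: "('a, 'i) pf_surface" and x :: 'a
    and c :: "real \<Rightarrow> ('i \<times> (real^2)) set" and D :: "real set" and t' :: real
  assumes "pf_finsler_surface M"
    and "is_vertex M x"
    and "geodesic M x D c"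
    and "t' \<in> D"
    and "c t' \<noteq> apex M x"
    and "\<exists>i v. (outgoing M x D c t' i v \<or> incoming M x D c t' i v) \<and> v \<notin> span {coord i (c t')}"
  shows "\<exists>\<gamma>. geodesic M x UNIV \<gamma> \<and> (\<forall>t\<in>D. \<gamma> t = c t) \<and>
      (\<forall>\<gamma>'. geodesic M x UNIV \<gamma>' \<and> (\<forall>t\<in>D. \<gamma>' t = c t) \<longrightarrow> \<gamma>' = \<gamma>) \<and>
      (\<exists>(m::nat) (k :: nat \<Rightarrow> 'i) (p :: nat \<Rightarrow> ('i \<times> (real^2)) set) (\<tau> :: nat \<Rightarrow> real)
          (vin :: real^2) (vout :: real^2).
        1 \<le> m \<and>
        consecutive_cones M x m k \<and>
        (\<forall>i\<in>{1..m}. p i \<noteq> apex M x \<and> p i \<in> mcone M x (k (i - 1)) \<inter> mcone M x (k i)) \<and>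
        strict_mono_on {1..m} \<tau> \<and> (\<forall>i\<in>{1..m}. \<gamma> (\<tau> i) = p i) \<and>
        incoming M x UNIV \<gamma> (\<tau> 1) (k 0) vin \<and>
        outgoing M x UNIV \<gamma> (\<tau> m) (k m) vout \<and>
        range \<gamma> = ray M x (k 0) (p 1) (- vin) \<union>
          (\<Union>i\<in>{1..<m}. segment M x (k i) (p i) (p (i + 1))) \<union>
          ray M x (k m) (p m) vout \<and>
        ray M x (k 0) (p 1) (- vin) \<subseteq> mcone M x (k 0) \<and>
        (\<forall>i\<in>{1..<m}. segment M x (k i) (p i) (p (i + 1)) \<subseteq> mcone M x (k i)) \<and>
        ray M x (k m) (p m) vout \<subseteq> mcone M x (k m) \<and>
        apex M x \<notin> range \<gamma> \<and>
        (\<forall>E. cone_edge M x E \<longrightarrow>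
           \<not> ray M x (k 0) (p 1) (- vin) \<subseteq> E \<and>
           (\<forall>i\<in>{1..<m}. \<not> segment M x (k i) (p i) (p (i + 1)) \<subseteq> E) \<and>
           \<not> ray M x (k m) (p m) vout \<subseteq> E))"
proof -
  interpret pf_vertex M x using assms(1,2) by unfold_locales
  obtain \<kappa> where g: "geo \<kappa> D c" using assms(3) geodesic_geo by blast
  then have kappa: "0 < \<kappa>" by (simp add: geo_def)
  obtain i v where iv: "outgoing M x D c t' i v \<or> incoming M x D c t' i v" "v \<notin> span {coord i (c t')}"
    using assms(6) by blast
  obtain T a b w where T: "0 < a" "{T - a..T + a} \<subseteq> D" "straight c (T - a) (T + a) i (\<lambda>r. b + r *\<^sub>R w)"
    "inside i (b + T *\<^sub>R w)" "F i w = \<kappa>" and nz: "\<And>r. b + r *\<^sub>R w \<noteq> 0"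
    using initial_line[OF g assms(4,5) iv] by blast
  have i: "i \<in> I" using T(3) by (simp add: straight_def)
  obtain lo hi cn ba ve \<tau> where mx: "chain \<kappa> lo hi cn ba ve \<tau>" "lo \<le> 0" "0 \<le> hi" "lo < hi" "cn 0 = i" "ba 0 = b" "ve 0 = w"
    "ve hi \<in> sec (cn hi)" "- ve lo \<in> sec (cn lo)"
    using maximal_chain[OF i kappa T(5,4) nz] by metis
  interpret full_chain M x \<kappa> lo hi cn ba ve \<tau>
    by unfold_locales (use mx kappa in auto)
  have line0: "line 0 r = b + r *\<^sub>R w" for r by (simp add: line_def mx)
  \<comment> \<open>The chain was built from the line alone, so \<open>T\<close> has to be located
    in time. The position at \<open>T\<close> is inside the cone while a coordinate vanishes at each
    crossing; the sign of the velocity tells on which side of the crossing \<open>T\<close>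
    lies.\<close>
  have sd: "sdom 0 T"
    unfolding sdom_def
  proof (intro conjI impI)
    assume l: "lo < 0"
    obtain y s where y: "y \<in> Y (cn 0)" "line 0 (\<tau> 0) = s *\<^sub>R e (cn 0) y" "0 < co (cn 0) (oth (cn 0) y) (ve 0)"
      using entry[OF l mx(3)] by metis
    have "0 < co i (oth i y) (line 0 T)" using T(4) y(1) oth(1)[OF i, of y] mx(5) unfolding inside_def line0 by simp
    also have "line 0 T = s *\<^sub>R e i y + (T - \<tau> 0) *\<^sub>R w" using line_shift[of 0 T "\<tau> 0"] y(2) mx by simp
    finally have "0 < (T - \<tau> 0) * co i (oth i y) w" using i y(1) mx(5) oth(1)[OF i, of y] by simp
    then show "\<tau> 0 < T" using y(3) mx by (simp add: zero_less_mult_iff)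
  next
    assume l: "0 < hi"
    obtain y s where y: "y \<in> Y (cn 0)" "line 0 (\<tau> (0 + 1)) = s *\<^sub>R e (cn 0) y" "co (cn 0) (oth (cn 0) y) (ve 0) < 0"
      using exit[OF mx(2) l] by metis
    have "0 < co i (oth i y) (line 0 T)" using T(4) y(1) oth(1)[OF i, of y] mx(5) unfolding inside_def line0 by simp
    also have "line 0 T = s *\<^sub>R e i y + (T - \<tau> (0 + 1)) *\<^sub>R w" using line_shift[of 0 T "\<tau> (0 + 1)"] y(2) mx by simp
    finally have "0 < (T - \<tau> (0 + 1)) * co i (oth i y) w" using i y(1) mx(5) oth(1)[OF i, of y] by simp
    then show "T < \<tau> (0 + 1)" using y(3) mx by (simp add: zero_less_mult_iff)
  qed (use mx in simp_all)
  obtain a' where a': "0 < a'" "dom 0 (T + a')"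
    using right_room[of 0 T] sd mx(2,3) by (auto simp: sdom_def)
  \<comment> \<open>The stretch from \<open>T\<close> to \<open>q\<close> lies both in the straight
    part of \<open>c\<close> and in the time interval of piece 0.\<close>
  define q where "q = T + min a a'"
  have q: "T < q" "q \<le> T + a" "q \<le> T + a'" using T(1) a' by (auto simp: q_def)
  have TD: "{T..q} \<subseteq> D" using T(2) q T(1) by auto
  have near: "c r = curve r" if r: "r \<in> {T..q}" for r
  proof -
    have "dom 0 r" using dom_between[OF sdom_dom[OF sd] a'(2)] r q by simp
    then have "curve r = pnt (cn 0) (line 0 r)" by (rule curve_eq)
    moreover have "c r = pnt i (b + r *\<^sub>R w)" using straight_at[OF T(3), of r] r q T(1) by simp
    ultimately show ?thesis using line0 mx(5) by simp
  qed
  have D: "\<forall>t\<in>D. curve t = c t" using agree_everywhere[OF g q(1) TD near] by simp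
  \<comment> \<open>Any extension agrees with \<open>c\<close>, and hence with the chain, on the
    stretch from \<open>T\<close> to \<open>q\<close>; this already determines it on the whole
    line.\<close>
  have unique: "\<gamma>' = curve" if h: "geodesic M x UNIV \<gamma>'" "\<forall>t\<in>D. \<gamma>' t = c t" for \<gamma>'
  proof
    fix t
    obtain \<kappa>' where g': "geo \<kappa>' UNIV \<gamma>'" using h(1) geodesic_geo by blast
    show "\<gamma>' t = curve t"
      by (rule agree_everywhere[OF g' q(1) _ _ UNIV_I]) (use h(2) near TD in auto)
  qed
  have geod: "geodesic M x UNIV curve" using curve_geo geodesic_geo by blast
  show ?thesis
  proof (rule exI[of _ curve], rule conjI[OF geod], rule conjI[OF D], rule conjI[OF _ curve_decomposition])
    show "\<forall>\<gamma>'. geodesic M x UNIV \<gamma>' \<and> (\<forall>t\<in>D. \<gamma>' t = c t) \<longrightarrow> \<gamma>' = curve" using unique by blast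
  qed
qed

end
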